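(* Let $(X_\sigma,f_\sigma)_{\sigma\in A}$ be a combinatorial Seshadri stratification on $X_P$ and fix a linearization $>^t$ of the partial order on $A$. Let $\nu$ be the quasi-valuation on $\mathbb K[\hat X_P]$ associated to the combinatorial Seshadri stratification (defined via weight coordinates), and let $\mathcal V$ be the quasi-valuation on $\mathbb K[\hat X_P]$ defined via successive vanishing multiplicities. For all $g\in\mathbb K[\hat X_P]\setminus\{0\}$ one has $\mathcal V(g)=\nu(g)$.
   Context: Toric variety. $\mathbb K$ is an algebraically closed field of characteristic zero, $T\simeq(\mathbb K^* )^n$ is a torus with character lattice $M$, $M_{\mathbb R}=M\otimes_{\mathbb Z}\mathbb R$. $P\subseteq M_{\mathbb R}$ is a full dimensional normal lattice polytope, $\Lambda=P\cap M$, $V=\mathbb K^\Lambda$ with standard basis $\{e_\chi\}_{\chi\in\Lambda}$ and dual coordinates $x_\chi$. $X_P\subseteq\mathbb P(V)$ is the Zariski closure of the image of $T\to\mathbb P(V)$, $t\mapsto[\sum_{\chi\in\Lambda}\chi(t)e_\chi]$; $\hat X_P\subseteq V$ is its affine cone and $\mathbb K[\hat X_P]$ the coordinate ring of the cone (the homogeneous coordinate ring of $X_P$), graded by degree. $\hat T=\mathbb K^*\times T$, with character lattice $\hat M=\mathbb Z\oplus M$, acts on $V$ by $(c,t)\cdot e_\chi=c\chi(t)e_\chi$ and on functions by $(\hat t\cdot g)(x)=g(\hat t^{-1}x)$; so $x_\chi|_{\hat X_P}$ has weight $(-1,-\chi)$. A (nonzero) $\hat T$-eigenfunction $g$ is homogeneous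 and its weight $\lambda_g$ has first entry $-\deg g$. $M_{\mathbb R}$ is identified with $\{1\}\times M_{\mathbb R}\subset\mathbb R\oplus M_{\mathbb R}$. Stratification. $A$ is the set of (nonempty) faces of $P$, including $P$, ordered by inclusion; $\sigma^o$ is the relative interior of $\sigma$; $X_\sigma$ is the Zariski closure of the $T$-orbit $\{[\sum_{\chi\in\Lambda\cap\sigma}\chi(t)e_\chi]\mid t\in T\}$ and $\hat X_\sigma$ its affine cone. A combinatorial Seshadri stratification on $X_P$ is a collection $(X_\sigma,f_\sigma)_{\sigma\in A}$ where each $f_\sigma\in\mathbb K[\hat X_P]\setminus\{0\}$ is a $\hat T$-eigenfunction with $\deg f_\sigma\ge1$ whose $\hat T$-weight $\mu_\sigma$ satisfies $\frac{-\mu_\sigma}{\deg f_\sigma}\in\sigma^o$. The quasi-valuation $\nu$. For a maximal chain $\mathfrak C=\{\tau_r>\dots>\tau_0\}$ in $A$ the weights $\mu_{\tau_r},\dots,\mu_{\tau_0}$ form a $\mathbb Q$-basis of $\hat M_{\mathbb Q}$. $\mathbb Q^{\mathfrak C}$ is the subspace of $\mathbb Q^A$ (standard basis $e_\sigma$, $\sigma\in A$) spanned by $e_\sigma$, $\sigma\in\mathfrak C$. For a $\hat T$-eigenfunction $g$ of weight $\lambda_g=\sum_i a_i\mu_{\tau_i}$ put $\nu_{\mathfrak C}(g)=\sum_i a_ie_{\tau_i}$; for general $g\ne0$ take the minimum of the values on the $\hat T$-weight components of $g$. Minima are with respect to the lexicographic order on $\mathbb Q^A$ induced by a fixed total order $>^t$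 on $A$ refining the partial order (the coordinate at the $>^t$-largest element is compared first). $\nu(g)=\min\{\nu_{\mathfrak C}(g)\mid\mathfrak C\text{ a maximal chain in }A\}$. The quasi-valuation $\mathcal V$. For a maximal chain $\mathfrak C:\tau_r=P>\tau_{r-1}>\dots>\tau_0$, let $\mathcal V_i$ ($i\ge1$) be the discrete valuation on $\mathbb K(\hat X_{\tau_i})\setminus\{0\}$ giving the vanishing multiplicity along the prime divisor $\hat X_{\tau_{i-1}}$ ($\hat X_{\tau_i}$ is smooth in codimension one), and let $\mathcal V_0$ be the vanishing multiplicity at the origin on $\mathbb K(\hat X_{\tau_0})\setminus\{0\}$ ($\hat X_{\tau_0}\simeq\mathbb A^1$). Put $b_i=\mathcal V_i(f_{\tau_i}|_{\hat X_{\tau_i}})$. For $g\in\mathbb K(\hat X_P)\setminus\{0\}$ define $g_r=g$ and, inductively, $g_{i-1}=\left.\frac{g_i^{b_i}}{f_{\tau_i}^{\mathcal V_i(g_i)}}\right|_{\hat X_{\tau_{i-1}}}\in\mathbb K(\hat X_{\tau_{i-1}})\setminus\{0\}$. Set $$\mathcal V_{\mathfrak C}(g)=\frac{\mathcal V_r(g_r)}{b_r}e_{\tau_r}+\frac{\mathcal V_{r-1}(g_{r-1})}{b_rb_{r-1}}e_{\tau_{r-1}}+\dots+\frac{\mathcal V_0(g_0)}{b_r\cdots b_0}e_{\tau_0}\in\mathbb Q^{\mathfrak C}\subseteq\mathbb Q^A,$$ and $\mathcal V(g)=\min\{\mathcal V_{\mathfrak C}(g)\mid\mathfrak C\text{ a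 maximal chain in }A\}$, with the same order on $\mathbb Q^A$. *)

theory Defs
  imports "HOL-Analysis.Analysis" "HOL-Algebra.Ideal_Product" "HOL-Library.Poly_Mapping"
begin

section \<open>Fraction fields and the valuation of a prime of height one\<close>

definition frac_rel :: "('a, 'b) ring_scheme \<Rightarrow> (('a \<times> 'a) \<times> ('a \<times> 'a)) set" where
  "frac_rel R = {((a, b), (c, d)). a \<in> carrier R \<and> b \<in> carrier R - {\<zero>\<^bsub>R\<^esub>} \<and>
     c \<in> carrier R \<and> d \<in> carrier R - {\<zero>\<^bsub>R\<^esub>} \<and> a \<otimes>\<^bsub>R\<^esub> d = c \<otimes>\<^bsub>R\<^esub> b}"

definition fraction :: "('a, 'b) ring_scheme \<Rightarrow> 'a \<Rightarrow> 'a \<Rightarrow> ('a \<times> 'a) set" where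
  "fraction R a b = frac_rel R `` {(a, b)}"

definition frac_field :: "('a, 'b) ring_scheme \<Rightarrow> ('a \<times> 'a) set ring" where
  "frac_field R =
    \<lparr> carrier = (carrier R \<times> (carrier R - {\<zero>\<^bsub>R\<^esub>})) // frac_rel R,
      monoid.mult = (\<lambda>\<phi> \<psi>. \<Union>(a, b)\<in>\<phi>. \<Union>(c, d)\<in>\<psi>. fraction R (a \<otimes>\<^bsub>R\<^esub> c) (b \<otimes>\<^bsub>R\<^esub> d)),
      one = fraction R \<one>\<^bsub>R\<^esub> \<one>\<^bsub>R\<^esub>,
      zero = fraction R \<zero>\<^bsub>R\<^esub> \<one>\<^bsub>R\<^esub>,
      add = (\<lambda>\<phi> \<psi>. \<Union>(a, b)\<in>\<phi>. \<Union>(c, d)\<in>\<psi>.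
               fraction R (a \<otimes>\<^bsub>R\<^esub> d \<oplus>\<^bsub>R\<^esub> c \<otimes>\<^bsub>R\<^esub> b) (b \<otimes>\<^bsub>R\<^esub> d)) \<rparr>"

definition ideal_pow :: "('a, 'b) ring_scheme \<Rightarrow> 'a set \<Rightarrow> nat \<Rightarrow> 'a set" where
  "ideal_pow R I n = ((\<lambda>J. ideal_prod R I J) ^^ n) (carrier R)"

text \<open>
  An element \<open>a\<close> of \<open>R\<close> lies in the \<open>n\<close>-th power of the maximal ideal of the localization of
  \<open>R\<close> at the prime \<open>Q\<close> iff \<open>s a \<in> Q^n\<close> for some \<open>s \<notin> Q\<close>.  So if this localization is a
  discrete valuation ring, \<open>ord_at R Q\<close> is its valuation on \<open>R\<close>, and \<open>val_at R Q\<close> the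
  extension of it to the nonzero elements of the fraction field.
\<close>

definition ord_at :: "('a, 'b) ring_scheme \<Rightarrow> 'a set \<Rightarrow> 'a \<Rightarrow> nat" where
  "ord_at R Q a = (GREATEST n. \<exists>s\<in>carrier R - Q. s \<otimes>\<^bsub>R\<^esub> a \<in> ideal_pow R Q n)"

definition val_at :: "('a, 'b) ring_scheme \<Rightarrow> 'a set \<Rightarrow> ('a \<times> 'a) set \<Rightarrow> int" where
  "val_at R Q \<phi> = (THE k. \<exists>a\<in>carrier R - {\<zero>\<^bsub>R\<^esub>}. \<exists>b\<in>carrier R - {\<zero>\<^bsub>R\<^esub>}.
     \<phi> = fraction R a b \<and> k = int (ord_at R Q a) - int (ord_at R Q b))"


section \<open>Affine and projective varieties\<close>

text \<open>
  Polynomials in variables indexed by \<open>'c\<close> are finitely supported functions on the exponents.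
  The vector space \<open>K^L\<close>, for \<open>L :: 'c set\<close>, consists of the functions vanishing outside \<open>L\<close>.
\<close>

type_synonym ('c, 'k) mpoly = "('c \<Rightarrow>\<^sub>0 nat) \<Rightarrow>\<^sub>0 'k"
type_synonym ('c, 'k) regfun = "('c \<Rightarrow> 'k) \<Rightarrow> 'k"
type_synonym ('c, 'k) ratfun = "(('c, 'k) regfun \<times> ('c, 'k) regfun) set"

definition coord_space :: "'c set \<Rightarrow> ('c \<Rightarrow> 'k::field) set" where
  "coord_space L = {v. \<forall>\<xi>. \<xi> \<notin> L \<longrightarrow> v \<xi> = 0}"

definition polys :: "'c set \<Rightarrow> ('c, 'k::field) mpoly set" where
  "polys L = {p. \<forall>m\<in>Poly_Mapping.keys p. Poly_Mapping.keys m \<subseteq> L}"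

definition poly_eval :: "('c, 'k::field) mpoly \<Rightarrow> ('c, 'k) regfun" where
  "poly_eval p v = (\<Sum>m\<in>Poly_Mapping.keys p. Poly_Mapping.lookup p m * (\<Prod>\<xi>\<in>Poly_Mapping.keys m. v \<xi> ^ Poly_Mapping.lookup m \<xi>))"

definition homogeneous :: "nat \<Rightarrow> ('c, 'k::field) mpoly \<Rightarrow> bool" where
  "homogeneous d p \<longleftrightarrow> (\<forall>m\<in>Poly_Mapping.keys p. (\<Sum>\<xi>\<in>Poly_Mapping.keys m. Poly_Mapping.lookup m \<xi>) = d)"

definition proj_pt :: "('c \<Rightarrow> 'k::field) \<Rightarrow> ('c \<Rightarrow> 'k) set" where
  "proj_pt v = {w. \<exists>c. c \<noteq> 0 \<and> w = (\<lambda>\<xi>. c * v \<xi>)}"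

definition proj_space :: "'c set \<Rightarrow> ('c \<Rightarrow> 'k::field) set set" where
  "proj_space L = proj_pt ` (coord_space L - {\<lambda>_. 0})"

definition proj_closed :: "'c set \<Rightarrow> ('c \<Rightarrow> 'k::field) set set \<Rightarrow> bool" where
  "proj_closed L Y \<longleftrightarrow> (\<exists>S\<subseteq>polys L. (\<forall>p\<in>S. \<exists>d. homogeneous d p) \<and>
     Y = {q \<in> proj_space L. \<forall>p\<in>S. \<forall>v\<in>q. poly_eval p v = 0})"

definition proj_closure :: "'c set \<Rightarrow> ('c \<Rightarrow> 'k::field) set set \<Rightarrow> ('c \<Rightarrow> 'k) set set" where
  "proj_closure L Y = \<Inter>{Z. proj_closed L Z \<and> Y \<subseteq> Z}"

definition affine_cone :: "'c set \<Rightarrow> ('c \<Rightarrow> 'k::field) set set \<Rightarrow> ('c \<Rightarrow> 'k) set" where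
  "affine_cone L Y = {v \<in> coord_space L. v = (\<lambda>_. 0) \<or> proj_pt v \<in> Y}"

text \<open>The coordinate ring of a closed subset \<open>Z\<close> of \<open>K^L\<close>: the restrictions to \<open>Z\<close> of
  polynomial functions, as extensional functions on \<open>Z\<close>.\<close>

definition coord_ring :: "'c set \<Rightarrow> ('c \<Rightarrow> 'k::field) set \<Rightarrow> ('c, 'k) regfun ring" where
  "coord_ring L Z =
    \<lparr> carrier = {restrict (poly_eval p) Z | p. p \<in> polys L},
      monoid.mult = (\<lambda>a b. \<lambda>x\<in>Z. a x * b x),
      one = (\<lambda>x\<in>Z. 1),
      zero = (\<lambda>x\<in>Z. 0),
      add = (\<lambda>a b. \<lambda>x\<in>Z. a x + b x) \<rparr>"

definition function_field :: "'c set \<Rightarrow> ('c \<Rightarrow> 'k::field) set \<Rightarrow> ('c, 'k) ratfun ring" where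
  "function_field L Z = frac_field (coord_ring L Z)"

definition vanishing_ideal ::
    "'c set \<Rightarrow> ('c \<Rightarrow> 'k::field) set \<Rightarrow> ('c \<Rightarrow> 'k) set \<Rightarrow> ('c, 'k) regfun set" where
  "vanishing_ideal L Z D = {a \<in> carrier (coord_ring L Z). \<forall>x\<in>D. a x = 0}"

definition vanishing_mult ::
    "'c set \<Rightarrow> ('c \<Rightarrow> 'k::field) set \<Rightarrow> ('c \<Rightarrow> 'k) set \<Rightarrow> ('c, 'k) ratfun \<Rightarrow> int" where
  "vanishing_mult L Z D \<phi> = val_at (coord_ring L Z) (vanishing_ideal L Z D) \<phi>"

text \<open>The restriction to \<open>D\<close> of a rational function on \<open>Z\<close>; it is meaningful if the
  rational function is regular at the generic point of \<open>D\<close>.\<close>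

definition rat_restrict ::
    "'c set \<Rightarrow> ('c \<Rightarrow> 'k::field) set \<Rightarrow> ('c \<Rightarrow> 'k) set \<Rightarrow> ('c, 'k) ratfun \<Rightarrow> ('c, 'k) ratfun" where
  "rat_restrict L Z D \<phi> = (THE \<psi>. \<exists>a\<in>carrier (coord_ring L Z).
     \<exists>s\<in>carrier (coord_ring L Z) - vanishing_ideal L Z D.
       \<phi> = fraction (coord_ring L Z) a s \<and>
       \<psi> = fraction (coord_ring L D) (restrict a D) (restrict s D))"


section \<open>Toric varieties of lattice polytopes\<close>

text \<open>The character lattice is \<open>M = int ^ 'n\<close>, and \<open>real ^ 'n\<close> is \<open>M\<close> tensored with the reals.\<close>

definition real_vec :: "int ^ 'n \<Rightarrow> real ^ 'n" where
  "real_vec \<xi> = (\<chi> i. real_of_int (\<xi> $ i))"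

definition lattice_points :: "(real ^ 'n) set \<Rightarrow> (int ^ 'n) set" where
  "lattice_points S = {\<xi>. real_vec \<xi> \<in> S}"

definition lattice_polytope :: "(real ^ 'n) set \<Rightarrow> bool" where
  "lattice_polytope P \<longleftrightarrow> (\<exists>S. finite S \<and> P = convex hull (real_vec ` S))"

definition normal_polytope :: "(real ^ 'n) set \<Rightarrow> bool" where
  "normal_polytope P \<longleftrightarrow> (\<forall>k l :: nat.
     {\<xi> + \<psi> | \<xi> \<psi>. \<xi> \<in> lattice_points ((*\<^sub>R) (real k) ` P) \<and> \<psi> \<in> lattice_points ((*\<^sub>R) (real l) ` P)}
     = lattice_points ((*\<^sub>R) (real (k + l)) ` P))"

definition faces :: "(real ^ 'n) set \<Rightarrow> (real ^ 'n) set set" where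
  "faces P = {\<sigma>. \<sigma> face_of P \<and> \<sigma> \<noteq> {}}"

definition torus :: "('k::field ^ 'n) set" where
  "torus = {t. \<forall>i. t $ i \<noteq> 0}"

definition character :: "int ^ 'n \<Rightarrow> 'k::field ^ 'n \<Rightarrow> 'k" where
  "character \<xi> t = (\<Prod>i\<in>UNIV. t $ i powi \<xi> $ i)"

definition orbit_vec :: "(real ^ 'n) set \<Rightarrow> 'k::field ^ 'n \<Rightarrow> int ^ 'n \<Rightarrow> 'k" where
  "orbit_vec \<sigma> t = (\<lambda>\<xi>. if \<xi> \<in> lattice_points \<sigma> then character \<xi> t else 0)"

definition toric_variety :: "(real ^ 'n) set \<Rightarrow> (real ^ 'n) set \<Rightarrow> (int ^ 'n \<Rightarrow> 'k::field) set set" where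
  "toric_variety P \<sigma> = proj_closure (lattice_points P) {proj_pt (orbit_vec \<sigma> t) | t. t \<in> torus}"

definition toric_cone :: "(real ^ 'n) set \<Rightarrow> (real ^ 'n) set \<Rightarrow> (int ^ 'n \<Rightarrow> 'k::field) set" where
  "toric_cone P \<sigma> = affine_cone (lattice_points P) (toric_variety P \<sigma>)"

definition toric_ring ::
    "(real ^ 'n) set \<Rightarrow> (real ^ 'n) set \<Rightarrow> (int ^ 'n, 'k::field) regfun ring" where
  "toric_ring P \<sigma> = coord_ring (lattice_points P) (toric_cone P \<sigma>)"

definition toric_field ::
    "(real ^ 'n) set \<Rightarrow> (real ^ 'n) set \<Rightarrow> (int ^ 'n, 'k::field) ratfun ring" where
  "toric_field P \<sigma> = function_field (lattice_points P) (toric_cone P \<sigma>)"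


section \<open>The extended torus, weights and degrees\<close>

definition hat_torus :: "('k::field \<times> ('k ^ 'n)) set" where
  "hat_torus = {(c, t). c \<noteq> 0 \<and> t \<in> torus}"

definition hat_inverse :: "'k::field \<times> ('k ^ 'n) \<Rightarrow> 'k \<times> ('k ^ 'n)" where
  "hat_inverse = (\<lambda>(c, t). (inverse c, \<chi> i. inverse (t $ i)))"

definition hat_act :: "'k::field \<times> ('k ^ 'n) \<Rightarrow> (int ^ 'n \<Rightarrow> 'k) \<Rightarrow> (int ^ 'n \<Rightarrow> 'k)" where
  "hat_act = (\<lambda>(c, t) v. \<lambda>\<xi>. c * character \<xi> t * v \<xi>)"

definition hat_character :: "int \<times> (int ^ 'n) \<Rightarrow> 'k::field \<times> ('k ^ 'n) \<Rightarrow> 'k" where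
  "hat_character = (\<lambda>(d, \<xi>) (c, t). c powi d * character \<xi> t)"

definition real_hat :: "int \<times> (int ^ 'n) \<Rightarrow> real \<times> (real ^ 'n)" where
  "real_hat = (\<lambda>(d, \<xi>). (real_of_int d, real_vec \<xi>))"

definition has_weight ::
    "(real ^ 'n) set \<Rightarrow> (int ^ 'n, 'k::field) regfun \<Rightarrow> int \<times> (int ^ 'n) \<Rightarrow> bool" where
  "has_weight P g \<mu> \<longleftrightarrow> g \<in> carrier (toric_ring P P) - {\<zero>\<^bsub>toric_ring P P\<^esub>} \<and>
     (\<forall>s\<in>hat_torus. \<forall>x\<in>toric_cone P P. g (hat_act (hat_inverse s) x) = hat_character \<mu> s * g x)"

definition eigenfunction :: "(real ^ 'n) set \<Rightarrow> (int ^ 'n, 'k::field) regfun \<Rightarrow> bool" where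
  "eigenfunction P g \<longleftrightarrow> (\<exists>\<mu>. has_weight P g \<mu>)"

definition weight :: "(real ^ 'n) set \<Rightarrow> (int ^ 'n, 'k::field) regfun \<Rightarrow> int \<times> (int ^ 'n)" where
  "weight P g = (THE \<mu>. has_weight P g \<mu>)"

definition deg :: "(real ^ 'n) set \<Rightarrow> (int ^ 'n, 'k::field) regfun \<Rightarrow> nat" where
  "deg P g = (THE d. \<exists>p\<in>polys (lattice_points P).
     homogeneous d p \<and> g = restrict (poly_eval p) (toric_cone P P))"


section \<open>Combinatorial Seshadri stratifications\<close>

text \<open>The varieties \<open>X_\<sigma>\<close> are determined by \<open>P\<close>, so the functions \<open>f_\<sigma>\<close> are the only data.\<close>

definition comb_seshadri_strat ::
    "(real ^ 'n) set \<Rightarrow> ((real ^ 'n) set \<Rightarrow> (int ^ 'n, 'k::field) regfun) \<Rightarrow> bool" where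
  "comb_seshadri_strat P f \<longleftrightarrow> (\<forall>\<sigma>\<in>faces P.
     f \<sigma> \<in> carrier (toric_ring P P) - {\<zero>\<^bsub>toric_ring P P\<^esub>} \<and>
     eigenfunction P (f \<sigma>) \<and> deg P (f \<sigma>) \<ge> 1 \<and>
     (- 1 / real (deg P (f \<sigma>))) *\<^sub>R real_hat (weight P (f \<sigma>)) \<in> {1} \<times> rel_interior \<sigma>)"

text \<open>\<open>(\<sigma>, \<tau>) \<in> t\<close> means that \<open>\<sigma>\<close> is less than or equal to \<open>\<tau>\<close> in the total order.\<close>

definition linearization :: "(real ^ 'n) set \<Rightarrow> (real ^ 'n) set rel \<Rightarrow> bool" where
  "linearization P t \<longleftrightarrow> linear_order_on (faces P) t \<and>
     (\<forall>\<sigma>\<in>faces P. \<forall>\<tau>\<in>faces P. \<sigma> \<subseteq> \<tau> \<longrightarrow> (\<sigma>, \<tau>) \<in> t)"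

text \<open>Vectors indexed by a set \<open>A\<close> are functions vanishing outside \<open>A\<close>.\<close>

definition lex_less :: "'a set \<Rightarrow> 'a rel \<Rightarrow> ('a \<Rightarrow> rat) \<Rightarrow> ('a \<Rightarrow> rat) \<Rightarrow> bool" where
  "lex_less A t u v \<longleftrightarrow> (\<exists>\<sigma>\<in>A. u \<sigma> < v \<sigma> \<and>
     (\<forall>\<tau>\<in>A. (\<sigma>, \<tau>) \<in> t \<and> \<tau> \<noteq> \<sigma> \<longrightarrow> u \<tau> = v \<tau>))"

definition lex_min :: "'a set \<Rightarrow> 'a rel \<Rightarrow> ('a \<Rightarrow> rat) set \<Rightarrow> ('a \<Rightarrow> rat)" where
  "lex_min A t S = (THE u. u \<in> S \<and> (\<forall>v\<in>S. v = u \<or> lex_less A t u v))"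

definition max_chains :: "(real ^ 'n) set \<Rightarrow> (real ^ 'n) set set set" where
  "max_chains P = {C. subset.maxchain (faces P) C}"


subsection \<open>The quasi-valuation given by weights\<close>

definition weight_components ::
    "(real ^ 'n) set \<Rightarrow> (int ^ 'n, 'k::field) regfun \<Rightarrow> (int ^ 'n, 'k) regfun set" where
  "weight_components P g = (THE G. finite G \<and> (\<forall>h\<in>G. eigenfunction P h) \<and>
     inj_on (weight P) G \<and> g = (\<lambda>x\<in>toric_cone P P. \<Sum>h\<in>G. h x))"

definition weight_coords ::
    "(real ^ 'n) set \<Rightarrow> ((real ^ 'n) set \<Rightarrow> (int ^ 'n, 'k::field) regfun) \<Rightarrow> (real ^ 'n) set set \<Rightarrow>
     (int ^ 'n, 'k) regfun \<Rightarrow> (real ^ 'n) set \<Rightarrow> rat" where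
  "weight_coords P f C h = (THE a. (\<forall>\<sigma>. \<sigma> \<notin> C \<longrightarrow> a \<sigma> = 0) \<and>
     real_hat (weight P h) = (\<Sum>\<tau>\<in>C. real_of_rat (a \<tau>) *\<^sub>R real_hat (weight P (f \<tau>))))"

text \<open>An eigenfunction is its only weight component, so on eigenfunctions this is
  \<^const>\<open>weight_coords\<close>.\<close>

definition nu_chain ::
    "(real ^ 'n) set \<Rightarrow> ((real ^ 'n) set \<Rightarrow> (int ^ 'n, 'k::field) regfun) \<Rightarrow> (real ^ 'n) set rel \<Rightarrow>
     (real ^ 'n) set set \<Rightarrow> (int ^ 'n, 'k) regfun \<Rightarrow> (real ^ 'n) set \<Rightarrow> rat" where
  "nu_chain P f t C g = lex_min (faces P) t (weight_coords P f C ` weight_components P g)"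

definition quasi_nu ::
    "(real ^ 'n) set \<Rightarrow> ((real ^ 'n) set \<Rightarrow> (int ^ 'n, 'k::field) regfun) \<Rightarrow> (real ^ 'n) set rel \<Rightarrow>
     (int ^ 'n, 'k) regfun \<Rightarrow> (real ^ 'n) set \<Rightarrow> rat" where
  "quasi_nu P f t g = lex_min (faces P) t {nu_chain P f t C g | C. C \<in> max_chains P}"


subsection \<open>The quasi-valuation given by successive vanishing multiplicities\<close>

text \<open>The divisor in the cone of the first member of a decreasing chain along which the
  vanishing multiplicity is taken; for the last member, a vertex, it is the origin.\<close>

definition next_cone ::
    "(real ^ 'n) set \<Rightarrow> (real ^ 'n) set list \<Rightarrow> (int ^ 'n \<Rightarrow> 'k::field) set" where
  "next_cone P \<tau>s = (case \<tau>s of [] \<Rightarrow> {\<lambda>_. 0} | \<rho> # _ \<Rightarrow> toric_cone P \<rho>)"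

text \<open>
  \<open>succ_vanishing P f [\<tau>_i, ..., \<tau>_0] \<phi> B\<close> collects the coordinates at \<open>\<tau>_i, ..., \<tau>_0\<close>, where
  \<open>\<phi> = g_i\<close> and \<open>B = b_r * ... * b_(i+1)\<close>.  Below, \<open>k\<close> is the multiplicity of \<open>g_i\<close> and \<open>b\<close>
  is \<open>b_i\<close>.
\<close>

primrec succ_vanishing ::
    "(real ^ 'n) set \<Rightarrow> ((real ^ 'n) set \<Rightarrow> (int ^ 'n, 'k::field) regfun) \<Rightarrow> (real ^ 'n) set list \<Rightarrow>
     (int ^ 'n, 'k) ratfun \<Rightarrow> int \<Rightarrow> (real ^ 'n) set \<Rightarrow> rat" where
  "succ_vanishing P f [] \<phi> B = (\<lambda>_. 0)"
| "succ_vanishing P f (\<tau> # \<tau>s) \<phi> B =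
    (let L = lattice_points P; Z = toric_cone P \<tau>; D = next_cone P \<tau>s; K = toric_field P \<tau>;
         F = fraction (toric_ring P \<tau>) (restrict (f \<tau>) Z) \<one>\<^bsub>toric_ring P \<tau>\<^esub>;
         k = vanishing_mult L Z D \<phi>;
         b = vanishing_mult L Z D F;
         \<psi> = rat_restrict L Z D ((\<phi> [^]\<^bsub>K\<^esub> b) \<otimes>\<^bsub>K\<^esub> inv\<^bsub>K\<^esub> (F [^]\<^bsub>K\<^esub> k))
     in (succ_vanishing P f \<tau>s \<psi> (B * b)) (\<tau> := of_int k / of_int (B * b)))"

definition desc_list :: "(real ^ 'n) set set \<Rightarrow> (real ^ 'n) set list" where
  "desc_list C = (THE \<tau>s. set \<tau>s = C \<and> sorted_wrt (\<supset>) \<tau>s)"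

definition V_chain ::
    "(real ^ 'n) set \<Rightarrow> ((real ^ 'n) set \<Rightarrow> (int ^ 'n, 'k::field) regfun) \<Rightarrow> (real ^ 'n) set set \<Rightarrow>
     (int ^ 'n, 'k) ratfun \<Rightarrow> (real ^ 'n) set \<Rightarrow> rat" where
  "V_chain P f C \<phi> = succ_vanishing P f (desc_list C) \<phi> 1"

definition quasi_V ::
    "(real ^ 'n) set \<Rightarrow> ((real ^ 'n) set \<Rightarrow> (int ^ 'n, 'k::field) regfun) \<Rightarrow> (real ^ 'n) set rel \<Rightarrow>
     (int ^ 'n, 'k) regfun \<Rightarrow> (real ^ 'n) set \<Rightarrow> rat" where
  "quasi_V P f t g = lex_min (faces P) t
     {V_chain P f C (fraction (toric_ring P P) g \<one>\<^bsub>toric_ring P P\<^esub>) | C. C \<in> max_chains P}"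

end

theory Submission
  imports Defs
begin

text \<open>
  Both quasi-valuations are minima over the maximal chains of faces, and they agree on every single
  chain.

  A polynomial function on the cone over \<open>X_\<sigma>\<close> is determined by its values on the orbit of the
  extended torus, where it becomes a Laurent polynomial.  Since \<open>P\<close> is normal, the exponents that
  occur are all lattice points of the cone over \<open>\<sigma>\<close>: the coordinate ring is the semigroup ring of
  these lattice points (\<open>toric_semigroup_ring\<close>), the restriction to the cone of a smaller face keeps
  the terms whose exponents lie over that face, and the torus eigenfunctions are the monomials.  So
  \<open>f_\<sigma>\<close> is a multiple of the monomial with exponent \<open>M \<sigma> = - \<mu>_\<sigma>\<close>, and \<open>\<nu>\<close> along a chain is the
  lexicographic minimum, over the exponents of \<open>g\<close>, of the coordinates in the basis
  \<open>M \<tau>_r, ..., M \<tau>_0\<close>.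

  The vanishing multiplicity along a facet \<open>\<rho>\<close> of \<open>\<tau>\<close> is monomial too: the coordinate at \<open>M \<tau>\<close> is
  nonnegative on the cone over \<open>\<tau>\<close>, vanishes there exactly on the cone over \<open>\<rho>\<close>, and the
  multiplicity is its minimum over the exponents, scaled by the factor \<open>b\<close> that makes it surjective
  onto the integers (\<open>ord_at_eq\<close>, \<open>divisor_of_subflag\<close>).  That factor is the multiplicity of \<open>f_\<tau>\<close>,
  because \<open>M \<tau>\<close> has coordinate 1.

  All these minima are attained at one exponent, the lexicographically least one.  Leading exponents
  add up in products, so a fraction has well-behaved coordinates: those of the leading exponent of
  the numerator minus those of the denominator.  Passing from \<open>g_i\<close> to \<open>g_(i-1)\<close> multiplies the
  coordinates by \<open>b_i\<close> and removes the one at \<open>\<tau>_i\<close>, and the restriction to the divisor keeps the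
  leading exponents.  Hence the successive quotients by \<open>b_r * ... * b_i\<close> are the coordinates of the
  leading exponent of \<open>g\<close> (\<open>succ_vanishing_eq\<close>).
\<close>


section \<open>Finitely supported functions as Laurent polynomials\<close>

abbreviation "keys \<equiv> Poly_Mapping.keys"
abbreviation "lookup \<equiv> Poly_Mapping.lookup"
abbreviation "single \<equiv> Poly_Mapping.single"

lemma poly_mapping_sum_single:
  "(\<Sum>k\<in>keys p. single k (lookup p k)) = p"
proof (rule poly_mapping_eqI)
  fix j
  have "lookup (\<Sum>k\<in>keys p. single k (lookup p k)) j
      = (\<Sum>k\<in>keys p. if k = j then lookup p k else 0)"
    by (simp add: lookup_sum lookup_single when_def)
  also have "\<dots> = lookup p j"
    by (simp add: in_keys_iff)
  finally show "lookup (\<Sum>k\<in>keys p. single k (lookup p k)) j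
      = lookup p j" .
qed

lemma mult_sum_single:
  fixes p q :: "'m::comm_monoid_add \<Rightarrow>\<^sub>0 'k::comm_semiring_0"
  shows "p * q = (\<Sum>a\<in>keys p. \<Sum>b\<in>keys q.
     single (a + b) (lookup p a * lookup q b))"
proof -
  have "p * q = (\<Sum>a\<in>keys p. single a (lookup p a)) *
      (\<Sum>b\<in>keys q. single b (lookup q b))"
    by (simp add: poly_mapping_sum_single)
  then show ?thesis by (simp add: sum_product mult_single)
qed

lemma lookup_mult_keys:
  fixes p q :: "'m::comm_monoid_add \<Rightarrow>\<^sub>0 'k::comm_semiring_0"
  shows "lookup (p * q) k = (\<Sum>a\<in>keys p. \<Sum>b\<in>keys q.
     (if a + b = k then lookup p a * lookup q b else 0))"
  by (subst mult_sum_single) (simp add: lookup_sum lookup_single when_def)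

definition restrict_keys :: "'m set \<Rightarrow> ('m \<Rightarrow>\<^sub>0 'k::zero) \<Rightarrow> ('m \<Rightarrow>\<^sub>0 'k)" where
  "restrict_keys T q = Poly_Mapping.mapp (\<lambda>k c. if k \<in> T then c else 0) q"

lemma lookup_restrict_keys:
  "lookup (restrict_keys T q) k = (if k \<in> T then lookup q k else 0)"
  by (auto simp: restrict_keys_def lookup_mapp when_def in_keys_iff)

lemma keys_restrict_keys: "keys (restrict_keys T q) = keys q \<inter> T"
  by (auto simp: in_keys_iff lookup_restrict_keys split: if_splits)

lemma restrict_keys_id: "keys q \<subseteq> T \<Longrightarrow> restrict_keys T q = q"
  by (rule poly_mapping_eqI) (auto simp: lookup_restrict_keys in_keys_iff subset_iff)

text \<open>The function \<open>w\<close> gives the values of the monomials.  If it is multiplicative on the exponents that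
  occur, this is the evaluation homomorphism.\<close>

definition pm_eval :: "('m \<Rightarrow> 'k) \<Rightarrow> ('m \<Rightarrow>\<^sub>0 'k::comm_semiring_1) \<Rightarrow> 'k" where
  "pm_eval w q = (\<Sum>k\<in>keys q. lookup q k * w k)"

lemma pm_eval_superset:
  assumes "finite F" "keys q \<subseteq> F"
  shows "pm_eval w q = (\<Sum>k\<in>F. lookup q k * w k)"
  unfolding pm_eval_def using assms
  by (intro sum.mono_neutral_left) (auto simp: in_keys_iff)

lemma pm_eval_0 [simp]: "pm_eval w 0 = 0"
  by (simp add: pm_eval_def)

lemma pm_eval_single [simp]: "pm_eval w (single k c) = c * w k"
  by (simp add: pm_eval_def)

lemma pm_eval_add: "pm_eval w (p + q) = pm_eval w p + pm_eval w q"
proof -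
  let ?F = "keys p \<union> keys q"
  have "pm_eval w (p + q) = (\<Sum>k\<in>?F. lookup (p + q) k * w k)"
    by (rule pm_eval_superset) (auto simp: keys_add)
  also have "\<dots> = (\<Sum>k\<in>?F. lookup p k * w k) + (\<Sum>k\<in>?F. lookup q k * w k)"
    by (simp add: lookup_add distrib_right sum.distrib)
  also have "\<dots> = pm_eval w p + pm_eval w q"
    by (simp add: pm_eval_superset [of ?F, symmetric])
  finally show ?thesis .
qed

lemma pm_eval_sum: "pm_eval w (\<Sum>i\<in>I. p i) = (\<Sum>i\<in>I. pm_eval w (p i))"
  by (induction I rule: infinite_finite_induct) (auto simp: pm_eval_add)

lemma pm_eval_mult:
  fixes p q :: "'m::comm_monoid_add \<Rightarrow>\<^sub>0 'k::comm_semiring_1"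
  assumes "\<And>a b. a \<in> keys p \<Longrightarrow> b \<in> keys q \<Longrightarrow> w (a + b) = w a * w b"
  shows "pm_eval w (p * q) = pm_eval w p * pm_eval w q"
proof -
  have "pm_eval w (p * q) = (\<Sum>a\<in>keys p. \<Sum>b\<in>keys q.
     lookup p a * lookup q b * w (a + b))"
    unfolding mult_sum_single [of p q] by (simp add: pm_eval_sum)
  also have "\<dots> = (\<Sum>a\<in>keys p. \<Sum>b\<in>keys q.
     (lookup p a * w a) * (lookup q b * w b))"
    by (intro sum.cong refl) (simp add: assms mult_ac)
  also have "\<dots> = pm_eval w p * pm_eval w q"
    by (simp add: pm_eval_def sum_product)
  finally show ?thesis .
qed

lemma pm_eval_cong:
  "(\<And>k. k \<in> keys q \<Longrightarrow> w k = w' k) \<Longrightarrow> pm_eval w q = pm_eval w' q"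
  by (simp add: pm_eval_def)

lemma pm_eval_restrict_keys:
  assumes "\<And>k. k \<in> keys q \<Longrightarrow> k \<notin> T \<Longrightarrow> w k = 0"
  shows "pm_eval w (restrict_keys T q) = pm_eval w q"
proof -
  have "pm_eval w (restrict_keys T q) = (\<Sum>k\<in>keys q. lookup (restrict_keys T q) k * w k)"
    by (rule pm_eval_superset) (auto simp: keys_restrict_keys)
  also have "\<dots> = pm_eval w q"
    unfolding pm_eval_def by (intro sum.cong refl) (auto simp: lookup_restrict_keys assms)
  finally show ?thesis .
qed


section \<open>Leading exponents\<close>

locale translation_order =
  fixes less :: "'m::ab_group_add \<Rightarrow> 'm \<Rightarrow> bool" (infix "\<sqsubset>" 50)
  assumes irrefl: "\<not> a \<sqsubset> a"
    and trans: "a \<sqsubset> b \<Longrightarrow> b \<sqsubset> c \<Longrightarrow> a \<sqsubset> c"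
    and total: "a \<noteq> b \<Longrightarrow> a \<sqsubset> b \<or> b \<sqsubset> a"
    and translate: "a \<sqsubset> b \<Longrightarrow> a + c \<sqsubset> b + c"
begin

text \<open>Leading means least, since the valuations to be computed are minima over the exponents.\<close>

definition is_lead :: "('m \<Rightarrow>\<^sub>0 'k::zero) \<Rightarrow> 'm \<Rightarrow> bool" where
  "is_lead q m \<longleftrightarrow> m \<in> keys q \<and> (\<forall>k\<in>keys q. k \<noteq> m \<longrightarrow> m \<sqsubset> k)"

lemma finite_has_least:
  "finite F \<Longrightarrow> F \<noteq> {} \<Longrightarrow> \<exists>m\<in>F. \<forall>k\<in>F. k \<noteq> m \<longrightarrow> m \<sqsubset> k"
proof (induction F rule: finite_ne_induct)
  case (insert x F)
  then obtain m where m: "m \<in> F" "\<forall>k\<in>F. k \<noteq> m \<longrightarrow> m \<sqsubset> k" by blast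
  have "x \<noteq> m" using insert m by blast
  then consider "x \<sqsubset> m" | "m \<sqsubset> x" using total by blast
  then show ?case
  proof cases
    case 1
    have "x \<sqsubset> k" if "k \<in> F" for k
      using that 1 m trans [OF 1, of k] by (cases "k = m") auto
    then show ?thesis by blast
  next
    case 2
    then show ?thesis using m by blast
  qed
qed auto

lemma is_lead_exists:
  assumes "q \<noteq> 0" shows "\<exists>m. is_lead q m"
proof -
  have "keys q \<noteq> {}"
    using assms by (metis empty_iff in_keys_iff lookup_zero poly_mapping_eqI)
  from finite_has_least [OF finite_keys this] show ?thesis
    by (auto simp: is_lead_def)
qed

lemma is_lead_unique: "is_lead q m \<Longrightarrow> is_lead q m' \<Longrightarrow> m = m'"
  unfolding is_lead_def using trans [of m m' m] irrefl [of m] by metis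

definition lead :: "('m \<Rightarrow>\<^sub>0 'k::zero) \<Rightarrow> 'm" where
  "lead q = (THE m. is_lead q m)"

lemma is_lead_lead: "q \<noteq> 0 \<Longrightarrow> is_lead q (lead q)"
  unfolding lead_def using is_lead_exists is_lead_unique by (metis theI)

lemma lead_eqI: "is_lead q m \<Longrightarrow> lead q = m"
  unfolding lead_def using is_lead_unique by blast

lemma lead_in_keys: "q \<noteq> 0 \<Longrightarrow> lead q \<in> keys q"
  using is_lead_lead is_lead_def by blast

lemma lead_single: "c \<noteq> 0 \<Longrightarrow> lead (single m c) = m"
  by (rule lead_eqI) (auto simp: is_lead_def)

text \<open>A sum of two exponents equals the sum of the two leading exponents only if both of them
  are leading, so the product of the leading coefficients cannot cancel.\<close>

lemma is_lead_mult:
  fixes p q :: "'m \<Rightarrow>\<^sub>0 'k::idom"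
  assumes p: "is_lead p a" and q: "is_lead q b"
  shows "is_lead (p * q) (a + b)"
proof -
  have le: "a' + b' = a + b \<longleftrightarrow> a' = a \<and> b' = b" "a' + b' \<noteq> a + b \<Longrightarrow> a + b \<sqsubset> a' + b'"
    if "a' \<in> keys p" "b' \<in> keys q" for a' b'
  proof -
    have A: "a' = a \<or> a + b' \<sqsubset> a' + b'"
      using p that(1) translate [of a a' b'] unfolding is_lead_def by blast
    have B: "b' = b \<or> a + b \<sqsubset> a + b'"
      using q that(2) translate [of b b' a] unfolding is_lead_def by (simp add: add.commute) blast
    have *: "a + b \<sqsubset> a' + b'" if "a' \<noteq> a \<or> b' \<noteq> b"
      using A B that trans [of "a + b" "a + b'" "a' + b'"] by blast
    show "a' + b' = a + b \<longleftrightarrow> a' = a \<and> b' = b" using * irrefl [of "a + b"] by fastforce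
    show "a' + b' \<noteq> a + b \<Longrightarrow> a + b \<sqsubset> a' + b'" using * by blast
  qed
  have "lookup (p * q) (a + b) = (\<Sum>a'\<in>keys p. \<Sum>b'\<in>keys q.
     (if a' = a then if b' = b then lookup p a * lookup q b else 0 else 0))"
    unfolding lookup_mult_keys by (intro sum.cong refl) (auto simp: le)
  also have "\<dots> = (\<Sum>a'\<in>keys p. if a' = a then
      \<Sum>b'\<in>keys q. (if b' = b then lookup p a * lookup q b else 0) else 0)"
    by (intro sum.cong refl) auto
  also have "\<dots> = lookup p a * lookup q b"
    using p q by (simp add: is_lead_def)
  finally have "a + b \<in> keys (p * q)"
    using p q by (simp add: is_lead_def in_keys_iff)
  moreover have "a + b \<sqsubset> k" if "k \<in> keys (p * q)" "k \<noteq> a + b" for k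
    using that keys_mult [of p q] le by blast
  ultimately show ?thesis by (auto simp: is_lead_def)
qed

lemma mult_nonzero:
  fixes p q :: "'m \<Rightarrow>\<^sub>0 'k::idom"
  assumes "p \<noteq> 0" "q \<noteq> 0" shows "p * q \<noteq> 0"
proof
  assume "p * q = 0"
  then show False
    using is_lead_mult [OF is_lead_lead [OF assms(1)] is_lead_lead [OF assms(2)]]
    by (simp add: is_lead_def)
qed

lemma lead_mult:
  fixes p q :: "'m \<Rightarrow>\<^sub>0 'k::idom"
  assumes "p \<noteq> 0" "q \<noteq> 0" shows "lead (p * q) = lead p + lead q"
  by (rule lead_eqI) (intro is_lead_mult is_lead_lead assms)

end


section \<open>Fractions over a domain\<close>

context domain
begin

lemma frac_rel_iff:
  "((a, b), (c, d)) \<in> frac_rel R \<longleftrightarrow>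
    a \<in> carrier R \<and> b \<in> carrier R - {\<zero>} \<and> c \<in> carrier R \<and> d \<in> carrier R - {\<zero>} \<and> a \<otimes> d = c \<otimes> b"
  by (simp add: frac_rel_def)

lemma equiv_frac_rel: "equiv (carrier R \<times> (carrier R - {\<zero>})) (frac_rel R)"
proof (rule equivI)
  show "frac_rel R \<subseteq> (carrier R \<times> (carrier R - {\<zero>})) \<times> carrier R \<times> (carrier R - {\<zero>})"
    by (auto simp: frac_rel_def)
  show "refl_on (carrier R \<times> (carrier R - {\<zero>})) (frac_rel R)"
    by (auto simp: refl_on_def frac_rel_def)
  show "sym (frac_rel R)" by (auto simp: sym_def frac_rel_def)
  show "trans (frac_rel R)"
  proof (rule transI, clarify)
    fix a b c d e f
    assume *: "((a, b), (c, d)) \<in> frac_rel R" "((c, d), (e, f)) \<in> frac_rel R"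
    then have [simp]: "a \<in> carrier R" "b \<in> carrier R" "c \<in> carrier R" "d \<in> carrier R" "e \<in> carrier R"
      "f \<in> carrier R" and "d \<noteq> \<zero>" by (auto simp: frac_rel_iff)
    have "d \<otimes> (a \<otimes> f) = (a \<otimes> d) \<otimes> f" by (simp add: m_ac)
    also have "\<dots> = (c \<otimes> f) \<otimes> b" using * by (simp add: frac_rel_iff m_ac)
    also have "\<dots> = d \<otimes> (e \<otimes> b)" using * by (simp add: frac_rel_iff m_ac)
    finally have "a \<otimes> f = e \<otimes> b" using \<open>d \<noteq> \<zero>\<close> by (simp add: m_lcancel)
    then show "((a, b), (e, f)) \<in> frac_rel R" using * by (simp add: frac_rel_iff)
  qed
qed

lemma fraction_eq_iff:
  assumes "a \<in> carrier R" "b \<in> carrier R - {\<zero>}" "c \<in> carrier R" "d \<in> carrier R - {\<zero>}"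
  shows "fraction R a b = fraction R c d \<longleftrightarrow> a \<otimes> d = c \<otimes> b"
proof -
  have "fraction R a b = fraction R c d \<longleftrightarrow> ((a, b), (c, d)) \<in> frac_rel R"
    unfolding fraction_def using equiv_frac_rel assms by (intro eq_equiv_class_iff) auto
  then show ?thesis using assms by (simp add: frac_rel_iff)
qed

lemma fraction_self:
  assumes "a \<in> carrier R" "b \<in> carrier R - {\<zero>}"
  shows "(a, b) \<in> fraction R a b"
  using assms by (simp add: fraction_def frac_rel_iff)

lemma fraction_memD:
  assumes "(c, d) \<in> fraction R a b"
  shows "c \<in> carrier R" "d \<in> carrier R - {\<zero>}" "a \<in> carrier R" "b \<in> carrier R - {\<zero>}" "a \<otimes> d = c \<otimes> b"
  using assms by (auto simp: fraction_def frac_rel_iff)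

lemma fraction_in_frac_field:
  assumes "a \<in> carrier R" "b \<in> carrier R - {\<zero>}"
  shows "fraction R a b \<in> carrier (frac_field R)"
  using assms by (auto simp: frac_field_def fraction_def intro: quotientI)

lemma frac_field_cases:
  assumes "\<phi> \<in> carrier (frac_field R)"
  obtains a b where "a \<in> carrier R" "b \<in> carrier R - {\<zero>}" "\<phi> = fraction R a b"
  using assms by (auto simp: frac_field_def fraction_def elim!: quotientE)

lemma fraction_mult:
  assumes "a \<in> carrier R" "b \<in> carrier R - {\<zero>}" "c \<in> carrier R" "d \<in> carrier R - {\<zero>}"
  shows "fraction R a b \<otimes>\<^bsub>frac_field R\<^esub> fraction R c d = fraction R (a \<otimes> c) (b \<otimes> d)"
proof -
  have eq: "fraction R (x \<otimes> y) (u \<otimes> v) = fraction R (a \<otimes> c) (b \<otimes> d)"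
    if "(x, u) \<in> fraction R a b" "(y, v) \<in> fraction R c d" for x u y v
  proof -
    note X = fraction_memD [OF that(1)] and Y = fraction_memD [OF that(2)]
    have car: "x \<in> carrier R" "u \<in> carrier R" "y \<in> carrier R" "v \<in> carrier R" "a \<in> carrier R"
      "b \<in> carrier R" "c \<in> carrier R" "d \<in> carrier R"
      and nz: "u \<otimes> v \<noteq> \<zero>" "b \<otimes> d \<noteq> \<zero>" using X Y assms integral by auto
    have "(x \<otimes> y) \<otimes> (b \<otimes> d) = (x \<otimes> b) \<otimes> (y \<otimes> d)" using car by (simp add: m_ac)
    also have "\<dots> = (a \<otimes> u) \<otimes> (c \<otimes> v)" using X Y by simp
    also have "\<dots> = (a \<otimes> c) \<otimes> (u \<otimes> v)" using car by (simp add: m_ac)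
    finally show ?thesis using car nz by (subst fraction_eq_iff) auto
  qed
  have "fraction R a b \<otimes>\<^bsub>frac_field R\<^esub> fraction R c d =
     (\<Union>(x, u)\<in>fraction R a b. \<Union>(y, v)\<in>fraction R c d. fraction R (x \<otimes> y) (u \<otimes> v))"
    by (simp add: frac_field_def)
  also have "\<dots> = fraction R (a \<otimes> c) (b \<otimes> d)"
  proof
    show "(\<Union>(x, u)\<in>fraction R a b. \<Union>(y, v)\<in>fraction R c d. fraction R (x \<otimes> y) (u \<otimes> v))
        \<subseteq> fraction R (a \<otimes> c) (b \<otimes> d)" using eq by fastforce
    show "fraction R (a \<otimes> c) (b \<otimes> d) \<subseteq>
        (\<Union>(x, u)\<in>fraction R a b. \<Union>(y, v)\<in>fraction R c d. fraction R (x \<otimes> y) (u \<otimes> v))"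
      using fraction_self [OF assms(1,2)] fraction_self [OF assms(3,4)] by fastforce
  qed
  finally show ?thesis .
qed

lemma fraction_one: "\<one>\<^bsub>frac_field R\<^esub> = fraction R \<one> \<one>"
  by (simp add: frac_field_def)

lemma fraction_inv:
  assumes a: "a \<in> carrier R - {\<zero>}" and b: "b \<in> carrier R - {\<zero>}"
  shows "inv\<^bsub>frac_field R\<^esub> (fraction R a b) = fraction R b a"
  unfolding m_inv_def
proof (rule the_equality)
  show "fraction R b a \<in> carrier (frac_field R) \<and>
      fraction R a b \<otimes>\<^bsub>frac_field R\<^esub> fraction R b a = \<one>\<^bsub>frac_field R\<^esub> \<and>
      fraction R b a \<otimes>\<^bsub>frac_field R\<^esub> fraction R a b = \<one>\<^bsub>frac_field R\<^esub>"
  proof -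
    have "a \<otimes> b \<noteq> \<zero>" "b \<otimes> a \<noteq> \<zero>" using a b integral by auto
    then have "fraction R (a \<otimes> b) (b \<otimes> a) = fraction R \<one> \<one>" "fraction R (b \<otimes> a) (a \<otimes> b) = fraction R \<one> \<one>"
      using a b by (subst fraction_eq_iff; simp add: m_ac)+
    then show ?thesis
      using a b by (simp add: fraction_in_frac_field fraction_mult fraction_one)
  qed
next
  fix y assume y: "y \<in> carrier (frac_field R) \<and>
      fraction R a b \<otimes>\<^bsub>frac_field R\<^esub> y = \<one>\<^bsub>frac_field R\<^esub> \<and>
      y \<otimes>\<^bsub>frac_field R\<^esub> fraction R a b = \<one>\<^bsub>frac_field R\<^esub>"
  then obtain c d where cd: "c \<in> carrier R" "d \<in> carrier R - {\<zero>}" "y = fraction R c d"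
    using frac_field_cases by blast
  have "fraction R (a \<otimes> c) (b \<otimes> d) = fraction R \<one> \<one>"
    using y a b cd by (simp add: fraction_mult fraction_one)
  moreover have "b \<otimes> d \<noteq> \<zero>" using b cd integral by blast
  ultimately have "a \<otimes> c = b \<otimes> d" using a b cd by (simp add: fraction_eq_iff)
  then show "y = fraction R b a" using a b cd by (simp add: fraction_eq_iff m_ac)
qed

end


section \<open>Rings of Laurent polynomials with exponents in a semigroup\<close>

primrec multiple :: "nat \<Rightarrow> 'm::comm_monoid_add \<Rightarrow> 'm" where
  "multiple 0 m = 0"
| "multiple (Suc n) m = m + multiple n m"

lemma multiple_add: "multiple (a + b) m = multiple a m + multiple b m"
  by (induction a) (auto simp: add.assoc)

definition laurents :: "'m set \<Rightarrow> ('m \<Rightarrow>\<^sub>0 'k::zero) set" where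
  "laurents S = {q. keys q \<subseteq> S}"

lemma zero_in_laurents [simp]: "0 \<in> laurents S"
  by (simp add: laurents_def)

lemma single_in_laurents: "m \<in> S \<Longrightarrow> single m c \<in> laurents S"
  by (simp add: laurents_def)

lemma add_in_laurents: "p \<in> laurents S \<Longrightarrow> q \<in> laurents S \<Longrightarrow> p + q \<in> laurents S"
  using keys_add [of p q] by (auto simp: laurents_def)

text \<open>The isomorphism \<open>\<Psi>\<close> identifies \<open>R\<close> with the semigroup ring of \<open>S\<close>.  The additive functions
  \<open>c\<close> are the coordinates in which leading exponents are recorded.\<close>

locale semigroup_ring = translation_order less
  for less :: "'m::ab_group_add \<Rightarrow> 'm \<Rightarrow> bool" (infix "\<sqsubset>" 50) +
  fixes R :: "('r, 'x) ring_scheme" (structure) and S :: "'m set" and \<Psi> :: "('m \<Rightarrow>\<^sub>0 'k::field) \<Rightarrow> 'r"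
    and c :: "'m \<Rightarrow> 'i \<Rightarrow> rat"
  assumes S_0: "0 \<in> S" and S_add: "\<And>m m'. m \<in> S \<Longrightarrow> m' \<in> S \<Longrightarrow> m + m' \<in> S"
    and carrier_eq: "carrier R = \<Psi> ` laurents S"
    and inj_\<Psi>: "inj_on \<Psi> (laurents S)"
    and \<Psi>_add: "\<And>p q. p \<in> laurents S \<Longrightarrow> q \<in> laurents S \<Longrightarrow> \<Psi> (p + q) = \<Psi> p \<oplus> \<Psi> q"
    and \<Psi>_mult: "\<And>p q. p \<in> laurents S \<Longrightarrow> q \<in> laurents S \<Longrightarrow> \<Psi> (p * q) = \<Psi> p \<otimes> \<Psi> q"
    and \<Psi>_0: "\<Psi> 0 = \<zero>" and \<Psi>_1: "\<Psi> 1 = \<one>"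
    and c_add: "\<And>m m' i. c (m + m') i = c m i + c m' i"
begin

lemma mult_in_laurents:
  fixes p q :: "'m \<Rightarrow>\<^sub>0 'k"
  shows "p \<in> laurents S \<Longrightarrow> q \<in> laurents S \<Longrightarrow> p * q \<in> laurents S"
  using keys_mult [of p q] S_add by (fastforce simp: laurents_def)

lemma one_in_laurents: "(1 :: 'm \<Rightarrow>\<^sub>0 'k) \<in> laurents S"
  using S_0 by (simp add: laurents_def)

lemma uminus_in_laurents:
  fixes p :: "'m \<Rightarrow>\<^sub>0 'k"
  shows "p \<in> laurents S \<Longrightarrow> - p \<in> laurents S"
  by (auto simp: laurents_def in_keys_iff subset_iff)

lemma \<Psi>_eq_iff: "p \<in> laurents S \<Longrightarrow> q \<in> laurents S \<Longrightarrow> \<Psi> p = \<Psi> q \<longleftrightarrow> p = q"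
  using inj_\<Psi> by (auto dest: inj_onD)

lemma \<Psi>_eq_0_iff: "p \<in> laurents S \<Longrightarrow> \<Psi> p = \<zero> \<longleftrightarrow> p = 0"
  using \<Psi>_eq_iff [of p 0] \<Psi>_0 by simp

lemma \<Psi>_carrier: "p \<in> laurents S \<Longrightarrow> \<Psi> p \<in> carrier R"
  by (simp add: carrier_eq)

lemma domain_R: "domain R"
proof (intro domain.intro domain_axioms.intro)
  note closed = add_in_laurents mult_in_laurents one_in_laurents
  show "cring R"
  proof (rule cringI)
    show "abelian_group R"
    proof (rule abelian_groupI)
      fix x assume "x \<in> carrier R"
      then obtain p where p: "p \<in> laurents S" "x = \<Psi> p" by (auto simp: carrier_eq)
      then have "\<Psi> (- p) \<oplus> x = \<zero>"
        using \<Psi>_add [of "- p" p] \<Psi>_0 uminus_in_laurents by simp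
      then show "\<exists>y\<in>carrier R. y \<oplus> x = \<zero>"
        using p uminus_in_laurents \<Psi>_carrier by blast
      show "\<zero> \<oplus> x = x" using p \<Psi>_add [of 0 p] \<Psi>_0 by simp
    next
      show "\<zero> \<in> carrier R" using \<Psi>_0 \<Psi>_carrier [of 0] by simp
    qed (auto simp: carrier_eq closed add_ac simp flip: \<Psi>_add)
    show "comm_monoid R"
    proof (rule comm_monoidI)
      fix x assume "x \<in> carrier R"
      then obtain p where p: "p \<in> laurents S" "x = \<Psi> p" by (auto simp: carrier_eq)
      then show "\<one> \<otimes> x = x" using \<Psi>_mult [of 1 p] \<Psi>_1 one_in_laurents by simp
    next
      show "\<one> \<in> carrier R" using \<Psi>_1 \<Psi>_carrier [of 1] one_in_laurents by simp
    qed (auto simp: carrier_eq closed mult_ac simp flip: \<Psi>_mult)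
  qed (auto simp: carrier_eq closed distrib_right simp flip: \<Psi>_mult \<Psi>_add)
  show "\<one> \<noteq> \<zero>" using \<Psi>_eq_iff [of 1 0] one_in_laurents \<Psi>_0 \<Psi>_1 by simp
  show "x = \<zero> \<or> y = \<zero>" if xy: "x \<otimes> y = \<zero>" "x \<in> carrier R" "y \<in> carrier R" for x y
  proof -
    obtain p q where p: "p \<in> laurents S" "x = \<Psi> p" and q: "q \<in> laurents S" "y = \<Psi> q"
      using xy(2,3) by (auto simp: carrier_eq)
    then have "p * q = 0"
      using xy by (simp add: \<Psi>_eq_0_iff mult_in_laurents flip: \<Psi>_mult)
    then have "p = 0 \<or> q = 0" using mult_nonzero [of p q] by blast
    then show ?thesis using p(2) q(2) \<Psi>_0 by auto
  qed
qed

sublocale domain R by (rule domain_R)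

lemma \<Psi>_nonzero: "p \<in> laurents S - {0} \<Longrightarrow> \<Psi> p \<in> carrier R - {\<zero>}"
  by (simp add: \<Psi>_carrier \<Psi>_eq_0_iff)

lemma mult_in_laurents_nz:
  fixes p q :: "'m \<Rightarrow>\<^sub>0 'k"
  shows "p \<in> laurents S - {0} \<Longrightarrow> q \<in> laurents S - {0} \<Longrightarrow> p * q \<in> laurents S - {0}"
  using mult_in_laurents mult_nonzero by blast

lemma carrier_nonzero: "x \<in> carrier R - {\<zero>} \<longleftrightarrow> (\<exists>p\<in>laurents S - {0}. x = \<Psi> p)"
  using \<Psi>_nonzero \<Psi>_eq_0_iff \<Psi>_0 by (auto simp: carrier_eq)

text \<open>A relation rather than a function of \<open>\<phi>\<close>, so that a numerator and a denominator never have to be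
  chosen.\<close>

definition has_val :: "('r \<times> 'r) set \<Rightarrow> ('i \<Rightarrow> rat) \<Rightarrow> bool" where
  "has_val \<phi> u \<longleftrightarrow> (\<exists>a\<in>laurents S - {0}. \<exists>s\<in>laurents S - {0}.
     \<phi> = fraction R (\<Psi> a) (\<Psi> s) \<and> u = (\<lambda>i. c (lead a) i - c (lead s) i))"

lemma fraction_\<Psi>_mult:
  assumes "a \<in> laurents S" "s \<in> laurents S - {0}" "b \<in> laurents S" "t \<in> laurents S - {0}"
  shows "fraction R (\<Psi> a) (\<Psi> s) \<otimes>\<^bsub>frac_field R\<^esub> fraction R (\<Psi> b) (\<Psi> t) = fraction R (\<Psi> (a * b)) (\<Psi> (s * t))"
  using assms \<Psi>_nonzero by (simp add: fraction_mult \<Psi>_mult \<Psi>_carrier \<Psi>_eq_0_iff)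

lemma fraction_\<Psi>_eq_iff:
  assumes "a \<in> laurents S" "s \<in> laurents S - {0}" "b \<in> laurents S" "t \<in> laurents S - {0}"
  shows "fraction R (\<Psi> a) (\<Psi> s) = fraction R (\<Psi> b) (\<Psi> t) \<longleftrightarrow> a * t = b * s"
proof -
  have "fraction R (\<Psi> a) (\<Psi> s) = fraction R (\<Psi> b) (\<Psi> t) \<longleftrightarrow> \<Psi> (a * t) = \<Psi> (b * s)"
    using assms by (subst fraction_eq_iff) (auto simp: \<Psi>_mult \<Psi>_carrier \<Psi>_eq_0_iff)
  then show ?thesis using assms by (simp add: \<Psi>_eq_iff mult_in_laurents)
qed

lemma has_val_mult:
  assumes "has_val \<phi> u" "has_val \<psi> v"
  shows "has_val (\<phi> \<otimes>\<^bsub>frac_field R\<^esub> \<psi>) (\<lambda>i. u i + v i)"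
proof -
  obtain a s where a: "a \<in> laurents S - {0}" and s: "s \<in> laurents S - {0}"
    and \<phi>: "\<phi> = fraction R (\<Psi> a) (\<Psi> s)" "u = (\<lambda>i. c (lead a) i - c (lead s) i)"
    using assms unfolding has_val_def by blast
  obtain b t where b: "b \<in> laurents S - {0}" and t: "t \<in> laurents S - {0}"
    and \<psi>: "\<psi> = fraction R (\<Psi> b) (\<Psi> t)" "v = (\<lambda>i. c (lead b) i - c (lead t) i)"
    using assms unfolding has_val_def by blast
  show ?thesis unfolding has_val_def
  proof (intro bexI conjI)
    show "\<phi> \<otimes>\<^bsub>frac_field R\<^esub> \<psi> = fraction R (\<Psi> (a * b)) (\<Psi> (s * t))"
      using a s b t by (simp add: \<phi> \<psi> fraction_\<Psi>_mult)
    show "(\<lambda>i. u i + v i) = (\<lambda>i. c (lead (a * b)) i - c (lead (s * t)) i)"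
      using a s b t by (auto simp: \<phi> \<psi> lead_mult c_add)
  qed (use a s b t mult_in_laurents_nz in blast)+
qed

lemma has_val_inv:
  assumes "has_val \<phi> u" shows "has_val (inv\<^bsub>frac_field R\<^esub> \<phi>) (\<lambda>i. - u i)"
proof -
  obtain a s where a: "a \<in> laurents S - {0}" and s: "s \<in> laurents S - {0}"
    and \<phi>: "\<phi> = fraction R (\<Psi> a) (\<Psi> s)" "u = (\<lambda>i. c (lead a) i - c (lead s) i)"
    using assms unfolding has_val_def by blast
  then have "inv\<^bsub>frac_field R\<^esub> \<phi> = fraction R (\<Psi> s) (\<Psi> a)"
    using fraction_inv \<Psi>_nonzero by simp
  then show ?thesis unfolding has_val_def using a s \<phi> by fastforce
qed

lemma has_val_nat_pow:
  assumes "has_val \<phi> u"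
  shows "has_val (\<phi> [^]\<^bsub>frac_field R\<^esub> (n::nat)) (\<lambda>i. of_nat n * u i)"
proof (induction n)
  case 0
  have "\<phi> [^]\<^bsub>frac_field R\<^esub> (0::nat) = fraction R (\<Psi> 1) (\<Psi> 1)"
    by (simp add: nat_pow_def fraction_one \<Psi>_1)
  then show ?case unfolding has_val_def using one_in_laurents by fastforce
next
  case (Suc n)
  have "\<phi> [^]\<^bsub>frac_field R\<^esub> Suc n = \<phi> [^]\<^bsub>frac_field R\<^esub> n \<otimes>\<^bsub>frac_field R\<^esub> \<phi>"
    by (simp add: nat_pow_def)
  moreover have "(\<lambda>i. of_nat (Suc n) * u i) = (\<lambda>i. of_nat n * u i + u i)"
    by (auto simp: algebra_simps)
  ultimately show ?case using has_val_mult [OF Suc assms] by simp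
qed

lemma has_val_int_pow:
  assumes "has_val \<phi> u"
  shows "has_val (\<phi> [^]\<^bsub>frac_field R\<^esub> (z::int)) (\<lambda>i. of_int z * u i)"
proof (cases "z < 0")
  case True
  then have "(\<lambda>i. of_int z * u i) = (\<lambda>i. - (of_nat (nat (- z)) * u i))" by auto
  then show ?thesis
    using True has_val_inv [OF has_val_nat_pow [OF assms, of "nat (- z)"]] by (simp add: int_pow_def)
next
  case False
  then have "(\<lambda>i. of_int z * u i) = (\<lambda>i. of_nat (nat z) * u i)" by auto
  then show ?thesis
    using False has_val_nat_pow [OF assms, of "nat z"] by (simp add: int_pow_def)
qed

end


section \<open>The valuation of a monomial prime divisor\<close>

text \<open>The ideal \<open>Q\<close> is spanned by the monomials on which the degree \<open>h\<close> is positive.  The monomial with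
  exponent \<open>m0\<close> is outside of \<open>Q\<close> and becomes a unit in the localization at \<open>Q\<close>; the one with
  exponent \<open>m1\<close> becomes a uniformizer.  The last assumption says that each monomial of degree at
  least \<open>n\<close> is divisible by the \<open>n\<close>-th power of the uniformizer after multiplication by a power of
  the unit, so the localization is a discrete valuation ring with valuation \<open>h\<close>.\<close>

locale monomial_divisor = semigroup_ring less R S \<Psi> c
  for less :: "'m::ab_group_add \<Rightarrow> 'm \<Rightarrow> bool" (infix "\<sqsubset>" 50)
    and R :: "('r, 'x) ring_scheme" (structure) and S :: "'m set"
    and \<Psi> :: "('m \<Rightarrow>\<^sub>0 'k::field) \<Rightarrow> 'r" and c :: "'m \<Rightarrow> 'i \<Rightarrow> rat" +
  fixes h :: "'m \<Rightarrow> int" and Q :: "'r set" and m0 m1 :: 'm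
  assumes h_add: "\<And>m m'. m \<in> S \<Longrightarrow> m' \<in> S \<Longrightarrow> h (m + m') = h m + h m'"
    and h_nonneg: "\<And>m. m \<in> S \<Longrightarrow> 0 \<le> h m"
    and h_mono: "\<And>m m'. m \<in> S \<Longrightarrow> m' \<in> S \<Longrightarrow> m \<sqsubset> m' \<Longrightarrow> h m \<le> h m'"
    and Q_eq: "Q = \<Psi> ` {q \<in> laurents S. \<forall>m\<in>keys q. 0 < h m}"
    and m0: "m0 \<in> S" "h m0 = 0" and m1: "m1 \<in> S" "h m1 = 1"
    and shift: "\<And>m n. m \<in> S \<Longrightarrow> int n \<le> h m \<Longrightarrow> \<exists>N. m + multiple N m0 - multiple n m1 \<in> S"
begin

lemma h_0: "h 0 = 0"
  using h_add [OF S_0 S_0] by simp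

lemma multiple_in_S: "m \<in> S \<Longrightarrow> multiple n m \<in> S"
  by (induction n) (auto simp: S_0 S_add)

lemma h_multiple: "m \<in> S \<Longrightarrow> h (multiple n m) = int n * h m"
  by (induction n) (auto simp: h_0 h_add multiple_in_S algebra_simps)

lemma shift_mono:
  assumes "m + multiple N m0 - multiple n m1 \<in> S" "N \<le> N'"
  shows "m + multiple N' m0 - multiple n m1 \<in> S"
proof -
  have "m + multiple N' m0 - multiple n m1 = (m + multiple N m0 - multiple n m1) + multiple (N' - N) m0"
    using multiple_add [of N "N' - N" m0] assms by (simp add: algebra_simps)
  then show ?thesis using S_add [OF assms(1) multiple_in_S [OF m0(1), of "N' - N"]] by (simp only:)
qed

lemma shift_finite:
  assumes "finite F" "\<And>m. m \<in> F \<Longrightarrow> m \<in> S \<and> int n \<le> h m"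
  shows "\<exists>N. \<forall>m\<in>F. m + multiple N m0 - multiple n m1 \<in> S"
  using assms
proof (induction F)
  case (insert m F)
  obtain N where N: "\<forall>m\<in>F. m + multiple N m0 - multiple n m1 \<in> S" using insert by blast
  obtain N' where N': "m + multiple N' m0 - multiple n m1 \<in> S" using insert shift by blast
  have "\<forall>x\<in>insert m F. x + multiple (max N N') m0 - multiple n m1 \<in> S"
    using N N' shift_mono by (metis insert_iff max.cobounded1 max.cobounded2)
  then show ?case by blast
qed auto

lemma h_ge_lead:
  assumes "q \<in> laurents S - {0}" "m \<in> keys q"
  shows "h (lead q) \<le> h m"
proof (cases "m = lead q")
  case False
  then have "lead q \<sqsubset> m" using assms is_lead_lead [of q] by (auto simp: is_lead_def)
  then show ?thesis using assms h_mono lead_in_keys [of q] by (auto simp: laurents_def)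
qed simp

lemma lead_in_S: "q \<in> laurents S - {0} \<Longrightarrow> lead q \<in> S"
  using lead_in_keys [of q] by (auto simp: laurents_def)

lemma h_lead_mult:
  fixes p q :: "'m \<Rightarrow>\<^sub>0 'k"
  shows "p \<in> laurents S - {0} \<Longrightarrow> q \<in> laurents S - {0} \<Longrightarrow> h (lead (p * q)) = h (lead p) + h (lead q)"
  using lead_in_S [of p] lead_in_S [of q] by (simp add: lead_mult h_add)

lemma Q_iff:
  assumes "q \<in> laurents S - {0}" shows "\<Psi> q \<in> Q \<longleftrightarrow> 0 < h (lead q)"
proof
  assume "\<Psi> q \<in> Q"
  then obtain q' where q': "q' \<in> laurents S" "\<forall>m\<in>keys q'. 0 < h m" "\<Psi> q = \<Psi> q'"
    by (auto simp: Q_eq)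
  then have "q' = q" using assms \<Psi>_eq_iff by blast
  then show "0 < h (lead q)" using q' assms lead_in_keys [of q] by auto
next
  assume "0 < h (lead q)"
  then have "\<forall>m\<in>keys q. 0 < h m" using h_ge_lead [OF assms] by fastforce
  then show "\<Psi> q \<in> Q" using assms by (auto simp: Q_eq)
qed

lemma ideal_pow_Suc: "ideal_pow R Q (Suc n) = ideal_prod R Q (ideal_pow R Q n)"
  by (simp add: ideal_pow_def)

lemma ideal_pow_subset:
  "ideal_pow R Q n \<subseteq> \<Psi> ` {q \<in> laurents S. \<forall>m\<in>keys q. int n \<le> h m}"
proof (induction n)
  case 0
  show ?case using h_nonneg by (auto simp: ideal_pow_def carrier_eq laurents_def)
next
  case (Suc n)
  show ?case
  proof
    fix x assume "x \<in> ideal_pow R Q (Suc n)"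
    then have "x \<in> ideal_prod R Q (ideal_pow R Q n)" by (simp add: ideal_pow_Suc)
    then show "x \<in> \<Psi> ` {q \<in> laurents S. \<forall>m\<in>keys q. int (Suc n) \<le> h m}"
    proof (induction rule: ideal_prod.induct)
      case (prod i j)
      obtain p where p: "p \<in> laurents S" "\<forall>m\<in>keys p. 0 < h m" "i = \<Psi> p"
        using prod by (auto simp: Q_eq)
      obtain q where q: "q \<in> laurents S" "\<forall>m\<in>keys q. int n \<le> h m" "j = \<Psi> q"
        using prod Suc by blast
      have "int (Suc n) \<le> h m" if "m \<in> keys (p * q)" for m
      proof -
        have "m \<in> {a + b |a b. a \<in> keys p \<and> b \<in> keys q}"
          using that keys_mult [of p q] by (rule set_rev_mp)
        then obtain a b where ab: "a \<in> keys p" "b \<in> keys q" "m = a + b"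
          by auto
        then have "0 < h a" "int n \<le> h b" "a \<in> S" "b \<in> S"
          using p q by (auto simp: laurents_def)
        then show ?thesis using h_add [of a b] ab(3) by simp
      qed
      then show ?case
        using p(1,3) q(1,3) \<Psi>_mult [of p q] mult_in_laurents [of p q] by (intro image_eqI [of _ _ "p * q"]) simp_all
    next
      case (sum s1 s2)
      obtain p where p: "p \<in> laurents S" "\<forall>m\<in>keys p. int (Suc n) \<le> h m" "s1 = \<Psi> p"
        using sum by blast
      obtain q where q: "q \<in> laurents S" "\<forall>m\<in>keys q. int (Suc n) \<le> h m" "s2 = \<Psi> q"
        using sum by blast
      have "\<forall>m\<in>keys (p + q). int (Suc n) \<le> h m"
        using p q keys_add [of p q] by blast
      then show ?case
        using p(1,3) q(1,3) \<Psi>_add [of p q] add_in_laurents [of p S q] by (intro image_eqI [of _ _ "p + q"]) simp_all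
    qed
  qed
qed

lemma monomial_multiple_in_ideal_pow:
  assumes "q \<in> laurents S"
  shows "\<Psi> (single (multiple n m1) 1 * q) \<in> ideal_pow R Q n"
proof (induction n)
  case 0
  show ?case using assms by (simp add: ideal_pow_def carrier_eq)
next
  case (Suc n)
  have m1': "single (multiple n m1) (1::'k) \<in> laurents S"
    "single m1 (1::'k) \<in> laurents S"
    using multiple_in_S m1 by (auto intro: single_in_laurents)
  have "single (multiple (Suc n) m1) (1::'k) * q
      = single m1 1 * (single (multiple n m1) 1 * q)"
    by (simp add: mult_single flip: mult.assoc)
  then have "\<Psi> (single (multiple (Suc n) m1) 1 * q) =
      \<Psi> (single m1 1) \<otimes> \<Psi> (single (multiple n m1) 1 * q)"
    using \<Psi>_mult m1' assms mult_in_laurents by simp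
  moreover have "\<Psi> (single m1 1) \<in> Q"
    using m1 m1' by (auto simp: Q_eq)
  ultimately show ?case using Suc by (simp add: ideal_pow_Suc ideal_prod.prod)
qed

lemma divide_by_monomial:
  fixes q :: "'m \<Rightarrow>\<^sub>0 'k"
  assumes "q \<in> laurents S" "\<And>m. m \<in> keys q \<Longrightarrow> int n \<le> h m"
    and N: "\<forall>m\<in>keys q. m + multiple N m0 - multiple n m1 \<in> S"
  defines "q' \<equiv> single (multiple N m0 - multiple n m1) 1 * q"
  shows "q' \<in> laurents S"
    and "single (multiple n m1) 1 * q' = single (multiple N m0) 1 * q"
proof -
  have "keys q' \<subseteq> (\<lambda>m. multiple N m0 - multiple n m1 + m) ` keys q"
    unfolding q'_def using keys_mult [of "single (multiple N m0 - multiple n m1) 1" q]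
    by (auto split: if_splits)
  then show "q' \<in> laurents S" using N by (auto simp: laurents_def algebra_simps)
  show "single (multiple n m1) 1 * q' = single (multiple N m0) 1 * q"
    by (simp add: q'_def mult_single flip: mult.assoc)
qed

text \<open>The order is at most \<open>h (lead q)\<close> because \<open>h\<close> is at least \<open>n\<close> on all exponents of a member of
  \<open>Q^n\<close>, and a multiplier outside of \<open>Q\<close> has a leading exponent of degree zero.  It is at least
  \<open>h (lead q)\<close> because a power of the unit makes \<open>q\<close> divisible by that power of the uniformizer.\<close>

proposition ord_at_eq:
  assumes q: "q \<in> laurents S - {0}"
  shows "ord_at R Q (\<Psi> q) = nat (h (lead q))"
  unfolding ord_at_def
proof (rule Greatest_equality)
  let ?n = "nat (h (lead q))"
  have n: "int ?n \<le> h m" if "m \<in> keys q" for m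
    using h_ge_lead [OF q that] h_nonneg [OF lead_in_S [OF q]] by simp
  have "\<exists>N. \<forall>m\<in>keys q. m + multiple N m0 - multiple ?n m1 \<in> S"
    using n q by (intro shift_finite) (auto simp: laurents_def)
  then obtain N where N: "\<forall>m\<in>keys q. m + multiple N m0 - multiple ?n m1 \<in> S" ..
  let ?q' = "single (multiple N m0 - multiple ?n m1) (1::'k) * q"
  let ?s = "single (multiple N m0) (1::'k)"
  have q': "?q' \<in> laurents S" "single (multiple ?n m1) 1 * ?q' = ?s * q"
    using divide_by_monomial [OF _ n N] q by auto
  have s: "?s \<in> laurents S - {0}"
    using m0 multiple_in_S by (auto intro: single_in_laurents simp: poly_mapping_eq_iff fun_eq_iff lookup_single when_def)
  have "\<Psi> ?s \<notin> Q"
    using Q_iff [OF s] m0 by (simp add: lead_single h_multiple)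
  moreover have "\<Psi> ?s \<otimes> \<Psi> q \<in> ideal_pow R Q ?n"
    using monomial_multiple_in_ideal_pow [OF q'(1), of ?n] q'(2) \<Psi>_mult s q by simp
  ultimately show "\<exists>s\<in>carrier R - Q. s \<otimes> \<Psi> q \<in> ideal_pow R Q ?n"
    using \<Psi>_carrier s by blast
next
  fix n assume "\<exists>s\<in>carrier R - Q. s \<otimes> \<Psi> q \<in> ideal_pow R Q n"
  then obtain s where s: "s \<in> laurents S" "\<Psi> s \<notin> Q" "\<Psi> s \<otimes> \<Psi> q \<in> ideal_pow R Q n"
    by (auto simp: carrier_eq)
  have "\<Psi> 0 \<in> Q" by (auto simp: Q_eq)
  then have s': "s \<in> laurents S - {0}" using s by blast
  obtain p where p: "p \<in> laurents S" "\<forall>m\<in>keys p. int n \<le> h m" "\<Psi> s \<otimes> \<Psi> q = \<Psi> p"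
    using s ideal_pow_subset by blast
  then have "p = s * q" using s q \<Psi>_eq_iff \<Psi>_mult mult_in_laurents by (metis DiffD1)
  then have "int n \<le> h (lead (s * q))"
    using p lead_in_keys mult_nonzero s' q by blast
  also have "\<dots> = h (lead s) + h (lead q)" using h_lead_mult s' q by blast
  also have "h (lead s) = 0" using s s' Q_iff h_nonneg lead_in_S by fastforce
  finally show "n \<le> nat (h (lead q))" by simp
qed

lemma val_at_eq:
  assumes a: "a \<in> laurents S - {0}" and s: "s \<in> laurents S - {0}"
  shows "val_at R Q (fraction R (\<Psi> a) (\<Psi> s)) = h (lead a) - h (lead s)"
  unfolding val_at_def
proof (rule the_equality)
  have ord: "int (ord_at R Q (\<Psi> q)) = h (lead q)" if "q \<in> laurents S - {0}" for q
    using ord_at_eq [OF that] h_nonneg [OF lead_in_S [OF that]] by simp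
  show "\<exists>x\<in>carrier R - {\<zero>}. \<exists>y\<in>carrier R - {\<zero>}. fraction R (\<Psi> a) (\<Psi> s) = fraction R x y \<and>
      h (lead a) - h (lead s) = int (ord_at R Q x) - int (ord_at R Q y)"
    using \<Psi>_nonzero [OF a] \<Psi>_nonzero [OF s] ord [OF a] ord [OF s]
    by (intro bexI [of _ "\<Psi> a"] bexI [of _ "\<Psi> s"]) auto
  fix k assume "\<exists>x\<in>carrier R - {\<zero>}. \<exists>y\<in>carrier R - {\<zero>}. fraction R (\<Psi> a) (\<Psi> s) = fraction R x y \<and>
      k = int (ord_at R Q x) - int (ord_at R Q y)"
  then obtain x y where "x \<in> carrier R - {\<zero>}" "y \<in> carrier R - {\<zero>}"
    and xy: "fraction R (\<Psi> a) (\<Psi> s) = fraction R x y" "k = int (ord_at R Q x) - int (ord_at R Q y)"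
    by blast
  then obtain b t where b: "b \<in> laurents S - {0}" "x = \<Psi> b" and t: "t \<in> laurents S - {0}" "y = \<Psi> t"
    unfolding carrier_nonzero by blast
  then have eq: "fraction R (\<Psi> a) (\<Psi> s) = fraction R (\<Psi> b) (\<Psi> t)"
    and k: "k = int (ord_at R Q (\<Psi> b)) - int (ord_at R Q (\<Psi> t))"
    using xy by auto
  have "a * t = b * s" using eq fraction_\<Psi>_eq_iff [of a s b t] a s b(1) t(1) by simp
  then have "h (lead a) + h (lead t) = h (lead b) + h (lead s)"
    using h_lead_mult [OF a t(1)] h_lead_mult [OF b(1) s] by simp
  then show "k = h (lead a) - h (lead s)" using k ord [OF b(1)] ord [OF t(1)] by simp
qed

text \<open>Numerator and denominator have the same order, so multiplying both by one and the same
  monomial, whose degree is minus that order, brings both to order zero.\<close>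

lemma normalize_fraction:
  assumes a: "a \<in> laurents S - {0}" and s: "s \<in> laurents S - {0}" and eq: "h (lead a) = h (lead s)"
  obtains a' s' where "a' \<in> laurents S - {0}" "s' \<in> laurents S - {0}"
    "fraction R (\<Psi> a) (\<Psi> s) = fraction R (\<Psi> a') (\<Psi> s')" "h (lead a') = 0" "h (lead s') = 0"
    "\<And>i. c (lead a') i - c (lead s') i = c (lead a) i - c (lead s) i"
proof -
  define n where "n = nat (h (lead a))"
  have n: "int n = h (lead a)" "int n = h (lead s)"
    using h_nonneg [OF lead_in_S [OF a]] eq by (auto simp: n_def)
  have "\<exists>N. \<forall>m\<in>keys a \<union> keys s. m + multiple N m0 - multiple n m1 \<in> S"
    using h_ge_lead [OF a] h_ge_lead [OF s] n a s
    by (intro shift_finite) (auto simp: laurents_def)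
  then obtain N where N: "\<forall>m\<in>keys a \<union> keys s. m + multiple N m0 - multiple n m1 \<in> S" ..
  define x where "x = multiple N m0 - multiple n m1"
  let ?x = "single x (1::'k)"
  have x0: "?x \<noteq> 0" by (auto simp: poly_mapping_eq_iff fun_eq_iff lookup_single when_def)
  have *: "?x * q \<in> laurents S - {0} \<and> h (lead (?x * q)) = 0 \<and> lead (?x * q) = x + lead q"
    if q: "q \<in> laurents S - {0}" "int n = h (lead q)"
      "\<forall>m\<in>keys q. m + multiple N m0 - multiple n m1 \<in> S" for q
  proof -
    have car: "?x * q \<in> laurents S" unfolding x_def
      by (rule divide_by_monomial) (use q h_ge_lead in auto)
    have nz: "?x * q \<noteq> 0" using q x0 mult_nonzero by blast
    have l: "lead (?x * q) = x + lead q" using q x0 by (simp add: lead_mult lead_single)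
    have "lead (?x * q) + multiple n m1 = lead q + multiple N m0"
      unfolding l by (simp add: x_def algebra_simps)
    moreover have "lead (?x * q) \<in> S" using car nz lead_in_S by blast
    ultimately have "h (lead (?x * q)) + int n = h (lead q)"
      using h_add [OF \<open>lead (?x * q) \<in> S\<close> multiple_in_S [OF m1(1), of n]]
        h_add [OF lead_in_S [OF q(1)] multiple_in_S [OF m0(1), of N]]
      by (simp add: h_multiple m0 m1)
    then show ?thesis using car nz l q by auto
  qed
  have A: "?x * a \<in> laurents S - {0} \<and> h (lead (?x * a)) = 0 \<and> lead (?x * a) = x + lead a"
    using * [OF a n(1)] N by blast
  have B: "?x * s \<in> laurents S - {0} \<and> h (lead (?x * s)) = 0 \<and> lead (?x * s) = x + lead s"
    using * [OF s n(2)] N by blast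
  show thesis
  proof
    show "fraction R (\<Psi> a) (\<Psi> s) = fraction R (\<Psi> (?x * a)) (\<Psi> (?x * s))"
      using a s A B by (subst fraction_\<Psi>_eq_iff) (auto simp: mult_ac)
  qed (use A B in \<open>auto simp: c_add\<close>)
qed

end


section \<open>Cones over faces and their lattice points\<close>

lemma real_vec_add: "real_vec (\<xi> + \<psi>) = real_vec \<xi> + real_vec \<psi>"
  by (simp add: real_vec_def vec_eq_iff)

lemma real_vec_0 [simp]: "real_vec 0 = 0"
  by (simp add: real_vec_def vec_eq_iff)

lemma real_vec_eq_iff: "real_vec \<xi> = real_vec \<psi> \<longleftrightarrow> \<xi> = \<psi>"
  by (simp add: real_vec_def vec_eq_iff)

lemma real_hat_eq: "real_hat m = (real_of_int (fst m), real_vec (snd m))"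
  by (simp add: real_hat_def case_prod_beta)

lemma real_hat_add: "real_hat (m + m') = real_hat m + real_hat m'"
  by (simp add: real_hat_eq real_vec_add)

lemma real_hat_0 [simp]: "real_hat 0 = 0"
  by (simp add: real_hat_eq zero_prod_def)

lemma real_hat_eq_iff: "real_hat m = real_hat m' \<longleftrightarrow> m = m'"
  by (auto simp: real_hat_eq real_vec_eq_iff prod_eq_iff)

lemma real_hat_minus: "real_hat (- m) = - real_hat m"
  using real_hat_add [of "- m" m] by (simp add: eq_neg_iff_add_eq_0)

lemma real_hat_multiple: "real_hat (multiple n m) = real n *\<^sub>R real_hat m"
  by (induction n) (auto simp: real_hat_add algebra_simps)

text \<open>The cone over \<open>{1} \<times> \<sigma>\<close>.  The origin is always included, so that the cone over the empty
  face is the origin: it plays the role of the facet of a vertex.\<close>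

definition real_cone :: "'a::real_vector set \<Rightarrow> (real \<times> 'a) set" where
  "real_cone \<sigma> = {(k, x). k = 0 \<and> x = 0 \<or> 0 < k \<and> (1 / k) *\<^sub>R x \<in> \<sigma>}"

definition lattice_cone :: "(real ^ 'n) set \<Rightarrow> (int \<times> (int ^ 'n)) set" where
  "lattice_cone \<sigma> = {m. real_hat m \<in> real_cone \<sigma>}"

lemma real_cone_0 [simp]: "0 \<in> real_cone \<sigma>"
  by (simp add: real_cone_def zero_prod_def)

lemma real_cone_empty: "real_cone {} = {0}"
  by (auto simp: real_cone_def zero_prod_def)

lemma real_cone_mono: "\<rho> \<subseteq> \<sigma> \<Longrightarrow> real_cone \<rho> \<subseteq> real_cone \<sigma>"
  by (auto simp: real_cone_def)

lemma real_cone_1_iff: "(1, x) \<in> real_cone \<sigma> \<longleftrightarrow> x \<in> \<sigma>"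
  by (simp add: real_cone_def)

lemma real_cone_scale:
  assumes "z \<in> real_cone \<sigma>" "0 \<le> r" shows "r *\<^sub>R z \<in> real_cone \<sigma>"
  using assms by (cases "r = 0"; cases z) (auto simp: real_cone_def zero_prod_def)

lemma convex_combination_quotient:
  fixes x y :: "'a::real_vector"
  assumes "0 < k" "0 < l"
  shows "(1 / (k + l)) *\<^sub>R (x + y) = (1 - l / (k + l)) *\<^sub>R ((1 / k) *\<^sub>R x) + (l / (k + l)) *\<^sub>R ((1 / l) *\<^sub>R y)"
proof -
  have "1 - l / (k + l) = k / (k + l)" using assms by (simp add: field_simps)
  then show ?thesis using assms by (simp add: scaleR_right_distrib)
qed

lemma real_cone_add:
  assumes "convex \<sigma>" "z \<in> real_cone \<sigma>" "w \<in> real_cone \<sigma>" shows "z + w \<in> real_cone \<sigma>"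
proof -
  obtain k x l y where z: "z = (k, x)" and w: "w = (l, y)" by (cases z, cases w) auto
  consider "z = 0" | "w = 0" | "0 < k" "0 < l"
    using assms z w by (auto simp: real_cone_def zero_prod_def)
  then show ?thesis
  proof cases
    case 3
    then have "(1 / (k + l)) *\<^sub>R (x + y) \<in> \<sigma>"
      unfolding convex_combination_quotient [OF 3] using assms z w
      by (intro convexD_alt) (auto simp: real_cone_def)
    then show ?thesis using 3 by (simp add: z w real_cone_def)
  qed (use assms in auto)
qed

text \<open>The cone over a face is extremal.  This does the work of a supporting hyperplane below.\<close>

lemma real_cone_face:
  assumes "\<rho> face_of \<sigma>" "z \<in> real_cone \<sigma>" "w \<in> real_cone \<sigma>" "z + w \<in> real_cone \<rho>"
  shows "z \<in> real_cone \<rho>"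
proof -
  obtain k x l y where z: "z = (k, x)" and w: "w = (l, y)" by (cases z, cases w) auto
  consider "z = 0" | "w = 0" | "0 < k" "0 < l"
    using assms z w by (auto simp: real_cone_def zero_prod_def)
  then show ?thesis
  proof cases
    case 3
    let ?a = "(1 / k) *\<^sub>R x" and ?b = "(1 / l) *\<^sub>R y"
    have ab: "?a \<in> \<sigma>" "?b \<in> \<sigma>" using 3 assms z w by (auto simp: real_cone_def)
    have eq: "(1 / (k + l)) *\<^sub>R (x + y) = (1 - l / (k + l)) *\<^sub>R ?a + (l / (k + l)) *\<^sub>R ?b"
      using 3 by (rule convex_combination_quotient)
    have mem: "(1 / (k + l)) *\<^sub>R (x + y) \<in> \<rho>" using 3 assms z w by (auto simp: real_cone_def)
    have "?a \<in> \<rho>"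
    proof (cases "?a = ?b")
      case True
      have "(1 / (k + l)) *\<^sub>R (x + y) = (1 - l / (k + l)) *\<^sub>R ?a + (l / (k + l)) *\<^sub>R ?a"
        by (subst (2) True) (rule eq)
      also have "\<dots> = ?a" by (simp only: flip: scaleR_left_distrib) simp
      finally have "(1 / (k + l)) *\<^sub>R (x + y) = ?a" .
      then show ?thesis using mem by simp
    next
      case False
      have "(1 / (k + l)) *\<^sub>R (x + y) \<in> open_segment ?a ?b"
        unfolding in_segment using False 3 eq by (intro conjI exI [of _ "l / (k + l)"]) auto
      then show ?thesis using assms(1) ab mem by (meson face_ofD)
    qed
    then show ?thesis using 3 z by (simp add: real_cone_def)
  qed (use assms in auto)
qed

lemma lattice_cone_0 [simp]: "0 \<in> lattice_cone \<sigma>"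
  by (simp add: lattice_cone_def)

lemma lattice_cone_empty: "lattice_cone {} = {0}"
  using real_hat_eq_iff [of _ 0] by (auto simp: lattice_cone_def real_cone_empty)

lemma lattice_cone_mono: "\<rho> \<subseteq> \<sigma> \<Longrightarrow> lattice_cone \<rho> \<subseteq> lattice_cone \<sigma>"
  using real_cone_mono by (auto simp: lattice_cone_def)

lemma lattice_cone_add:
  "convex \<sigma> \<Longrightarrow> m \<in> lattice_cone \<sigma> \<Longrightarrow> m' \<in> lattice_cone \<sigma> \<Longrightarrow> m + m' \<in> lattice_cone \<sigma>"
  by (simp add: lattice_cone_def real_hat_add real_cone_add)

lemma lattice_cone_multiple: "m \<in> lattice_cone \<sigma> \<Longrightarrow> multiple n m \<in> lattice_cone \<sigma>"
  by (simp add: lattice_cone_def real_hat_multiple real_cone_scale)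

lemma lattice_cone_1_iff: "(1, \<xi>) \<in> lattice_cone \<sigma> \<longleftrightarrow> \<xi> \<in> lattice_points \<sigma>"
  by (simp add: lattice_cone_def real_hat_eq real_cone_1_iff lattice_points_def)

lemma lattice_cone_face:
  "\<rho> face_of \<sigma> \<Longrightarrow> m \<in> lattice_cone \<sigma> \<Longrightarrow> m' \<in> lattice_cone \<sigma> \<Longrightarrow> m + m' \<in> lattice_cone \<rho> \<Longrightarrow> m \<in> lattice_cone \<rho>"
  unfolding lattice_cone_def using real_cone_face real_hat_add by (metis mem_Collect_eq)


section \<open>Monomials and their weights\<close>

definition exp_weight :: "(int ^ 'n \<Rightarrow>\<^sub>0 nat) \<Rightarrow> int \<times> (int ^ 'n)" where
  "exp_weight e = (\<Sum>\<xi>\<in>keys e. multiple (lookup e \<xi>) (1, \<xi>))"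

definition monom_val :: "('c \<Rightarrow> 'k::comm_semiring_1) \<Rightarrow> ('c \<Rightarrow>\<^sub>0 nat) \<Rightarrow> 'k" where
  "monom_val v e = (\<Prod>\<xi>\<in>keys e. v \<xi> ^ lookup e \<xi>)"

lemma poly_eval_eq: "poly_eval p v = pm_eval (monom_val v) p"
  by (simp add: poly_eval_def pm_eval_def monom_val_def)

lemma keys_add_nat: "keys (e + e' :: 'c \<Rightarrow>\<^sub>0 nat) = keys e \<union> keys e'"
  by (auto simp: in_keys_iff lookup_add)

lemma exp_weight_superset:
  assumes "finite F" "keys e \<subseteq> F"
  shows "exp_weight e = (\<Sum>\<xi>\<in>F. multiple (lookup e \<xi>) (1, \<xi>))"
  unfolding exp_weight_def using assms by (intro sum.mono_neutral_left) (auto simp: in_keys_iff)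

lemma exp_weight_add: "exp_weight (e + e') = exp_weight e + exp_weight e'"
proof -
  let ?F = "keys e \<union> keys e'"
  show ?thesis
    by (simp add: exp_weight_superset [of ?F] keys_add_nat lookup_add multiple_add sum.distrib)
qed

lemma exp_weight_0 [simp]: "exp_weight 0 = 0"
  by (simp add: exp_weight_def)

lemma exp_weight_single: "exp_weight (single \<xi> n) = multiple n (1, \<xi>)"
  by (cases "n = 0") (simp_all add: exp_weight_def)

lemma monom_val_superset:
  assumes "finite F" "keys e \<subseteq> F"
  shows "monom_val v e = (\<Prod>\<xi>\<in>F. v \<xi> ^ lookup e \<xi>)"
  unfolding monom_val_def using assms by (intro prod.mono_neutral_left) (auto simp: in_keys_iff)

lemma monom_val_add: "monom_val v (e + e') = monom_val v e * monom_val v e'"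
proof -
  let ?F = "keys e \<union> keys e'"
  show ?thesis
    by (simp add: monom_val_superset [of ?F] keys_add_nat lookup_add power_add prod.distrib)
qed

lemma monom_val_0 [simp]: "monom_val v 0 = 1"
  by (simp add: monom_val_def)

lemma monom_val_single: "monom_val v (single \<xi> n) = v \<xi> ^ n"
  by (cases "n = 0") (simp_all add: monom_val_def)

lemma monom_val_eq_0:
  fixes v :: "'c \<Rightarrow> 'k::field"
  assumes "\<xi> \<in> keys e" "v \<xi> = 0"
  shows "monom_val v e = 0"
  unfolding monom_val_def using assms
  by (intro prod_zero) (auto simp: in_keys_iff zero_power intro!: bexI [of _ \<xi>])

lemma exponent_split:
  fixes e :: "'c \<Rightarrow>\<^sub>0 nat"
  assumes "\<xi> \<in> keys e"
  obtains e' where "e = single \<xi> 1 + e'" "keys e' \<subseteq> keys e"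
proof
  let ?e' = "e - single \<xi> 1"
  show "e = single \<xi> 1 + ?e'"
    using assms by (intro poly_mapping_eqI) (auto simp: lookup_add lookup_minus lookup_single when_def in_keys_iff)
  show "keys ?e' \<subseteq> keys e"
    by (auto simp: in_keys_iff lookup_minus)
qed

lemma exponent_induct [case_names zero add]:
  fixes e :: "'c \<Rightarrow>\<^sub>0 nat"
  assumes "keys e \<subseteq> L" "Q 0"
    and "\<And>\<xi> e. \<xi> \<in> L \<Longrightarrow> keys e \<subseteq> L \<Longrightarrow> Q e \<Longrightarrow> Q (single \<xi> 1 + e)"
  shows "Q e"
  using assms(1)
proof (induction "\<Sum>\<xi>\<in>keys e. lookup e \<xi>" arbitrary: e rule: less_induct)
  case less
  show ?case
  proof (cases "e = 0")
    case True
    then show ?thesis using assms(2) by simp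
  next
    case False
    then obtain \<xi> where \<xi>: "\<xi> \<in> keys e"
      by (metis empty_iff in_keys_iff lookup_zero poly_mapping_eqI)
    then obtain e' where e': "e = single \<xi> 1 + e'" "keys e' \<subseteq> keys e"
      by (rule exponent_split)
    have "(\<Sum>\<xi>\<in>keys e'. lookup e' \<xi>) = (\<Sum>\<xi>\<in>keys e. lookup e' \<xi>)"
      using e'(2) by (intro sum.mono_neutral_left) (auto simp: in_keys_iff)
    also have "\<dots> < (\<Sum>\<xi>\<in>keys e. lookup e \<xi>)"
      by (rule sum_strict_mono_ex1) (use \<xi> in \<open>auto simp: e'(1) lookup_add lookup_single when_def intro!: bexI [of _ \<xi>]\<close>)
    finally have "Q e'" using less e'(2) by blast
    then show ?thesis using assms(3) [of \<xi> e'] e' \<xi> less.prems by auto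
  qed
qed

lemma exp_weight_fst:
  fixes e :: "int ^ 'n \<Rightarrow>\<^sub>0 nat"
  shows "fst (exp_weight e) = int (\<Sum>\<xi>\<in>keys e. lookup e \<xi>)"
proof -
  have "fst (multiple n (1, \<xi>) :: int \<times> (int ^ 'n)) = int n" for n and \<xi> :: "int ^ 'n"
    by (induction n) auto
  then show ?thesis by (simp add: exp_weight_def fst_sum)
qed

lemma exp_weight_eq_0_iff: "exp_weight e = 0 \<longleftrightarrow> e = 0"
proof
  assume "exp_weight e = 0"
  then have "(\<Sum>\<xi>\<in>keys e. lookup e \<xi>) = 0"
    using exp_weight_fst [of e] by (simp only: fst_zero)
  then show "e = 0" by (intro poly_mapping_eqI) (auto simp: in_keys_iff)
qed simp

lemma exp_weight_in_lattice_cone: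
  assumes "convex \<sigma>" "keys e \<subseteq> lattice_points \<sigma>"
  shows "exp_weight e \<in> lattice_cone \<sigma>"
proof (rule exponent_induct [OF assms(2)])
  fix \<xi> e assume "\<xi> \<in> lattice_points \<sigma>" "exp_weight e \<in> lattice_cone \<sigma>"
  then show "exp_weight (single \<xi> 1 + e) \<in> lattice_cone \<sigma>"
    using lattice_cone_add [OF assms(1), of "(1, \<xi>)"]
    by (simp add: exp_weight_add exp_weight_single lattice_cone_1_iff)
qed simp

text \<open>A monomial of this weight is a product of variables with weights in the cone over \<open>P\<close>, and the cone
  over the face is extremal.\<close>

lemma keys_in_face:
  assumes "\<sigma> face_of P" "convex P" "keys e \<subseteq> lattice_points P" "exp_weight e \<in> lattice_cone \<sigma>"
  shows "keys e \<subseteq> lattice_points \<sigma>"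
proof
  fix \<xi> assume \<xi>: "\<xi> \<in> keys e"
  then obtain e' where e': "e = single \<xi> 1 + e'" "keys e' \<subseteq> keys e"
    by (rule exponent_split)
  have "(1, \<xi>) + exp_weight e' \<in> lattice_cone \<sigma>"
    using assms(4) e'(1) by (simp add: exp_weight_add exp_weight_single)
  moreover have "(1, \<xi>) \<in> lattice_cone P" "exp_weight e' \<in> lattice_cone P"
    using assms e'(2) \<xi> by (auto simp: lattice_cone_1_iff intro!: exp_weight_in_lattice_cone)
  ultimately have "(1, \<xi>) \<in> lattice_cone \<sigma>"
    using lattice_cone_face assms(1) by blast
  then show "\<xi> \<in> lattice_points \<sigma>" by (simp add: lattice_cone_1_iff)
qed

text \<open>Normality makes the semigroup generated at height one saturated: it contains every lattice point of
  the cone.\<close>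

lemma normal_polytope_exponent:
  assumes P: "normal_polytope P" and m: "m \<in> lattice_cone P"
  shows "\<exists>e. keys e \<subseteq> lattice_points P \<and> exp_weight e = m"
proof -
  have *: "\<exists>e. keys e \<subseteq> lattice_points P \<and> exp_weight e = (int k, \<xi>)"
    if "\<xi> \<in> lattice_points ((*\<^sub>R) (real k) ` P)" for k \<xi>
    using that
  proof (induction k arbitrary: \<xi>)
    case 0
    then have "real_vec \<xi> = real_vec 0" by (auto simp: lattice_points_def)
    then have "\<xi> = 0" using real_vec_eq_iff by blast
    then show ?case by (intro exI [of _ 0]) (simp add: zero_prod_def)
  next
    case (Suc k)
    have "\<xi> \<in> lattice_points ((*\<^sub>R) (real (1 + k)) ` P)" using Suc by simp
    then obtain \<psi> \<phi> where *: "\<xi> = \<psi> + \<phi>" "\<psi> \<in> lattice_points ((*\<^sub>R) (real 1) ` P)"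
      "\<phi> \<in> lattice_points ((*\<^sub>R) (real k) ` P)"
      using P unfolding normal_polytope_def by blast
    obtain e where e: "keys e \<subseteq> lattice_points P" "exp_weight e = (int k, \<phi>)"
      using Suc.IH * by blast
    have "\<psi> \<in> lattice_points P" using * by (auto simp: lattice_points_def)
    then show ?case using e *
      by (intro exI [of _ "single \<psi> 1 + e"])
         (auto simp: exp_weight_add exp_weight_single keys_add_nat)
  qed
  obtain k \<xi> where m': "m = (k, \<xi>)" by (cases m)
  show ?thesis
  proof (cases "k = 0")
    case True
    then have "real_vec \<xi> = real_vec 0"
      using m m' by (auto simp: lattice_cone_def real_cone_def real_hat_eq)
    then have "m = 0" using True m' real_vec_eq_iff [of \<xi> 0] by (simp add: zero_prod_def)
    then show ?thesis by (intro exI [of _ 0]) simp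
  next
    case False
    then have k: "0 < k" "(1 / real_of_int k) *\<^sub>R real_vec \<xi> \<in> P"
      using m m' by (auto simp: lattice_cone_def real_cone_def real_hat_eq)
    then have "\<xi> \<in> lattice_points ((*\<^sub>R) (real (nat k)) ` P)"
      by (auto simp: lattice_points_def intro!: image_eqI [of _ _ "(1 / real_of_int k) *\<^sub>R real_vec \<xi>"])
    then show ?thesis using *[of \<xi> "nat k"] k m' by simp
  qed
qed


section \<open>Characters\<close>

lemma character_add:
  assumes "t \<in> torus" shows "character (\<xi> + \<psi>) t = character \<xi> t * character \<psi> t"
  using assms by (simp add: character_def torus_def power_int_add prod.distrib)

lemma character_0 [simp]: "character 0 t = 1"
  by (simp add: character_def)

lemma hat_character_eq: "hat_character m s = fst s powi fst m * character (snd m) (snd s)"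
  by (simp add: hat_character_def case_prod_beta)

lemma hat_character_add:
  assumes "s \<in> hat_torus" shows "hat_character (m + m') s = hat_character m s * hat_character m' s"
  using assms by (auto simp: hat_character_eq hat_torus_def character_add power_int_add)

lemma hat_character_0 [simp]: "hat_character 0 s = 1"
  by (simp add: hat_character_eq)

lemma hat_character_nz: "s \<in> hat_torus \<Longrightarrow> hat_character m s \<noteq> 0"
  by (auto simp: hat_character_eq hat_torus_def character_def torus_def)

lemma hat_torus_mult:
  assumes "s \<in> hat_torus" "s' \<in> hat_torus"
  shows "(fst s * fst s', \<chi> i. snd s $ i * snd s' $ i) \<in> hat_torus"
    and "hat_character m (fst s * fst s', \<chi> i. snd s $ i * snd s' $ i) = hat_character m s * hat_character m s'"
  using assms
  by (auto simp: hat_torus_def torus_def hat_character_eq character_def power_int_mult_distrib prod.distrib)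

lemma powi_2_inject: "(2::'k::field_char_0) powi a = 2 powi b \<longleftrightarrow> a = b"
proof
  assume eq: "(2::'k) powi a = 2 powi b"
  have pow: "(2::'k) ^ n = 1 \<longleftrightarrow> n = 0" for n
    using of_nat_eq_iff [of "2 ^ n" 1, where 'a = 'k] by simp
  have one: "(2::'k) powi (a - b) = 1" using eq by (simp add: power_int_diff)
  obtain n where "a - b = int n \<or> a - b = - int n" by (metis int_cases2)
  then have "(2::'k) ^ n = 1" using one by (auto simp: power_int_minus inverse_eq_1_iff)
  then show "a = b" using pow \<open>a - b = int n \<or> _\<close> by simp
qed simp

text \<open>In characteristic zero the powers of 2 are distinct, so a torus element with one entry 2 and all
  others 1 detects a difference in one component.\<close>

lemma hat_character_separates:
  fixes m m' :: "int \<times> (int ^ 'n)"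
  assumes "m \<noteq> m'"
  shows "\<exists>s\<in>hat_torus. hat_character m s \<noteq> (hat_character m' s :: 'k::field_char_0)"
proof (cases "fst m = fst m'")
  case False
  then have "hat_character m (2, \<chi> i. 1) \<noteq> (hat_character m' (2, \<chi> i. 1) :: 'k)"
    by (simp add: hat_character_eq character_def powi_2_inject)
  then show ?thesis by (intro bexI [of _ "(2, \<chi> i. 1)"]) (auto simp: hat_torus_def torus_def)
next
  case True
  then obtain i where i: "snd m $ i \<noteq> snd m' $ i"
    using assms by (auto simp: prod_eq_iff vec_eq_iff)
  define t :: "'k ^ 'n" where "t = (\<chi> j. if j = i then 2 else 1)"
  have char: "character \<xi> t = 2 powi (\<xi> $ i)" for \<xi> :: "int ^ 'n"
  proof -
    have "character \<xi> t = (\<Prod>j\<in>UNIV. if j = i then 2 powi (\<xi> $ i) else 1)"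
      unfolding character_def by (intro prod.cong) (auto simp: t_def)
    then show ?thesis by simp
  qed
  have "hat_character m (1, t) \<noteq> hat_character m' (1, t)"
    using i by (simp add: hat_character_eq char powi_2_inject)
  then show ?thesis by (intro bexI [of _ "(1, t)"]) (auto simp: hat_torus_def torus_def t_def)
qed

text \<open>Independence of characters, by Artin's argument: translating a relation by an element that
  separates two of its characters and subtracting produces a shorter relation.\<close>

lemma characters_independent:
  fixes a :: "int \<times> (int ^ 'n) \<Rightarrow> 'k::field_char_0"
  assumes "finite F" "\<And>s. s \<in> hat_torus \<Longrightarrow> (\<Sum>m\<in>F. a m * hat_character m s) = 0"
  shows "\<forall>m\<in>F. a m = 0"
  using assms
proof (induction F arbitrary: a rule: finite_induct)
  case (insert m0 F)
  have F: "a m * (hat_character m u - hat_character m0 u) = 0" if m: "m \<in> F" and u: "u \<in> hat_torus" for m u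
  proof -
    have "\<forall>m\<in>F. a m * (hat_character m u - hat_character m0 u) = 0"
    proof (rule insert.IH)
      fix s :: "'k \<times> ('k ^ 'n)" assume s: "s \<in> hat_torus"
      let ?su = "(fst s * fst u, \<chi> i. snd s $ i * snd u $ i)"
      note su = hat_torus_mult [OF s u]
      have "(\<Sum>m\<in>F. a m * (hat_character m u - hat_character m0 u) * hat_character m s)
          = (\<Sum>m\<in>insert m0 F. a m * (hat_character m u - hat_character m0 u) * hat_character m s)"
        using insert.hyps by simp
      also have "\<dots> = (\<Sum>m\<in>insert m0 F. a m * hat_character m ?su) -
           hat_character m0 u * (\<Sum>m\<in>insert m0 F. a m * hat_character m s)"
        by (simp only: su(2) sum_distrib_left flip: sum_subtractf) (intro sum.cong refl, simp add: algebra_simps)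
      also have "\<dots> = 0" using insert.prems [OF s] insert.prems [OF su(1)] by simp
      finally show "(\<Sum>m\<in>F. a m * (hat_character m u - hat_character m0 u) * hat_character m s) = 0" .
    qed
    then show ?thesis using m by blast
  qed
  have aF: "a m = 0" if "m \<in> F" for m
  proof -
    have "m \<noteq> m0" using that insert.hyps by blast
    then obtain u :: "'k \<times> ('k ^ 'n)" where "u \<in> hat_torus" "hat_character m u \<noteq> hat_character m0 u"
      using hat_character_separates by blast
    moreover from this have "a m * (hat_character m u - hat_character m0 u) = 0"
      using F that by blast
    ultimately show ?thesis by simp
  qed
  have one: "(1, \<chi> i. 1) \<in> (hat_torus :: ('k \<times> ('k ^ 'n)) set)" by (simp add: hat_torus_def torus_def)
  have "a m0 = 0"
    using insert.prems [OF one] insert.hyps aF hat_character_nz [OF one, of m0] by simp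
  then show ?case using aF by blast
qed simp

lemma pm_eval_characters_inject:
  fixes p q :: "int \<times> (int ^ 'n) \<Rightarrow>\<^sub>0 'k::field_char_0"
  assumes "\<And>s. s \<in> hat_torus \<Longrightarrow> pm_eval (\<lambda>m. hat_character m s) p = pm_eval (\<lambda>m. hat_character m s) q"
  shows "p = q"
proof (rule poly_mapping_eqI)
  fix m
  let ?F = "keys p \<union> keys q"
  have "\<forall>m\<in>?F. lookup p m - lookup q m = 0"
  proof (rule characters_independent)
    fix s :: "'k \<times> ('k ^ 'n)" assume "s \<in> hat_torus"
    then have "(\<Sum>m\<in>?F. lookup p m * hat_character m s) = (\<Sum>m\<in>?F. lookup q m * hat_character m s)"
      using assms [of s] pm_eval_superset [of ?F p] pm_eval_superset [of ?F q] by simp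
    then show "(\<Sum>m\<in>?F. (lookup p m - lookup q m) * hat_character m s) = 0"
      by (simp add: left_diff_distrib sum_subtractf)
  qed (rule finite_UnI; rule finite_keys)
  then have "lookup p m - lookup q m = 0" if "m \<in> ?F"
    using that by blast
  moreover have "lookup p m = 0 \<and> lookup q m = 0" if "m \<notin> ?F"
    using that by (simp add: not_in_keys_iff_lookup_eq_zero)
  ultimately show "lookup p m = lookup q m"
    by (cases "m \<in> ?F") simp_all
qed


section \<open>The points and the coordinate ring of a toric cone\<close>

text \<open>The points of the toric cone are the semigroup homomorphisms to the field that vanish
  off the face; here they are described by the binomial equations.\<close>

definition toric_points :: "(real ^ 'n) set \<Rightarrow> (real ^ 'n) set \<Rightarrow> (int ^ 'n \<Rightarrow> 'k::field) set" where
  "toric_points P \<sigma> = {v \<in> coord_space (lattice_points P).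
     (\<forall>\<xi>. \<xi> \<notin> lattice_points \<sigma> \<longrightarrow> v \<xi> = 0) \<and>
     (\<forall>e e'. keys e \<subseteq> lattice_points P \<longrightarrow> keys e' \<subseteq> lattice_points P \<longrightarrow>
        exp_weight e = exp_weight e' \<longrightarrow> monom_val v e = monom_val v e')}"

definition exponent_of :: "(real ^ 'n) set \<Rightarrow> int \<times> (int ^ 'n) \<Rightarrow> (int ^ 'n \<Rightarrow>\<^sub>0 nat)" where
  "exponent_of P m = (SOME e. keys e \<subseteq> lattice_points P \<and> exp_weight e = m)"

text \<open>The value at \<open>v\<close> of the monomials of weight \<open>m\<close>.  On points that satisfy the binomial equations it
  does not depend on the monomial chosen.\<close>

definition point_char ::
    "(real ^ 'n) set \<Rightarrow> (int ^ 'n \<Rightarrow> 'k::field) \<Rightarrow> int \<times> (int ^ 'n) \<Rightarrow> 'k" where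
  "point_char P v m = monom_val v (exponent_of P m)"

definition laurent_fun ::
    "(real ^ 'n) set \<Rightarrow> (int ^ 'n \<Rightarrow> 'k::field) set \<Rightarrow> (int \<times> (int ^ 'n) \<Rightarrow>\<^sub>0 'k) \<Rightarrow> (int ^ 'n, 'k) regfun" where
  "laurent_fun P Z q = (\<lambda>v\<in>Z. pm_eval (point_char P v) q)"

text \<open>The Laurent polynomial to which a polynomial restricts on the orbit of the full polytope.\<close>

definition poly_laurent :: "(int ^ 'n, 'k::field) mpoly \<Rightarrow> (int \<times> (int ^ 'n) \<Rightarrow>\<^sub>0 'k)" where
  "poly_laurent p = (\<Sum>e\<in>keys p. single (exp_weight e) (lookup p e))"

definition orbit_pt :: "(real ^ 'n) set \<Rightarrow> 'k::field \<times> ('k ^ 'n) \<Rightarrow> (int ^ 'n \<Rightarrow> 'k)" where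
  "orbit_pt \<sigma> s = (\<lambda>\<xi>. fst s * orbit_vec \<sigma> (snd s) \<xi>)"

lemma hat_character_1: "hat_character (1, \<xi>) s = fst s * character \<xi> (snd s)"
  by (simp add: hat_character_eq)

lemma monom_val_orbit_pt:
  fixes s :: "'k::field \<times> ('k ^ 'n)"
  assumes "s \<in> hat_torus"
  shows "monom_val (orbit_pt \<sigma> s) e =
    (if keys e \<subseteq> lattice_points \<sigma> then hat_character (exp_weight e) s else 0)"
proof (cases "keys e \<subseteq> lattice_points \<sigma>")
  case True
  then have "monom_val (orbit_pt \<sigma> s) e = hat_character (exp_weight e) s"
  proof (rule exponent_induct)
    fix \<xi> e assume "\<xi> \<in> lattice_points \<sigma>" "monom_val (orbit_pt \<sigma> s) e = hat_character (exp_weight e) s"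
    then show "monom_val (orbit_pt \<sigma> s) (single \<xi> 1 + e)
        = hat_character (exp_weight (single \<xi> 1 + e)) s"
      using hat_character_add [OF assms, of "(1, \<xi>)" "exp_weight e"]
      by (simp add: monom_val_add monom_val_single exp_weight_add exp_weight_single
          hat_character_1 orbit_pt_def orbit_vec_def)
  qed simp
  then show ?thesis using True by simp
next
  case False
  then obtain \<xi> where "\<xi> \<in> keys e" "\<xi> \<notin> lattice_points \<sigma>" by blast
  then show ?thesis using False by (simp add: monom_val_eq_0 orbit_pt_def orbit_vec_def)
qed

lemma monom_val_hat_act:
  fixes s :: "'k::field \<times> ('k ^ 'n)"
  assumes "s \<in> hat_torus"
  shows "monom_val (hat_act s v) e = hat_character (exp_weight e) s * monom_val v e"
proof (rule exponent_induct [where L = UNIV])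
  fix \<xi> e assume "monom_val (hat_act s v) e = hat_character (exp_weight e) s * monom_val v e"
  then show "monom_val (hat_act s v) (single \<xi> 1 + e)
      = hat_character (exp_weight (single \<xi> 1 + e)) s * monom_val v (single \<xi> 1 + e)"
    using hat_character_add [OF assms, of "(1, \<xi>)" "exp_weight e"]
    by (simp add: monom_val_add monom_val_single exp_weight_add exp_weight_single
        hat_character_1 hat_act_def case_prod_beta mult_ac)
qed simp_all

lemma hat_inverse_in_hat_torus: "s \<in> hat_torus \<Longrightarrow> hat_inverse s \<in> hat_torus"
  by (auto simp: hat_torus_def hat_inverse_def torus_def)

lemma hat_inverse_hat_inverse: "hat_inverse (hat_inverse s) = s"
  by (cases s) (simp add: hat_inverse_def vec_eq_iff)

lemma hat_character_hat_inverse: "hat_character m (hat_inverse s) = hat_character (- m) s"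
  by (simp add: hat_inverse_def hat_character_eq case_prod_beta character_def
      power_int_minus power_int_inverse prod_inversef)

text \<open>Every homogeneous polynomial scales, so its vanishing is well defined on projective points.\<close>

lemma homogeneous_scale:
  assumes "homogeneous d p"
  shows "poly_eval p (\<lambda>\<xi>. a * v \<xi>) = a ^ d * poly_eval p v"
proof -
  have "monom_val (\<lambda>\<xi>. a * v \<xi>) e = a ^ d * monom_val v e" if "e \<in> keys p" for e
  proof -
    have "a ^ d = (\<Prod>\<xi>\<in>keys e. a ^ lookup e \<xi>)"
      using assms that by (auto simp: homogeneous_def power_sum)
    then show ?thesis by (simp add: monom_val_def power_mult_distrib prod.distrib)
  qed
  then show ?thesis
    by (simp add: poly_eval_eq pm_eval_def sum_distrib_left mult_ac)
qed

lemma homogeneous_vanishes_on_proj_pt: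
  assumes "homogeneous d p" "poly_eval p v = 0" "w \<in> proj_pt v" shows "poly_eval p w = 0"
  using assms homogeneous_scale [of d p] by (auto simp: proj_pt_def)

locale normal_lattice_polytope =
  fixes P :: "(real ^ 'n) set"
  assumes lattice: "lattice_polytope P" and normal: "normal_polytope P"
begin

lemma convex_P: "convex P"
  using lattice by (auto simp: lattice_polytope_def)

lemma face_convex: "\<sigma> face_of P \<Longrightarrow> convex \<sigma>"
  by (rule face_of_imp_convex)

lemma face_lattice_points: "\<sigma> face_of P \<Longrightarrow> lattice_points \<sigma> \<subseteq> lattice_points P"
  using face_of_imp_subset by (auto simp: lattice_points_def)

lemma face_lattice_cone: "\<sigma> face_of P \<Longrightarrow> lattice_cone \<sigma> \<subseteq> lattice_cone P"
  using face_of_imp_subset lattice_cone_mono by blast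

lemma face_has_lattice_point:
  assumes "\<sigma> \<in> faces P" obtains \<xi> where "\<xi> \<in> lattice_points \<sigma>"
proof -
  obtain S where S: "finite S" "P = convex hull (real_vec ` S)"
    using lattice by (auto simp: lattice_polytope_def)
  have "\<sigma> face_of convex hull (real_vec ` S)" "\<sigma> \<noteq> {}"
    using assms S by (auto simp: faces_def)
  then obtain S' where S': "S' \<subseteq> real_vec ` S" "\<sigma> = convex hull S'"
    using face_of_convex_hull_subset [of "real_vec ` S"] S(1) finite_imp_compact by blast
  then have "S' \<noteq> {}" using \<open>\<sigma> \<noteq> {}\<close> by auto
  then obtain \<xi> where "real_vec \<xi> \<in> S'" using S' by blast
  then have "\<xi> \<in> lattice_points \<sigma>" using S' by (simp add: lattice_points_def hull_inc)
  then show thesis by (rule that)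
qed

lemma exponent_of:
  assumes "m \<in> lattice_cone P"
  shows "keys (exponent_of P m) \<subseteq> lattice_points P" "exp_weight (exponent_of P m) = m"
  using someI_ex [OF normal_polytope_exponent [OF normal assms]] by (auto simp: exponent_of_def)

lemma toric_points_mono: "\<rho> \<subseteq> \<sigma> \<Longrightarrow> toric_points P \<rho> \<subseteq> toric_points P \<sigma>"
  by (auto simp: toric_points_def lattice_points_def)

lemma point_char_exp_weight:
  assumes "v \<in> toric_points P \<sigma>" "keys e \<subseteq> lattice_points P"
  shows "point_char P v (exp_weight e) = monom_val v e"
  using assms exponent_of [OF exp_weight_in_lattice_cone [OF convex_P assms(2)]]
  unfolding toric_points_def point_char_def by blast

lemma point_char_add:
  assumes "v \<in> toric_points P \<sigma>" "m \<in> lattice_cone P" "m' \<in> lattice_cone P"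
  shows "point_char P v (m + m') = point_char P v m * point_char P v m'"
proof -
  note e = exponent_of [OF assms(2)] and e' = exponent_of [OF assms(3)]
  have "point_char P v (exp_weight (exponent_of P m + exponent_of P m'))
      = monom_val v (exponent_of P m + exponent_of P m')"
    using assms(1) e e' by (intro point_char_exp_weight) (auto simp: keys_add_nat)
  then show ?thesis by (simp add: exp_weight_add e e' monom_val_add point_char_def)
qed

lemma point_char_0: "v \<in> toric_points P \<sigma> \<Longrightarrow> point_char P v 0 = 1"
  using point_char_exp_weight [of v \<sigma> 0] by simp

lemma point_char_outside:
  assumes v: "v \<in> toric_points P \<sigma>" and \<sigma>: "\<sigma> face_of P" and m: "m \<in> lattice_cone P" "m \<notin> lattice_cone \<sigma>"
  shows "point_char P v m = 0"
proof -
  note e = exponent_of [OF m(1)]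
  have "\<not> keys (exponent_of P m) \<subseteq> lattice_points \<sigma>"
    using exp_weight_in_lattice_cone [OF face_convex [OF \<sigma>], of "exponent_of P m"] e m by auto
  then obtain \<xi> where "\<xi> \<in> keys (exponent_of P m)" "\<xi> \<notin> lattice_points \<sigma>" by blast
  then show ?thesis using v by (simp add: point_char_def monom_val_eq_0 toric_points_def)
qed

lemma keys_in_face_iff:
  assumes "\<sigma> face_of P" "keys e \<subseteq> lattice_points P"
  shows "keys e \<subseteq> lattice_points \<sigma> \<longleftrightarrow> exp_weight e \<in> lattice_cone \<sigma>"
  using assms keys_in_face [OF assms(1) convex_P assms(2)] exp_weight_in_lattice_cone [OF face_convex [OF assms(1)]]
  by blast

lemma orbit_pt_in_toric_points:
  fixes s :: "'k::field \<times> ('k ^ 'n)"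
  assumes s: "s \<in> hat_torus" and \<sigma>: "\<sigma> face_of P"
  shows "orbit_pt \<sigma> s \<in> toric_points P \<sigma>"
  unfolding toric_points_def
proof (intro CollectI conjI allI impI)
  show "orbit_pt \<sigma> s \<in> coord_space (lattice_points P)"
    using face_lattice_points [OF \<sigma>] by (auto simp: coord_space_def orbit_pt_def orbit_vec_def)
  show "orbit_pt \<sigma> s \<xi> = 0" if "\<xi> \<notin> lattice_points \<sigma>" for \<xi>
    using that by (simp add: orbit_pt_def orbit_vec_def)
  fix e e' assume "keys e \<subseteq> lattice_points P" "keys e' \<subseteq> lattice_points P"
    "exp_weight e = exp_weight e'"
  then show "monom_val (orbit_pt \<sigma> s) e = monom_val (orbit_pt \<sigma> s) e'"
    using keys_in_face_iff [OF \<sigma>] by (simp add: monom_val_orbit_pt [OF s])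
qed

lemma point_char_orbit_pt:
  assumes "s \<in> hat_torus" "\<sigma> face_of P" "m \<in> lattice_cone P"
  shows "point_char P (orbit_pt \<sigma> s) m = (if m \<in> lattice_cone \<sigma> then hat_character m s else 0)"
  using exponent_of [OF assms(3)] keys_in_face_iff [OF assms(2), of "exponent_of P m"]
  by (simp add: point_char_def monom_val_orbit_pt [OF assms(1)])

lemma origin_in_toric_points: "(\<lambda>_. 0 :: 'k::field) \<in> toric_points P \<sigma>"
proof -
  have "monom_val (\<lambda>_. 0 :: 'k) e = (if e = 0 then 1 else 0)" for e :: "int ^ 'n \<Rightarrow>\<^sub>0 nat"
  proof (cases "e = 0")
    case False
    then obtain \<xi> where "\<xi> \<in> keys e"
      by (metis empty_iff in_keys_iff lookup_zero poly_mapping_eqI)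
    then show ?thesis using False by (simp add: monom_val_eq_0)
  qed simp
  then show ?thesis
    by (simp add: toric_points_def coord_space_def flip: exp_weight_eq_0_iff)
qed

lemma point_char_origin:
  assumes "m \<in> lattice_cone P"
  shows "point_char P (\<lambda>_. 0) m = (if m = 0 then 1 else 0)"
proof (cases "m = 0")
  case False
  then have "exponent_of P m \<noteq> 0" using exponent_of [OF assms] by auto
  then obtain \<xi> where "\<xi> \<in> keys (exponent_of P m)"
    by (metis empty_iff in_keys_iff lookup_zero poly_mapping_eqI)
  then show ?thesis using False by (simp add: point_char_def monom_val_eq_0)
qed (simp add: point_char_0 [OF origin_in_toric_points])

lemma keys_poly_laurent:
  assumes "p \<in> polys (lattice_points P)"
  shows "keys (poly_laurent p) \<subseteq> lattice_cone P"
proof -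
  have "exp_weight e \<in> lattice_cone P" if "e \<in> keys p" for e
    using assms that by (auto simp: polys_def intro!: exp_weight_in_lattice_cone convex_P)
  then show ?thesis
    unfolding poly_laurent_def using keys_sum by (fastforce split: if_splits)
qed

lemma poly_eval_eq_pm_eval:
  assumes "p \<in> polys (lattice_points P)" "v \<in> toric_points P \<sigma>"
  shows "poly_eval p v = pm_eval (point_char P v) (poly_laurent p)"
proof -
  have "pm_eval (point_char P v) (poly_laurent p) =
      (\<Sum>e\<in>keys p. lookup p e * point_char P v (exp_weight e))"
    by (simp add: poly_laurent_def pm_eval_sum)
  also have "\<dots> = (\<Sum>e\<in>keys p. lookup p e * monom_val v e)"
    using assms by (intro sum.cong refl) (auto simp: polys_def point_char_exp_weight)
  finally show ?thesis by (simp add: poly_eval_eq pm_eval_def)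
qed

lemma pm_eval_point_char_restrict:
  assumes "v \<in> toric_points P \<sigma>" "\<sigma> face_of P" "keys q \<subseteq> lattice_cone P"
  shows "pm_eval (point_char P v) (restrict_keys (lattice_cone \<sigma>) q) = pm_eval (point_char P v) q"
  using assms point_char_outside by (intro pm_eval_restrict_keys) blast

text \<open>By independence of characters, a Laurent polynomial with exponents in the cone of \<open>\<sigma>\<close> is
  determined by its values on the orbit of \<open>\<sigma>\<close>.\<close>

lemma laurent_eq_on_orbit:
  fixes p q :: "int \<times> (int ^ 'n) \<Rightarrow>\<^sub>0 'k::field_char_0"
  assumes \<sigma>: "\<sigma> face_of P" and keys: "keys p \<subseteq> lattice_cone \<sigma>" "keys q \<subseteq> lattice_cone \<sigma>"
    and eq: "\<And>s. s \<in> hat_torus \<Longrightarrow> pm_eval (point_char P (orbit_pt \<sigma> s)) p = pm_eval (point_char P (orbit_pt \<sigma> s)) q"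
  shows "p = q"
proof (rule pm_eval_characters_inject)
  fix s :: "'k \<times> ('k ^ 'n)" assume s: "s \<in> hat_torus"
  have "pm_eval (\<lambda>m. hat_character m s) x = pm_eval (point_char P (orbit_pt \<sigma> s)) x"
    if "keys x \<subseteq> lattice_cone \<sigma>" for x
  proof (rule pm_eval_cong)
    fix m assume "m \<in> keys x"
    then have "m \<in> lattice_cone \<sigma>" "m \<in> lattice_cone P"
      using that face_lattice_cone [OF \<sigma>] by auto
    then show "hat_character m s = point_char P (orbit_pt \<sigma> s) m"
      by (simp add: point_char_orbit_pt [OF s \<sigma>])
  qed
  then show "pm_eval (\<lambda>m. hat_character m s) p = pm_eval (\<lambda>m. hat_character m s) q"
    using keys eq [OF s] by simp
qed

lemma poly_vanishing_on_orbit: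
  fixes p :: "(int ^ 'n, 'k::field_char_0) mpoly"
  assumes \<sigma>: "\<sigma> face_of P" and p: "p \<in> polys (lattice_points P)"
    and 0: "\<And>s. s \<in> hat_torus \<Longrightarrow> poly_eval p (orbit_pt \<sigma> s) = 0"
    and v: "v \<in> toric_points P \<sigma>"
  shows "poly_eval p v = 0"
proof -
  let ?q = "restrict_keys (lattice_cone \<sigma>) (poly_laurent p)"
  note ev = poly_eval_eq_pm_eval [OF p] pm_eval_point_char_restrict [OF _ \<sigma> keys_poly_laurent [OF p]]
  have "?q = 0"
    using 0 ev [OF orbit_pt_in_toric_points [OF _ \<sigma>]]
    by (intro laurent_eq_on_orbit [OF \<sigma>]) (auto simp: keys_restrict_keys)
  then show ?thesis using ev [OF v] by simp
qed

lemma proj_pt_self: "v \<in> proj_pt v"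
  unfolding proj_pt_def by (intro CollectI exI [of _ 1]) simp

text \<open>The variables off the face and the differences of two monomials of the same weight are homogeneous
  polynomials that vanish on the orbit.\<close>

lemma toric_cone_subset:
  fixes v :: "int ^ 'n \<Rightarrow> 'k::field_char_0"
  assumes \<sigma>: "\<sigma> \<in> faces P" and v: "v \<in> toric_cone P \<sigma>"
  shows "v \<in> toric_points P \<sigma>"
proof (cases "v = (\<lambda>_. 0)")
  case True
  then show ?thesis using origin_in_toric_points by simp
next
  case False
  let ?L = "lattice_points P"
  have face: "\<sigma> face_of P" using \<sigma> by (simp add: faces_def)
  have v': "v \<in> coord_space ?L" "proj_pt v \<in> toric_variety P \<sigma>"
    using v False by (auto simp: toric_cone_def affine_cone_def)
  have vanish: "poly_eval p v = 0"
    if p: "p \<in> polys ?L" "homogeneous d p" "\<And>t. t \<in> torus \<Longrightarrow> poly_eval p (orbit_vec \<sigma> t) = 0" for p d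
  proof -
    let ?Z = "{q \<in> proj_space ?L. \<forall>p'\<in>{p}. \<forall>v\<in>q. poly_eval p' v = 0}"
    have "proj_closed ?L ?Z"
      unfolding proj_closed_def using p by (intro exI [of _ "{p}"]) auto
    moreover have "proj_pt (orbit_vec \<sigma> t) \<in> ?Z" if t: "t \<in> torus" for t :: "'k ^ 'n"
    proof -
      obtain \<xi> where \<xi>: "\<xi> \<in> lattice_points \<sigma>" using face_has_lattice_point [OF \<sigma>] .
      have "orbit_vec \<sigma> t \<xi> \<noteq> 0" using t \<xi> by (auto simp: orbit_vec_def character_def torus_def)
      then have "orbit_vec \<sigma> t \<noteq> (\<lambda>_. 0)" by auto
      moreover have "orbit_vec \<sigma> t \<in> coord_space ?L"
        using face_lattice_points [OF face] by (auto simp: coord_space_def orbit_vec_def)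
      ultimately show ?thesis
        using homogeneous_vanishes_on_proj_pt [OF p(2) p(3) [OF t]] by (auto simp: proj_space_def)
    qed
    ultimately have "toric_variety P \<sigma> \<subseteq> ?Z"
      unfolding toric_variety_def proj_closure_def by (intro Inter_lower) auto
    then show ?thesis using v' proj_pt_self by blast
  qed
  have torus_hat: "(1, t) \<in> hat_torus \<and> orbit_pt \<sigma> (1, t) = orbit_vec \<sigma> t" if "t \<in> torus" for t :: "'k ^ 'n"
    using that by (simp add: hat_torus_def orbit_pt_def)
  show ?thesis unfolding toric_points_def
  proof (intro CollectI conjI allI impI v')
    show "v \<xi> = 0" if "\<xi> \<notin> lattice_points \<sigma>" for \<xi>
    proof (cases "\<xi> \<in> ?L")
      case True
      let ?p = "single (single \<xi> 1) (1::'k)"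
      have "poly_eval ?p v = 0"
        by (rule vanish [of _ 1])
           (use True that in \<open>auto simp: polys_def homogeneous_def poly_eval_eq monom_val_single orbit_vec_def\<close>)
      then show ?thesis by (simp add: poly_eval_eq monom_val_single)
    qed (use v' in \<open>simp add: coord_space_def\<close>)
    fix e e' assume e: "keys e \<subseteq> ?L" "keys e' \<subseteq> ?L" "exp_weight e = exp_weight e'"
    let ?p = "single e 1 + single e' (-1::'k)"
    have ev: "poly_eval ?p w = monom_val w e - monom_val w e'" for w
      by (simp add: poly_eval_eq pm_eval_add)
    have keys: "keys ?p \<subseteq> {e, e'}"
      using keys_add [of "single e 1" "single e' (-1::'k)"] by (auto split: if_splits)
    have "poly_eval ?p v = 0"
    proof (rule vanish)
      show "?p \<in> polys ?L" using keys e by (auto simp: polys_def)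
      have "int (\<Sum>\<xi>\<in>keys e. lookup e \<xi>) = int (\<Sum>\<xi>\<in>keys e'. lookup e' \<xi>)"
        using e(3) by (metis exp_weight_fst)
      then show "homogeneous (\<Sum>\<xi>\<in>keys e. lookup e \<xi>) ?p"
        using keys unfolding homogeneous_def of_nat_eq_iff by auto
      fix t :: "'k ^ 'n" assume "t \<in> torus"
      then have "orbit_vec \<sigma> t \<in> toric_points P \<sigma>"
        using torus_hat [of t] orbit_pt_in_toric_points [OF _ face, of "(1, t)"] by simp
      then have "monom_val (orbit_vec \<sigma> t) e = monom_val (orbit_vec \<sigma> t) e'"
        using e unfolding toric_points_def by blast
      then show "poly_eval ?p (orbit_vec \<sigma> t) = 0" by (simp add: ev)
    qed
    then show "monom_val v e = monom_val v e'" by (simp add: ev)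
  qed
qed

text \<open>A homogeneous polynomial that vanishes on the orbit has no Laurent terms over the face, so it
  vanishes wherever the binomial equations and the equations of the face hold.\<close>

lemma toric_cone_supset:
  fixes v :: "int ^ 'n \<Rightarrow> 'k::field_char_0"
  assumes \<sigma>: "\<sigma> \<in> faces P" and v: "v \<in> toric_points P \<sigma>"
  shows "v \<in> toric_cone P \<sigma>"
proof (cases "v = (\<lambda>_. 0)")
  case True
  then show ?thesis by (simp add: toric_cone_def affine_cone_def coord_space_def)
next
  case False
  let ?L = "lattice_points P"
  have face: "\<sigma> face_of P" using \<sigma> by (simp add: faces_def)
  have vL: "v \<in> coord_space ?L" using v by (simp add: toric_points_def)
  have "proj_pt v \<in> toric_variety P \<sigma>"
    unfolding toric_variety_def proj_closure_def
  proof (rule InterI, clarify)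
    fix Z :: "(int ^ 'n \<Rightarrow> 'k) set set"
    assume "proj_closed ?L Z" and orbit: "{proj_pt (orbit_vec \<sigma> t) |t. t \<in> torus} \<subseteq> Z"
    then obtain S where S: "S \<subseteq> polys ?L" "\<forall>p\<in>S. \<exists>d. homogeneous d p"
      and Z: "Z = {q \<in> proj_space ?L. \<forall>p\<in>S. \<forall>v\<in>q. poly_eval p v = 0}"
      by (auto simp: proj_closed_def)
    have "poly_eval p w = 0" if p: "p \<in> S" and w: "w \<in> proj_pt v" for p w
    proof -
      obtain d where d: "homogeneous d p" using S p by blast
      have "poly_eval p v = 0"
      proof (rule poly_vanishing_on_orbit [OF face _ _ v])
        show "p \<in> polys ?L" using S p by blast
        fix s :: "'k \<times> ('k ^ 'n)" assume "s \<in> hat_torus"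
        then have "snd s \<in> torus" by (auto simp: hat_torus_def)
        then have "proj_pt (orbit_vec \<sigma> (snd s)) \<in> Z" using orbit by blast
        then have "poly_eval p (orbit_vec \<sigma> (snd s)) = 0" using Z p proj_pt_self by blast
        then show "poly_eval p (orbit_pt \<sigma> s) = 0"
          unfolding orbit_pt_def using homogeneous_scale [OF d] by simp
      qed
      then show ?thesis using homogeneous_vanishes_on_proj_pt [OF d _ w] by blast
    qed
    then show "proj_pt v \<in> Z" using Z vL False by (auto simp: proj_space_def)
  qed
  then show ?thesis using vL by (simp add: toric_cone_def affine_cone_def)
qed

theorem toric_cone_eq:
  assumes "\<sigma> \<in> faces P"
  shows "toric_cone P \<sigma> = (toric_points P \<sigma> :: (int ^ 'n \<Rightarrow> 'k::field_char_0) set)"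
  using toric_cone_subset [OF assms] toric_cone_supset [OF assms] by blast

end

definition next_face :: "'a set list \<Rightarrow> 'a set" where
  "next_face \<tau>s = (case \<tau>s of [] \<Rightarrow> {} | \<rho> # _ \<Rightarrow> \<rho>)"

context normal_lattice_polytope
begin

lemma toric_ring_simps:
  "carrier (toric_ring P \<sigma>) = {restrict (poly_eval p) (toric_cone P \<sigma>) | p. p \<in> polys (lattice_points P)}"
  "a \<otimes>\<^bsub>toric_ring P \<sigma>\<^esub> b = (\<lambda>x\<in>toric_cone P \<sigma>. a x * b x)"
  "a \<oplus>\<^bsub>toric_ring P \<sigma>\<^esub> b = (\<lambda>x\<in>toric_cone P \<sigma>. a x + b x)"
  "\<one>\<^bsub>toric_ring P \<sigma>\<^esub> = (\<lambda>x\<in>toric_cone P \<sigma>. 1)"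
  "\<zero>\<^bsub>toric_ring P \<sigma>\<^esub> = (\<lambda>x\<in>toric_cone P \<sigma>. 0)"
  by (simp_all add: toric_ring_def coord_ring_def)

lemma restrict_poly_eval:
  fixes p :: "(int ^ 'n, 'k::field_char_0) mpoly"
  assumes "\<sigma> \<in> faces P" "p \<in> polys (lattice_points P)"
  shows "restrict (poly_eval p) (toric_cone P \<sigma>)
      = laurent_fun P (toric_cone P \<sigma>) (restrict_keys (lattice_cone \<sigma>) (poly_laurent p))"
proof -
  have face: "\<sigma> face_of P" using assms by (simp add: faces_def)
  show ?thesis unfolding laurent_fun_def toric_cone_eq [OF assms(1)]
    using poly_eval_eq_pm_eval [OF assms(2)] pm_eval_point_char_restrict [OF _ face keys_poly_laurent [OF assms(2)]]
    by (intro restrict_ext) simp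
qed

lemma laurent_fun_is_regular:
  fixes q :: "int \<times> (int ^ 'n) \<Rightarrow>\<^sub>0 'k::field_char_0"
  assumes "keys q \<subseteq> lattice_cone P"
  shows "\<exists>p\<in>polys (lattice_points P). laurent_fun P Z q = restrict (poly_eval p) Z"
proof
  let ?p = "\<Sum>m\<in>keys q. single (exponent_of P m) (lookup q m)"
  have "poly_eval ?p v = pm_eval (point_char P v) q" for v
    by (simp add: poly_eval_eq pm_eval_sum point_char_def) (simp add: pm_eval_def point_char_def)
  then show "laurent_fun P Z q = restrict (poly_eval ?p) Z"
    unfolding laurent_fun_def by (intro restrict_ext) simp
  have "keys ?p \<subseteq> exponent_of P ` keys q"
    using keys_sum [of "\<lambda>m. single (exponent_of P m) (lookup q m)" "keys q"]
    by (auto split: if_splits)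
  moreover have "keys (exponent_of P m) \<subseteq> lattice_points P" if "m \<in> keys q" for m
    using exponent_of(1) assms that by blast
  ultimately show "?p \<in> polys (lattice_points P)"
    unfolding polys_def by blast
qed

lemma laurent_fun_inject:
  fixes p q :: "int \<times> (int ^ 'n) \<Rightarrow>\<^sub>0 'k::field_char_0"
  assumes \<sigma>: "\<sigma> \<in> faces P" and "p \<in> laurents (lattice_cone \<sigma>)" "q \<in> laurents (lattice_cone \<sigma>)"
    and eq: "laurent_fun P (toric_cone P \<sigma>) p = laurent_fun P (toric_cone P \<sigma>) q"
  shows "p = q"
proof -
  have face: "\<sigma> face_of P" using \<sigma> by (simp add: faces_def)
  show ?thesis
  proof (rule laurent_eq_on_orbit [OF face])
    fix s :: "'k \<times> ('k ^ 'n)" assume "s \<in> hat_torus"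
    then have "orbit_pt \<sigma> s \<in> toric_cone P \<sigma>"
      using toric_cone_eq [OF \<sigma>] orbit_pt_in_toric_points [OF _ face] by blast
    then show "pm_eval (point_char P (orbit_pt \<sigma> s)) p = pm_eval (point_char P (orbit_pt \<sigma> s)) q"
      using fun_cong [OF eq, of "orbit_pt \<sigma> s"] by (simp add: laurent_fun_def)
  qed (use assms in \<open>auto simp: laurents_def\<close>)
qed

lemma carrier_toric_ring:
  assumes \<sigma>: "\<sigma> \<in> faces P"
  shows "carrier (toric_ring P \<sigma>)
    = laurent_fun P (toric_cone P \<sigma> :: (int ^ 'n \<Rightarrow> 'k::field_char_0) set) ` laurents (lattice_cone \<sigma>)"
    (is "_ = laurent_fun P ?Z ` _")
proof
  show "carrier (toric_ring P \<sigma>) \<subseteq> laurent_fun P ?Z ` laurents (lattice_cone \<sigma>)"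
  proof
    fix a assume "a \<in> carrier (toric_ring P \<sigma> :: (int ^ 'n, 'k) regfun ring)"
    then obtain p where "p \<in> polys (lattice_points P)" "a = restrict (poly_eval p) ?Z"
      by (auto simp: toric_ring_simps)
    then have "a = laurent_fun P ?Z (restrict_keys (lattice_cone \<sigma>) (poly_laurent p))"
      using restrict_poly_eval [OF \<sigma>] by simp
    then show "a \<in> laurent_fun P ?Z ` laurents (lattice_cone \<sigma>)"
      by (rule image_eqI) (simp add: laurents_def keys_restrict_keys)
  qed
  show "laurent_fun P ?Z ` laurents (lattice_cone \<sigma>) \<subseteq> carrier (toric_ring P \<sigma>)"
  proof clarify
    fix q :: "int \<times> (int ^ 'n) \<Rightarrow>\<^sub>0 'k" assume "q \<in> laurents (lattice_cone \<sigma>)"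
    then have "keys q \<subseteq> lattice_cone P"
      using face_lattice_cone [of \<sigma>] \<sigma> by (auto simp: laurents_def faces_def)
    then show "laurent_fun P ?Z q \<in> carrier (toric_ring P \<sigma>)"
      using laurent_fun_is_regular [of q ?Z] by (auto simp: toric_ring_simps)
  qed
qed

text \<open>Independence of characters gives injectivity, and normality gives the variables needed to
  represent each monomial by a polynomial.\<close>

proposition toric_semigroup_ring:
  fixes prec :: "int \<times> (int ^ 'n) \<Rightarrow> int \<times> (int ^ 'n) \<Rightarrow> bool"
  assumes \<sigma>: "\<sigma> \<in> faces P" and prec: "translation_order prec" and c: "\<And>m m' i. c (m + m') i = c m i + c m' i"
  shows "semigroup_ring prec (toric_ring P \<sigma>) (lattice_cone \<sigma>)
    (laurent_fun P (toric_cone P \<sigma>) :: (_ \<Rightarrow>\<^sub>0 'k::field_char_0) \<Rightarrow> _) c"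
proof -
  let ?Z = "toric_cone P \<sigma> :: (int ^ 'n \<Rightarrow> 'k) set"
  have face: "\<sigma> face_of P" using \<sigma> by (simp add: faces_def)
  note Z = toric_cone_eq [OF \<sigma>, where 'k = 'k]
  interpret translation_order prec by (rule prec)
  show ?thesis
  proof
    show "carrier (toric_ring P \<sigma>) = laurent_fun P ?Z ` laurents (lattice_cone \<sigma>)"
      by (rule carrier_toric_ring [OF \<sigma>])
    show "inj_on (laurent_fun P ?Z) (laurents (lattice_cone \<sigma>))"
      using laurent_fun_inject [OF \<sigma>] by (intro inj_onI)
    show "laurent_fun P ?Z (p + q) = laurent_fun P ?Z p \<oplus>\<^bsub>toric_ring P \<sigma>\<^esub> laurent_fun P ?Z q"
      for p q by (auto simp: laurent_fun_def toric_ring_simps pm_eval_add intro!: restrict_ext)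
    show "laurent_fun P ?Z (p * q) = laurent_fun P ?Z p \<otimes>\<^bsub>toric_ring P \<sigma>\<^esub> laurent_fun P ?Z q"
      if p: "p \<in> laurents (lattice_cone \<sigma>)" and q: "q \<in> laurents (lattice_cone \<sigma>)" for p q
    proof -
      have mult: "pm_eval (point_char P v) (p * q) = pm_eval (point_char P v) p * pm_eval (point_char P v) q"
        if v: "v \<in> ?Z" for v
      proof (rule pm_eval_mult)
        fix a b assume "a \<in> keys p" "b \<in> keys q"
        then have "a \<in> lattice_cone P" "b \<in> lattice_cone P"
          using p q face_lattice_cone [OF face] by (auto simp: laurents_def)
        then show "point_char P v (a + b) = point_char P v a * point_char P v b"
          using v point_char_add unfolding Z by blast
      qed
      show ?thesis
        unfolding laurent_fun_def toric_ring_simps by (rule restrict_ext) (simp add: mult)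
    qed
    show "laurent_fun P ?Z 0 = \<zero>\<^bsub>toric_ring P \<sigma>\<^esub>"
      by (auto simp: laurent_fun_def toric_ring_simps)
    have "pm_eval (point_char P v) 1 = 1" if "v \<in> ?Z" for v
      using that point_char_0 [of v \<sigma>] pm_eval_single [of "point_char P v" 0 1] by (simp add: Z)
    then show "laurent_fun P ?Z 1 = \<one>\<^bsub>toric_ring P \<sigma>\<^esub>"
      unfolding laurent_fun_def toric_ring_simps by (intro restrict_ext) simp
    show "m + m' \<in> lattice_cone \<sigma>" if "m \<in> lattice_cone \<sigma>" "m' \<in> lattice_cone \<sigma>" for m m'
      using that lattice_cone_add face_convex [OF face] by blast
  qed (simp_all add: c)
qed

lemma toric_cone_mono:
  assumes "\<rho> \<in> faces P" "\<sigma> \<in> faces P" "\<rho> \<subseteq> \<sigma>"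
  shows "toric_cone P \<rho> \<subseteq> (toric_cone P \<sigma> :: (int ^ 'n \<Rightarrow> 'k::field_char_0) set)"
  using assms toric_points_mono by (simp add: toric_cone_eq)

lemma restrict_laurent_fun:
  fixes q :: "int \<times> (int ^ 'n) \<Rightarrow>\<^sub>0 'k::field_char_0"
  assumes \<rho>: "\<rho> \<in> faces P" and \<sigma>: "\<sigma> \<in> faces P" and sub: "\<rho> \<subseteq> \<sigma>"
    and q: "q \<in> laurents (lattice_cone P)"
  shows "restrict (laurent_fun P (toric_cone P \<sigma>) q) (toric_cone P \<rho>)
      = laurent_fun P (toric_cone P \<rho>) (restrict_keys (lattice_cone \<rho>) q)"
proof -
  have face: "\<rho> face_of P" using \<rho> by (simp add: faces_def)
  show ?thesis unfolding laurent_fun_def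
  proof (rule restrict_ext)
    fix v :: "int ^ 'n \<Rightarrow> 'k" assume v: "v \<in> toric_cone P \<rho>"
    then have "v \<in> toric_cone P \<sigma>" using toric_cone_mono [OF \<rho> \<sigma> sub] by blast
    moreover have "pm_eval (point_char P v) (restrict_keys (lattice_cone \<rho>) q) = pm_eval (point_char P v) q"
      using v q by (intro pm_eval_point_char_restrict [OF _ face]) (auto simp: toric_cone_eq [OF \<rho>] laurents_def)
    ultimately show "(\<lambda>v\<in>toric_cone P \<sigma>. pm_eval (point_char P v) q) v
        = pm_eval (point_char P v) (restrict_keys (lattice_cone \<rho>) q)" by simp
  qed
qed

text \<open>The restriction to the smaller cone is the Laurent polynomial of the terms over the smaller face,
  and it vanishes only if there are none.\<close>

lemma laurent_fun_vanishes_iff: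
  fixes q :: "int \<times> (int ^ 'n) \<Rightarrow>\<^sub>0 'k::field_char_0"
  assumes \<rho>: "\<rho> \<in> faces P" and \<sigma>: "\<sigma> \<in> faces P" and sub: "\<rho> \<subseteq> \<sigma>"
    and q: "q \<in> laurents (lattice_cone P)"
  shows "(\<forall>v\<in>toric_cone P \<rho>. laurent_fun P (toric_cone P \<sigma>) q v = 0)
      \<longleftrightarrow> keys q \<inter> lattice_cone \<rho> = {}"
proof -
  let ?q = "restrict_keys (lattice_cone \<rho>) q"
  have "(\<forall>v\<in>toric_cone P \<rho>. laurent_fun P (toric_cone P \<sigma>) q v = 0)
      \<longleftrightarrow> restrict (laurent_fun P (toric_cone P \<sigma>) q) (toric_cone P \<rho>) = laurent_fun P (toric_cone P \<rho>) 0"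
    by (auto simp: laurent_fun_def restrict_def fun_eq_iff)
  also have "\<dots> \<longleftrightarrow> ?q = 0"
    unfolding restrict_laurent_fun [OF assms]
    using laurent_fun_inject [OF \<rho>, of ?q 0] by (auto simp: laurents_def keys_restrict_keys)
  also have "\<dots> \<longleftrightarrow> keys q \<inter> lattice_cone \<rho> = {}"
    by (metis keys_restrict_keys keys_zero poly_mapping_eqI not_in_keys_iff_lookup_eq_zero empty_iff lookup_zero)
  finally show ?thesis .
qed

lemma laurent_fun_origin:
  fixes q :: "int \<times> (int ^ 'n) \<Rightarrow>\<^sub>0 'k::field_char_0"
  assumes \<sigma>: "\<sigma> \<in> faces P" and q: "q \<in> laurents (lattice_cone P)"
  shows "laurent_fun P (toric_cone P \<sigma>) q (\<lambda>_. 0) = 0 \<longleftrightarrow> keys q \<inter> lattice_cone {} = {}"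
proof -
  have "pm_eval (point_char P (\<lambda>_. 0)) q = (\<Sum>m\<in>keys q. if m = 0 then lookup q 0 else 0)"
    unfolding pm_eval_def using q
    by (intro sum.cong refl) (auto simp: point_char_origin laurents_def)
  also have "\<dots> = lookup q 0" by (simp add: in_keys_iff)
  finally show ?thesis
    by (simp add: laurent_fun_def toric_cone_eq [OF \<sigma>] origin_in_toric_points lattice_cone_empty in_keys_iff)
qed

lemma vanishing_ideal_next_cone:
  assumes \<tau>: "\<tau> \<in> faces P" and \<tau>s: "\<tau>s \<noteq> [] \<Longrightarrow> next_face \<tau>s \<in> faces P \<and> next_face \<tau>s \<subseteq> \<tau>"
  shows "vanishing_ideal (lattice_points P) (toric_cone P \<tau>) (next_cone P \<tau>s)
    = laurent_fun P (toric_cone P \<tau> :: (int ^ 'n \<Rightarrow> 'k::field_char_0) set) `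
        {q \<in> laurents (lattice_cone \<tau>). keys q \<inter> lattice_cone (next_face \<tau>s) = {}}"
proof -
  let ?Z = "toric_cone P \<tau> :: (int ^ 'n \<Rightarrow> 'k) set"
  have face: "\<tau> face_of P" using \<tau> by (simp add: faces_def)
  have "carrier (coord_ring (lattice_points P) ?Z) = laurent_fun P ?Z ` laurents (lattice_cone \<tau>)"
    using carrier_toric_ring [OF \<tau>] by (simp add: toric_ring_def)
  moreover have "(\<forall>x\<in>next_cone P \<tau>s. laurent_fun P ?Z q x = 0) \<longleftrightarrow>
      keys q \<inter> lattice_cone (next_face \<tau>s) = {}" if "q \<in> laurents (lattice_cone \<tau>)" for q
  proof -
    have "q \<in> laurents (lattice_cone P)" using that face_lattice_cone [OF face] by (auto simp: laurents_def)
    then show ?thesis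
      using laurent_fun_origin [OF \<tau>, of q] laurent_fun_vanishes_iff [of "next_face \<tau>s" \<tau> q] \<tau> \<tau>s
      by (cases \<tau>s) (simp_all add: next_cone_def next_face_def)
  qed
  ultimately show ?thesis unfolding vanishing_ideal_def by auto
qed

end


section \<open>Eigenfunctions are monomials\<close>

context normal_lattice_polytope
begin

lemma P_face: "P \<in> faces P" if "\<sigma> \<in> faces P"
  using that convex_P by (auto simp: faces_def face_of_refl_eq dest: face_of_imp_subset)

lemma hat_act_in_toric_points:
  assumes "s \<in> hat_torus" "v \<in> toric_points P \<sigma>" shows "hat_act s v \<in> toric_points P \<sigma>"
  unfolding toric_points_def
proof (intro CollectI conjI allI impI)
  show "hat_act s v \<in> coord_space (lattice_points P)"
    using assms by (auto simp: toric_points_def coord_space_def hat_act_def case_prod_beta)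
  show "hat_act s v \<xi> = 0" if "\<xi> \<notin> lattice_points \<sigma>" for \<xi>
    using assms that by (auto simp: toric_points_def hat_act_def case_prod_beta)
  fix e e' assume "keys e \<subseteq> lattice_points P" "keys e' \<subseteq> lattice_points P"
    "exp_weight e = exp_weight e'"
  then have "monom_val v e = monom_val v e'" using assms(2) unfolding toric_points_def by blast
  then show "monom_val (hat_act s v) e = monom_val (hat_act s v) e'"
    using \<open>exp_weight e = exp_weight e'\<close> by (simp add: monom_val_hat_act [OF assms(1)])
qed

lemma point_char_hat_act:
  assumes "s \<in> hat_torus" "m \<in> lattice_cone P"
  shows "point_char P (hat_act s v) m = hat_character m s * point_char P v m"
  using exponent_of [OF assms(2)] by (simp add: point_char_def monom_val_hat_act [OF assms(1)])

text \<open>On the orbit of the point with all coordinates 1, the equation for an eigenfunction becomes an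
  identity between combinations of characters, which determines the Laurent polynomial.\<close>

lemma has_weight_iff:
  fixes g :: "(int ^ 'n, 'k::field_char_0) regfun"
  assumes P: "P \<in> faces P"
  shows "has_weight P g \<mu> \<longleftrightarrow>
    (\<exists>\<kappa>. \<kappa> \<noteq> 0 \<and> - \<mu> \<in> lattice_cone P \<and> g = laurent_fun P (toric_cone P P) (single (- \<mu>) \<kappa>))"
proof -
  let ?Z = "toric_cone P P :: (int ^ 'n \<Rightarrow> 'k) set"
  note Z = toric_cone_eq [OF P, where 'k = 'k]
  have face: "P face_of P" using P by (simp add: faces_def)
  have zero: "\<zero>\<^bsub>toric_ring P P\<^esub> = laurent_fun P ?Z 0"
    by (auto simp: laurent_fun_def toric_ring_simps)
  show ?thesis
  proof
    assume w: "has_weight P g \<mu>"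
    then have "g \<in> carrier (toric_ring P P)" by (simp add: has_weight_def)
    then obtain q where q: "q \<in> laurents (lattice_cone P)" "g = laurent_fun P ?Z q"
      unfolding carrier_toric_ring [OF P] by blast
    define e :: "'k \<times> ('k ^ 'n)" where "e = (1, \<chi> i. 1)"
    have e: "e \<in> hat_torus" by (simp add: e_def hat_torus_def torus_def)
    have orbit: "orbit_pt P s \<in> ?Z" if "s \<in> hat_torus" for s
      using orbit_pt_in_toric_points [OF that face] by (simp add: Z)
    have "q = single (- \<mu>) (g (orbit_pt P e))"
    proof (rule pm_eval_characters_inject)
      fix u :: "'k \<times> ('k ^ 'n)" assume u: "u \<in> hat_torus"
      have "hat_act u (orbit_pt P e) = orbit_pt P u"
        by (auto simp: fun_eq_iff hat_act_def orbit_pt_def orbit_vec_def e_def character_def case_prod_beta)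
      then have "g (orbit_pt P u) = hat_character \<mu> (hat_inverse u) * g (orbit_pt P e)"
        using w hat_inverse_in_hat_torus [OF u] orbit [OF e]
        unfolding has_weight_def by (metis hat_inverse_hat_inverse)
      also have "\<dots> = hat_character (- \<mu>) u * g (orbit_pt P e)"
        by (simp add: hat_character_hat_inverse)
      finally have "g (orbit_pt P u) = hat_character (- \<mu>) u * g (orbit_pt P e)" .
      moreover have "g (orbit_pt P u) = pm_eval (\<lambda>m. hat_character m u) q"
        using q orbit [OF u] point_char_orbit_pt [OF u face]
        by (auto simp: laurent_fun_def laurents_def intro!: pm_eval_cong)
      ultimately show "pm_eval (\<lambda>m. hat_character m u) q
          = pm_eval (\<lambda>m. hat_character m u) (single (- \<mu>) (g (orbit_pt P e)))"
        by (simp add: mult.commute)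
    qed
    then obtain \<kappa> where \<kappa>: "q = single (- \<mu>) \<kappa>" by blast
    have "\<kappa> \<noteq> 0" using w q zero \<kappa> by (auto simp: has_weight_def)
    moreover from this have "- \<mu> \<in> lattice_cone P" using q \<kappa> by (simp add: laurents_def)
    ultimately show "\<exists>\<kappa>. \<kappa> \<noteq> 0 \<and> - \<mu> \<in> lattice_cone P \<and> g = laurent_fun P ?Z (single (- \<mu>) \<kappa>)"
      using q \<kappa> by blast
  next
    assume "\<exists>\<kappa>. \<kappa> \<noteq> 0 \<and> - \<mu> \<in> lattice_cone P \<and> g = laurent_fun P ?Z (single (- \<mu>) \<kappa>)"
    then obtain \<kappa> where \<kappa>: "\<kappa> \<noteq> 0" "- \<mu> \<in> lattice_cone P" "g = laurent_fun P ?Z (single (- \<mu>) \<kappa>)"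
      by blast
    have single: "single (- \<mu>) \<kappa> \<in> laurents (lattice_cone P)"
      using \<kappa> by (simp add: laurents_def)
    have "single (- \<mu>) \<kappa> \<noteq> 0"
      using \<kappa> by (metis lookup_single_eq lookup_zero)
    then have "g \<noteq> \<zero>\<^bsub>toric_ring P P\<^esub>"
      using laurent_fun_inject [OF P single, of 0] \<kappa> zero by auto
    moreover have "g \<in> carrier (toric_ring P P)"
      unfolding carrier_toric_ring [OF P] using \<kappa> single by blast
    moreover have "g (hat_act (hat_inverse s) x) = hat_character \<mu> s * g x"
      if s: "s \<in> hat_torus" and x: "x \<in> ?Z" for s x
    proof -
      note s' = hat_inverse_in_hat_torus [OF s]
      have "hat_act (hat_inverse s) x \<in> ?Z" using x hat_act_in_toric_points [OF s'] by (simp add: Z)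
      then show ?thesis
        using x \<kappa> by (simp add: laurent_fun_def point_char_hat_act [OF s'] hat_character_hat_inverse)
    qed
    ultimately show "has_weight P g \<mu>" by (simp add: has_weight_def)
  qed
qed

lemma weight_monomial:
  fixes \<kappa> :: "'k::field_char_0"
  assumes P: "P \<in> faces P" and "\<kappa> \<noteq> 0" "m \<in> lattice_cone P"
  shows "weight P (laurent_fun P (toric_cone P P) (single m \<kappa>)) = - m"
  unfolding weight_def
proof (rule the_equality)
  show "has_weight P (laurent_fun P (toric_cone P P) (single m \<kappa>)) (- m)"
    unfolding has_weight_iff [OF P] using assms by auto
  fix \<mu> assume "has_weight P (laurent_fun P (toric_cone P P) (single m \<kappa>)) \<mu>"
  then obtain \<kappa>' where "\<kappa>' \<noteq> 0" "- \<mu> \<in> lattice_cone P" and eq: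
    "laurent_fun P (toric_cone P P) (single m \<kappa>) = laurent_fun P (toric_cone P P) (single (- \<mu>) \<kappa>')"
    unfolding has_weight_iff [OF P] by blast
  then have "single m \<kappa> = single (- \<mu>) \<kappa>'"
    using assms by (intro laurent_fun_inject [OF P _ _ eq]) (simp_all add: laurents_def)
  then have "m = - \<mu>" using assms \<open>\<kappa>' \<noteq> 0\<close> by (metis keys_single singleton_inject)
  then show "\<mu> = - m" by simp
qed

lemma eigenfunction_iff:
  fixes g :: "(int ^ 'n, 'k::field_char_0) regfun"
  assumes P: "P \<in> faces P"
  shows "eigenfunction P g \<longleftrightarrow>
    (\<exists>m\<in>lattice_cone P. \<exists>\<kappa>. \<kappa> \<noteq> 0 \<and> g = laurent_fun P (toric_cone P P) (single m \<kappa>))"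
  unfolding eigenfunction_def has_weight_iff [OF P] by (metis minus_minus)

text \<open>Eigenfunctions are monomials, so a decomposition into eigenfunctions of distinct weights is
  a Laurent expansion, and that is unique.\<close>

lemma weight_components_laurent_fun:
  fixes q :: "int \<times> (int ^ 'n) \<Rightarrow>\<^sub>0 'k::field_char_0"
  assumes P: "P \<in> faces P" and q: "q \<in> laurents (lattice_cone P)"
  shows "weight_components P (laurent_fun P (toric_cone P P) q) =
    (\<lambda>m. laurent_fun P (toric_cone P P) (single m (lookup q m))) ` keys q"
    (is "_ = ?G")
  unfolding weight_components_def
proof (rule the_equality)
  let ?Z = "toric_cone P P :: (int ^ 'n \<Rightarrow> 'k) set"
  let ?mono = "\<lambda>m. laurent_fun P ?Z (single m (lookup q m))"
  have sum: "laurent_fun P ?Z (\<Sum>i\<in>I. r i) = (\<lambda>x\<in>?Z. \<Sum>i\<in>I. laurent_fun P ?Z (r i) x)"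
    for I :: "'b set" and r
    unfolding laurent_fun_def by (rule restrict_ext) (simp add: pm_eval_sum)
  have weight: "weight P (?mono m) = - m" if "m \<in> keys q" for m
    using that q by (intro weight_monomial [OF P]) (auto simp: laurents_def in_keys_iff)
  show "finite ?G \<and> (\<forall>h\<in>?G. eigenfunction P h) \<and> inj_on (weight P) ?G \<and>
      laurent_fun P ?Z q = (\<lambda>x\<in>?Z. \<Sum>h\<in>?G. h x)"
  proof (intro conjI)
    show "\<forall>h\<in>?G. eigenfunction P h"
    proof
      fix h assume "h \<in> ?G"
      then obtain m where "m \<in> keys q" "h = ?mono m" by blast
      moreover from this have "m \<in> lattice_cone P" "lookup q m \<noteq> 0"
        using q by (auto simp: laurents_def in_keys_iff)
      ultimately show "eigenfunction P h" unfolding eigenfunction_iff [OF P] by blast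
    qed
    show "inj_on (weight P) ?G"
    proof (rule inj_onI)
      fix h h' assume "h \<in> ?G" "h' \<in> ?G" "weight P h = weight P h'"
      then obtain m m' where "m \<in> keys q" "h = ?mono m" "m' \<in> keys q" "h' = ?mono m'"
        by blast
      then show "h = h'" using \<open>weight P h = weight P h'\<close> weight [of m] weight [of m'] by simp
    qed
    have "inj_on ?mono (keys q)"
    proof (rule inj_onI)
      fix m m' assume m: "m \<in> keys q" "m' \<in> keys q" and eq: "?mono m = ?mono m'"
      have "- m = - m'" using arg_cong [OF eq, of "weight P"] unfolding weight [OF m(1)] weight [OF m(2)] .
      then show "m = m'" by (rule neg_equal_iff_equal [THEN iffD1])
    qed
    then have G: "(\<Sum>h\<in>?G. h x) = (\<Sum>m\<in>keys q. ?mono m x)" for x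
      by (subst sum.reindex) simp_all
    show "laurent_fun P ?Z q = (\<lambda>x\<in>?Z. \<Sum>h\<in>?G. h x)"
      using sum [of "\<lambda>m. single m (lookup q m)" "keys q"]
      unfolding poly_mapping_sum_single G .
  qed simp
  fix G assume G: "finite G \<and> (\<forall>h\<in>G. eigenfunction P h) \<and> inj_on (weight P) G \<and>
      laurent_fun P ?Z q = (\<lambda>x\<in>?Z. \<Sum>h\<in>G. h x)"
  have "\<forall>h\<in>G. \<exists>m \<kappa>. m \<in> lattice_cone P \<and> \<kappa> \<noteq> 0 \<and> h = laurent_fun P ?Z (single m \<kappa>)"
    using G unfolding eigenfunction_iff [OF P] by blast
  then obtain m \<kappa> where h: "\<And>h. h \<in> G \<Longrightarrow> m h \<in> lattice_cone P \<and> \<kappa> h \<noteq> 0 \<and>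
      h = laurent_fun P ?Z (single (m h) (\<kappa> h))"
    by metis
  have wm: "weight P h = - m h" if "h \<in> G" for h
    using weight_monomial [OF P, of "\<kappa> h" "m h"] h [OF that] by simp
  have inj: "h = h'" if "h \<in> G" "h' \<in> G" "m h = m h'" for h h'
  proof -
    have "inj_on (weight P) G" using G by blast
    moreover have "weight P h = weight P h'" using wm [OF that(1)] wm [OF that(2)] that(3) by simp
    ultimately show ?thesis using that(1,2) by (rule inj_onD)
  qed
  let ?r = "\<Sum>h\<in>G. single (m h) (\<kappa> h)"
  have "laurent_fun P ?Z ?r = (\<lambda>x\<in>?Z. \<Sum>h\<in>G. h x)"
    unfolding sum by (intro restrict_ext sum.cong refl) (use h in metis)
  then have "laurent_fun P ?Z q = laurent_fun P ?Z ?r" using G by simp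
  moreover have "?r \<in> laurents (lattice_cone P)"
    using keys_sum [of "\<lambda>h. single (m h) (\<kappa> h)" G] h
    by (fastforce simp: laurents_def split: if_splits)
  ultimately have r: "q = ?r" using laurent_fun_inject [OF P q] by blast
  have lookup: "lookup q (m h) = \<kappa> h" if "h \<in> G" for h
  proof -
    have "lookup q (m h) = (\<Sum>h'\<in>G. if h' = h then \<kappa> h else 0)"
      unfolding r lookup_sum using inj [OF _ that]
      by (intro sum.cong refl) (auto simp: lookup_single when_def)
    then show ?thesis using G that by simp
  qed
  have keys: "keys q = m ` G"
  proof
    show "keys q \<subseteq> m ` G"
      using keys_sum [of "\<lambda>h. single (m h) (\<kappa> h)" G] unfolding r
      by (fastforce split: if_splits)
    show "m ` G \<subseteq> keys q"
      using lookup h by (auto simp: in_keys_iff)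
  qed
  have "?mono (m h) = h" if "h \<in> G" for h using h [OF that] lookup [OF that] by simp
  then show "G = ?G" unfolding keys by (force simp: image_image)
qed

end


section \<open>Flags of faces and their spans\<close>

text \<open>The empty face is given the interior vector zero, which makes the origin the cone over a
  facet of a vertex in all statements below.\<close>

definition interior_vec :: "'a::euclidean_space set \<Rightarrow> real \<times> 'a \<Rightarrow> bool" where
  "interior_vec \<sigma> w \<longleftrightarrow> (if \<sigma> = {} then w = 0 else 0 < fst w \<and> (1 / fst w) *\<^sub>R snd w \<in> rel_interior \<sigma>)"

lemma interior_vec_in_real_cone: "interior_vec \<sigma> w \<Longrightarrow> w \<in> real_cone \<sigma>"
  using rel_interior_subset [of \<sigma>]
  by (cases "\<sigma> = {}"; cases w) (auto simp: interior_vec_def real_cone_def zero_prod_def)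

text \<open>Prolonging the segment from a point of \<open>\<sigma>\<close> through an interior point keeps it in \<open>\<sigma>\<close> for a
  while, so large multiples of an interior vector absorb the negative of any vector of the cone.\<close>

lemma interior_vec_absorbs:
  assumes \<sigma>: "convex \<sigma>" and w: "interior_vec \<sigma> w" and z: "z \<in> real_cone \<sigma>"
  shows "\<exists>N::nat. real N *\<^sub>R w - z \<in> real_cone \<sigma>"
proof (cases "z = 0")
  case True
  then show ?thesis by (intro exI [of _ 0]) simp
next
  case False
  obtain k a d x where ka: "z = (k, a)" and dx: "w = (d, x)" by (cases z, cases w) auto
  have k: "0 < k" "(1 / k) *\<^sub>R a \<in> \<sigma>" using z False ka by (auto simp: real_cone_def zero_prod_def)
  then have "\<sigma> \<noteq> {}" by auto
  then have d: "0 < d" "(1 / d) *\<^sub>R x \<in> rel_interior \<sigma>" using w dx by (auto simp: interior_vec_def)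
  obtain e where e: "1 < e" "(1 - e) *\<^sub>R ((1 / k) *\<^sub>R a) + e *\<^sub>R ((1 / d) *\<^sub>R x) \<in> \<sigma>"
    using convex_rel_interior_if [OF \<sigma> d(2)] k(2) hull_inc by (metis order_refl)
  \<comment> \<open>The coefficient of \<open>w\<close> when the prolonged point, at height 1, is scaled so that \<open>z\<close> has coefficient \<open>-1\<close>.\<close>
  define r where "r = k * e / ((e - 1) * d)"
  have "(k / (e - 1)) *\<^sub>R (1, (1 - e) *\<^sub>R ((1 / k) *\<^sub>R a) + e *\<^sub>R ((1 / d) *\<^sub>R x)) \<in> real_cone \<sigma>"
    using e k by (intro real_cone_scale) (auto simp: real_cone_1_iff)
  moreover have "(k / (e - 1)) *\<^sub>R (1, (1 - e) *\<^sub>R ((1 / k) *\<^sub>R a) + e *\<^sub>R ((1 / d) *\<^sub>R x)) = r *\<^sub>R w - z"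
  proof -
    have 1: "k / (e - 1) = r * d - k" using e d by (simp add: r_def field_simps)
    have 2: "k / (e - 1) * (1 - e) * (1 / k) = - 1" using e k by (simp add: field_simps)
    have 3: "k / (e - 1) * e * (1 / d) = r" using e d by (simp add: r_def field_simps)
    have "(k / (e - 1)) *\<^sub>R ((1 - e) *\<^sub>R ((1 / k) *\<^sub>R a) + e *\<^sub>R ((1 / d) *\<^sub>R x))
        = (k / (e - 1) * (1 - e) * (1 / k)) *\<^sub>R a + (k / (e - 1) * e * (1 / d)) *\<^sub>R x"
      by (simp only: scaleR_right_distrib scaleR_scaleR mult.assoc)
    also have "\<dots> = r *\<^sub>R x - a" by (simp only: 2 3) simp
    finally show ?thesis using 1 by (simp add: ka dx)
  qed
  ultimately have r: "r *\<^sub>R w - z \<in> real_cone \<sigma>" by simp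
  define N where "N = nat \<lceil>r\<rceil>"
  have "(real N - r) *\<^sub>R w \<in> real_cone \<sigma>"
    using interior_vec_in_real_cone [OF w] by (intro real_cone_scale) (auto simp: N_def, linarith)
  from real_cone_add [OF \<sigma> r this] have "real N *\<^sub>R w - z \<in> real_cone \<sigma>"
    by (simp add: algebra_simps)
  then show ?thesis ..
qed

text \<open>The vectors that some multiple of \<open>w\<close> shifts into the cone form a subspace that contains the cone.\<close>

lemma span_shift_into_cone:
  assumes \<sigma>: "convex \<sigma>" and w: "interior_vec \<sigma> w" and y: "y \<in> span (real_cone \<sigma>)"
  shows "\<exists>N::nat. y + real N *\<^sub>R w \<in> real_cone \<sigma>"
proof -
  define T where "T = {y. \<exists>N::nat. y + real N *\<^sub>R w \<in> real_cone \<sigma>}"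
  have TI: "y \<in> T" if "y + r *\<^sub>R w \<in> real_cone \<sigma>" for y r
  proof -
    define N where "N = nat \<lceil>r\<rceil>"
    have "(real N - r) *\<^sub>R w \<in> real_cone \<sigma>"
      using interior_vec_in_real_cone [OF w] by (intro real_cone_scale) (auto simp: N_def, linarith)
    from real_cone_add [OF \<sigma> that this] have "y + real N *\<^sub>R w \<in> real_cone \<sigma>"
      by (simp add: algebra_simps)
    then show ?thesis unfolding T_def by blast
  qed
  have add: "x + y \<in> T" if xy: "x \<in> T" "y \<in> T" for x y
  proof -
    obtain N N' where "x + real N *\<^sub>R w \<in> real_cone \<sigma>" "y + real N' *\<^sub>R w \<in> real_cone \<sigma>"
      using xy unfolding T_def by blast
    from real_cone_add [OF \<sigma> this] show ?thesis
      by (intro TI [of _ "real N + real N'"]) (simp add: algebra_simps)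
  qed
  have pos: "c *\<^sub>R x \<in> T" if x: "x \<in> T" "0 \<le> c" for c x
  proof -
    obtain N where "x + real N *\<^sub>R w \<in> real_cone \<sigma>" using x unfolding T_def by blast
    from real_cone_scale [OF this x(2)] show ?thesis
      by (intro TI [of _ "c * real N"]) (simp add: algebra_simps)
  qed
  have neg: "- x \<in> T" if x: "x \<in> T" for x
  proof -
    obtain N where N: "x + real N *\<^sub>R w \<in> real_cone \<sigma>" using x unfolding T_def by blast
    obtain N' where "real N' *\<^sub>R w - (x + real N *\<^sub>R w) \<in> real_cone \<sigma>"
      using interior_vec_absorbs [OF \<sigma> w N] by blast
    then show ?thesis by (intro TI [of _ "real N' - real N"]) (simp add: algebra_simps)
  qed
  have "subspace T"
  proof (rule subspaceI)
    show "0 \<in> T" by (rule TI [of _ 0]) simp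
    show "c *\<^sub>R x \<in> T" if "x \<in> T" for c x
      using pos [OF that, of c] pos [OF neg [OF that], of "- c"] by (cases "0 \<le> c") auto
  qed (rule add)
  moreover have "real_cone \<sigma> \<subseteq> T" using TI [of _ 0] by auto
  ultimately have "y \<in> T" using y span_minimal by blast
  then show ?thesis by (simp add: T_def)
qed

lemma affine_hull_cone: "a \<in> affine hull X \<Longrightarrow> (1::real, a) \<in> span (Pair 1 ` X)"
proof -
  assume a: "a \<in> affine hull X"
  have "affine {a. (1::real, a) \<in> span (Pair 1 ` X)}"
    unfolding affine_def
  proof clarify
    fix x y and u v :: real
    assume x: "(1::real, x) \<in> span (Pair 1 ` X)" and y: "(1::real, y) \<in> span (Pair 1 ` X)" and "u + v = 1"
    have "u *\<^sub>R (1::real, x) + v *\<^sub>R (1, y) \<in> span (Pair 1 ` X)"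
      by (rule span_add [OF span_scale [OF x] span_scale [OF y]])
    then show "(1::real, u *\<^sub>R x + v *\<^sub>R y) \<in> span (Pair 1 ` X)"
      using \<open>u + v = 1\<close> by simp
  qed
  moreover have "X \<subseteq> {a. (1::real, a) \<in> span (Pair 1 ` X)}" by (auto intro: span_base)
  ultimately show ?thesis using a hull_minimal [of X _ affine] by blast
qed

lemma span_real_coneI:
  assumes "\<And>a. a \<in> \<sigma> \<Longrightarrow> (1, a) \<in> span W" "z \<in> real_cone \<sigma>" shows "z \<in> span W"
proof (cases "z = 0")
  case False
  then obtain k a where ka: "z = (k, a)" "0 < k" "(1 / k) *\<^sub>R a \<in> \<sigma>"
    using assms(2) by (cases z) (auto simp: real_cone_def zero_prod_def)
  then have "k *\<^sub>R (1, (1 / k) *\<^sub>R a) \<in> span W" using assms(1) by (intro span_scale) blast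
  then show ?thesis using ka by simp
qed (simp add: span_zero)

lemma span_real_cone_full:
  fixes P :: "'a::euclidean_space set"
  assumes "aff_dim P = int DIM('a)" shows "span (real_cone P) = UNIV"
proof -
  have hull: "affine hull P = UNIV" using assms aff_dim_eq_full by blast
  have 1: "(1, a) \<in> span (real_cone P)" for a
  proof -
    have "Pair 1 ` P \<subseteq> real_cone P" by (auto simp: real_cone_1_iff)
    moreover have "(1::real, a) \<in> span (Pair 1 ` P)" by (rule affine_hull_cone) (simp add: hull)
    ultimately show ?thesis using span_mono by blast
  qed
  have "(k, a) \<in> span (real_cone P)" for k a
    using span_add [OF span_scale [OF 1 [of 0], of "k - 1"] 1 [of a]] by simp
  then show ?thesis by auto
qed

text \<open>If \<open>z\<close> were in the span of the facet cone, it could be shifted into that cone by a vector of the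
  larger cone, and extremality would put \<open>z\<close> itself there.  The spans then agree by dimension.\<close>

lemma facet_span:
  fixes \<tau> :: "'a::euclidean_space set"
  assumes \<tau>: "convex \<tau>" "\<tau> \<noteq> {}" and \<rho>: "\<rho> face_of \<tau>" and dim: "aff_dim \<rho> = aff_dim \<tau> - 1"
    and w: "interior_vec \<rho> w" and z: "interior_vec \<tau> z"
  shows "z \<notin> span (real_cone \<rho>)" and "span (real_cone \<tau>) = span (insert z (real_cone \<rho>))"
proof -
  obtain d x where dx: "z = (d, x)" by (cases z)
  let ?x = "(1 / d) *\<^sub>R x"
  have d: "0 < d" "?x \<in> rel_interior \<tau>" using z \<tau> dx by (auto simp: interior_vec_def)
  have z_eq: "z = d *\<^sub>R (1, ?x)" "(1, ?x) = (1 / d) *\<^sub>R z" using d dx by auto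
  have "\<rho> \<noteq> \<tau>" using dim by auto
  then have disj: "?x \<notin> \<rho>" using face_of_disjoint_rel_interior [OF \<rho>] d by blast
  show notin: "z \<notin> span (real_cone \<rho>)"
  proof
    assume "z \<in> span (real_cone \<rho>)"
    then obtain N :: nat where "z + real N *\<^sub>R w \<in> real_cone \<rho>"
      using span_shift_into_cone w face_of_imp_convex [OF \<rho>] by blast
    moreover have "real N *\<^sub>R w \<in> real_cone \<tau>"
      using interior_vec_in_real_cone [OF w] real_cone_mono [OF face_of_imp_subset [OF \<rho>]]
      by (intro real_cone_scale) auto
    ultimately have "z \<in> real_cone \<rho>"
      using real_cone_face [OF \<rho> interior_vec_in_real_cone [OF z]] by blast
    then show False using disj d dx by (auto simp: real_cone_def)
  qed
  have x\<rho>: "?x \<notin> affine hull \<rho>"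
  proof
    assume "?x \<in> affine hull \<rho>"
    then have "(1::real, ?x) \<in> span (Pair 1 ` \<rho>)" by (rule affine_hull_cone)
    moreover have "Pair 1 ` \<rho> \<subseteq> real_cone \<rho>" by (auto simp: real_cone_1_iff)
    ultimately have "(1, ?x) \<in> span (real_cone \<rho>)" using span_mono by blast
    then have "z \<in> span (real_cone \<rho>)" unfolding z_eq(1) by (rule span_scale)
    then show False using notin by blast
  qed
  have sub: "insert ?x \<rho> \<subseteq> \<tau>" using d rel_interior_subset face_of_imp_subset [OF \<rho>] by blast
  have "aff_dim (insert ?x \<rho>) = aff_dim \<tau>" using x\<rho> dim by (simp add: aff_dim_insert)
  then have hull: "affine hull (insert ?x \<rho>) = affine hull \<tau>"
    using aff_dim_eq_full_gen [OF sub] by blast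
  have W: "Pair 1 ` insert ?x \<rho> \<subseteq> span (insert z (real_cone \<rho>))"
  proof -
    have "(1, ?x) \<in> span (insert z (real_cone \<rho>))"
      unfolding z_eq(2) by (intro span_scale span_base) simp
    then show ?thesis by (auto intro!: span_base simp: real_cone_1_iff)
  qed
  have "(1, a) \<in> span (insert z (real_cone \<rho>))" if "a \<in> \<tau>" for a
  proof -
    have "a \<in> affine hull (insert ?x \<rho>)" using that hull hull_inc by metis
    then have "(1::real, a) \<in> span (Pair 1 ` insert ?x \<rho>)" by (rule affine_hull_cone)
    then show ?thesis using span_minimal [OF W subspace_span] by blast
  qed
  then have "real_cone \<tau> \<subseteq> span (insert z (real_cone \<rho>))" using span_real_coneI by blast
  moreover have "insert z (real_cone \<rho>) \<subseteq> span (real_cone \<tau>)"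
    using interior_vec_in_real_cone [OF z] real_cone_mono [OF face_of_imp_subset [OF \<rho>]]
    by (auto intro: span_base)
  ultimately show "span (real_cone \<tau>) = span (insert z (real_cone \<rho>))"
    by (meson span_minimal subspace_span subset_antisym)
qed

primrec flag :: "'a::euclidean_space set list \<Rightarrow> bool" where
  "flag [] \<longleftrightarrow> True"
| "flag (\<tau> # \<tau>s) \<longleftrightarrow> \<tau> \<noteq> {} \<and> convex \<tau> \<and> next_face \<tau>s face_of \<tau> \<and>
     aff_dim (next_face \<tau>s) = aff_dim \<tau> - 1 \<and> (\<forall>\<sigma>\<in>set \<tau>s. \<sigma> \<subset> \<tau>) \<and> flag \<tau>s"

lemma next_face_Cons [simp]: "next_face (\<tau> # \<tau>s) = \<tau>"
  by (simp add: next_face_def)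

lemma next_face_Nil [simp]: "next_face [] = {}"
  by (simp add: next_face_def)

definition next_vec :: "('a set \<Rightarrow> 'b::zero) \<Rightarrow> 'a set list \<Rightarrow> 'b" where
  "next_vec w \<tau>s = (case \<tau>s of [] \<Rightarrow> 0 | \<rho> # _ \<Rightarrow> w \<rho>)"

lemma interior_next_vec:
  "(\<And>\<sigma>. \<sigma> \<in> set \<tau>s \<Longrightarrow> interior_vec \<sigma> (w \<sigma>)) \<Longrightarrow> interior_vec (next_face \<tau>s) (next_vec w \<tau>s)"
  by (cases \<tau>s) (auto simp: next_vec_def interior_vec_def)

text \<open>Each step of a flag enlarges the span of the cone by exactly the interior vector of the new
  face, so these vectors form a basis of the span of the largest cone.\<close>

lemma flag_basis:
  fixes w :: "'a::euclidean_space set \<Rightarrow> real \<times> 'a"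
  assumes "flag \<tau>s" "\<And>\<sigma>. \<sigma> \<in> set \<tau>s \<Longrightarrow> interior_vec \<sigma> (w \<sigma>)"
  shows "(\<forall>a. (\<Sum>\<sigma>\<in>set \<tau>s. a \<sigma> *\<^sub>R w \<sigma>) = 0 \<longrightarrow> (\<forall>\<sigma>\<in>set \<tau>s. a \<sigma> = 0)) \<and>
    (\<forall>x. x \<in> span (real_cone (next_face \<tau>s)) \<longleftrightarrow> (\<exists>a. x = (\<Sum>\<sigma>\<in>set \<tau>s. a \<sigma> *\<^sub>R w \<sigma>)))"
  using assms
proof (induction \<tau>s)
  case (Cons \<tau> \<tau>s)
  have \<tau>: "\<tau> \<notin> set \<tau>s" using Cons.prems by auto
  have "(\<forall>a. (\<Sum>\<sigma>\<in>set \<tau>s. a \<sigma> *\<^sub>R w \<sigma>) = 0 \<longrightarrow> (\<forall>\<sigma>\<in>set \<tau>s. a \<sigma> = 0)) \<and>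
    (\<forall>x. x \<in> span (real_cone (next_face \<tau>s)) \<longleftrightarrow> (\<exists>a. x = (\<Sum>\<sigma>\<in>set \<tau>s. a \<sigma> *\<^sub>R w \<sigma>)))"
    by (rule Cons.IH) (use Cons.prems in auto)
  then have IH: "\<And>a. (\<Sum>\<sigma>\<in>set \<tau>s. a \<sigma> *\<^sub>R w \<sigma>) = 0 \<Longrightarrow> \<forall>\<sigma>\<in>set \<tau>s. a \<sigma> = 0"
    "\<And>x. x \<in> span (real_cone (next_face \<tau>s)) \<longleftrightarrow> (\<exists>a. x = (\<Sum>\<sigma>\<in>set \<tau>s. a \<sigma> *\<^sub>R w \<sigma>))"
    by blast+
  have "interior_vec (next_face \<tau>s) (next_vec w \<tau>s)" using Cons.prems by (intro interior_next_vec) auto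
  then have span: "w \<tau> \<notin> span (real_cone (next_face \<tau>s))"
    "span (real_cone \<tau>) = span (insert (w \<tau>) (real_cone (next_face \<tau>s)))"
    using facet_span [of \<tau> "next_face \<tau>s" "next_vec w \<tau>s" "w \<tau>"] Cons.prems by auto
  have sum: "(\<Sum>\<sigma>\<in>set (\<tau> # \<tau>s). a \<sigma> *\<^sub>R w \<sigma>) = a \<tau> *\<^sub>R w \<tau> + (\<Sum>\<sigma>\<in>set \<tau>s. a \<sigma> *\<^sub>R w \<sigma>)" for a
    using \<tau> by simp
  show ?case
  proof (intro conjI allI impI)
    fix a assume 0: "(\<Sum>\<sigma>\<in>set (\<tau> # \<tau>s). a \<sigma> *\<^sub>R w \<sigma>) = 0"
    have "a \<tau> = 0"
    proof (rule ccontr)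
      assume nz: "a \<tau> \<noteq> 0"
      have "a \<tau> *\<^sub>R w \<tau> = (\<Sum>\<sigma>\<in>set \<tau>s. (- a \<sigma>) *\<^sub>R w \<sigma>)"
        using 0 unfolding sum by (simp add: sum_negf eq_neg_iff_add_eq_0)
      then have "a \<tau> *\<^sub>R w \<tau> \<in> span (real_cone (next_face \<tau>s))"
        unfolding IH(2) by (rule exI [of _ "\<lambda>\<sigma>. - a \<sigma>"])
      then have "(1 / a \<tau>) *\<^sub>R (a \<tau> *\<^sub>R w \<tau>) \<in> span (real_cone (next_face \<tau>s))" by (rule span_scale)
      then show False using nz span(1) by simp
    qed
    then show "\<forall>\<sigma>\<in>set (\<tau> # \<tau>s). a \<sigma> = 0" using 0 IH(1) [of a] unfolding sum by simp
  next
    fix x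
    have "x \<in> span (real_cone \<tau>) \<longleftrightarrow> (\<exists>k a. x - k *\<^sub>R w \<tau> = (\<Sum>\<sigma>\<in>set \<tau>s. a \<sigma> *\<^sub>R w \<sigma>))"
      unfolding span(2) span_breakdown_eq IH(2) ..
    also have "\<dots> \<longleftrightarrow> (\<exists>a. x = (\<Sum>\<sigma>\<in>set (\<tau> # \<tau>s). a \<sigma> *\<^sub>R w \<sigma>))"
    proof
      assume "\<exists>k a. x - k *\<^sub>R w \<tau> = (\<Sum>\<sigma>\<in>set \<tau>s. a \<sigma> *\<^sub>R w \<sigma>)"
      then obtain k a where ka: "x - k *\<^sub>R w \<tau> = (\<Sum>\<sigma>\<in>set \<tau>s. a \<sigma> *\<^sub>R w \<sigma>)" by blast
      have "(\<Sum>\<sigma>\<in>set \<tau>s. (a(\<tau> := k)) \<sigma> *\<^sub>R w \<sigma>) = (\<Sum>\<sigma>\<in>set \<tau>s. a \<sigma> *\<^sub>R w \<sigma>)"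
        using \<tau> by (intro sum.cong) auto
      then have "x = (\<Sum>\<sigma>\<in>set (\<tau> # \<tau>s). (a(\<tau> := k)) \<sigma> *\<^sub>R w \<sigma>)"
        unfolding sum using ka by (simp add: algebra_simps)
      then show "\<exists>a. x = (\<Sum>\<sigma>\<in>set (\<tau> # \<tau>s). a \<sigma> *\<^sub>R w \<sigma>)" by blast
    next
      assume "\<exists>a. x = (\<Sum>\<sigma>\<in>set (\<tau> # \<tau>s). a \<sigma> *\<^sub>R w \<sigma>)"
      then obtain a where "x = a \<tau> *\<^sub>R w \<tau> + (\<Sum>\<sigma>\<in>set \<tau>s. a \<sigma> *\<^sub>R w \<sigma>)" unfolding sum by blast
      then have "x - a \<tau> *\<^sub>R w \<tau> = (\<Sum>\<sigma>\<in>set \<tau>s. a \<sigma> *\<^sub>R w \<sigma>)" by simp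
      then show "\<exists>k a. x - k *\<^sub>R w \<tau> = (\<Sum>\<sigma>\<in>set \<tau>s. a \<sigma> *\<^sub>R w \<sigma>)" by blast
    qed
    finally show "x \<in> span (real_cone (next_face (\<tau> # \<tau>s))) \<longleftrightarrow> (\<exists>a. x = (\<Sum>\<sigma>\<in>set (\<tau> # \<tau>s). a \<sigma> *\<^sub>R w \<sigma>))"
      by simp
  qed
qed (simp add: real_cone_empty)


section \<open>Rational coordinates\<close>

text \<open>The reals form a rational vector space, in which 1 extends to a basis.\<close>

lemma rational_functional:
  obtains \<phi> :: "real \<Rightarrow> rat" where "\<And>x y. \<phi> (x + y) = \<phi> x + \<phi> y" "\<phi> 1 = 1"
proof -
  let ?s = "\<lambda>(q::rat) (x::real). of_rat q * x"
  interpret R: vector_space ?s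
    by unfold_locales (simp_all add: algebra_simps of_rat_add of_rat_mult)
  interpret Q: vector_space "(*) :: rat \<Rightarrow> rat \<Rightarrow> rat"
    by unfold_locales (simp_all add: algebra_simps)
  interpret RQ: vector_space_pair ?s "(*) :: rat \<Rightarrow> rat \<Rightarrow> rat" ..
  have "R.independent {1}" by (simp add: R.dependent_single)
  from RQ.linear_independent_extend [OF this, of "\<lambda>_. 1"]
  obtain g where g: "Vector_Spaces.linear ?s (*) g" "g 1 = 1" by auto
  interpret g: Vector_Spaces.linear ?s "(*)" g by (rule g(1))
  show thesis using that [of g] g.add g(2) by blast
qed

lemma additive_of_int_mult:
  fixes \<phi> :: "real \<Rightarrow> rat"
  assumes add: "\<And>x y. \<phi> (x + y) = \<phi> x + \<phi> y"
  shows "\<phi> (of_int k * x) = of_int k * \<phi> x"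
proof -
  have 0: "\<phi> 0 = 0" using add [of 0 0] by simp
  have minus: "\<phi> (- x) = - \<phi> x" for x using add [of "- x" x] 0 by (simp add: eq_neg_iff_add_eq_0)
  have nat: "\<phi> (of_nat n * x) = of_nat n * \<phi> x" for n x
    by (induction n) (auto simp: 0 add algebra_simps)
  show ?thesis
  proof (cases "0 \<le> k")
    case True
    then show ?thesis using nat [of "nat k" x] by simp
  next
    case False
    then have "of_int k * x = - (of_nat (nat (- k)) * x)" by simp
    then have "\<phi> (of_int k * x) = - (of_nat (nat (- k)) * \<phi> x)" by (simp only: minus nat)
    then show ?thesis using False by simp
  qed
qed

text \<open>Applying a rational functional to the coefficients turns a real linear relation between
  integral vectors into a rational one.\<close>

lemma rational_coefficients:
  fixes M :: "'i \<Rightarrow> int \<times> (int ^ 'n)"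
  assumes "real_hat m = (\<Sum>i\<in>I. r i *\<^sub>R real_hat (M i))"
  shows "\<exists>a. real_hat m = (\<Sum>i\<in>I. real_of_rat (a i) *\<^sub>R real_hat (M i))"
proof -
  obtain \<phi> :: "real \<Rightarrow> rat" where add: "\<And>x y. \<phi> (x + y) = \<phi> x + \<phi> y" and one: "\<phi> 1 = 1"
    using rational_functional by blast
  note int = additive_of_int_mult [of \<phi>, OF add]
  have "\<phi> 0 = 0" using add [of 0 0] by simp
  then have sum: "\<phi> (\<Sum>i\<in>I. x i) = (\<Sum>i\<in>I. \<phi> (x i))" for x
    by (induction I rule: infinite_finite_induct) (auto simp: add)
  have *: "real_of_int k = (\<Sum>i\<in>I. real_of_rat (\<phi> (r i)) * real_of_int (l i))"
    if "real_of_int k = (\<Sum>i\<in>I. r i * real_of_int (l i))" for k l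
  proof -
    have "(of_int k :: rat) = \<phi> (real_of_int k)" using int [of k 1] one by simp
    also have "\<dots> = (\<Sum>i\<in>I. of_int (l i) * \<phi> (r i))"
      unfolding that sum by (intro sum.cong refl) (metis int mult.commute)
    finally have "real_of_rat (of_int k) = real_of_rat (\<Sum>i\<in>I. of_int (l i) * \<phi> (r i))" by simp
    then show ?thesis by (simp add: of_rat_sum of_rat_mult mult.commute)
  qed
  have "real_of_int (fst m) = (\<Sum>i\<in>I. r i * real_of_int (fst (M i)))"
    using arg_cong [OF assms, of fst] by (simp add: fst_sum real_hat_eq)
  then have f: "real_of_int (fst m) = (\<Sum>i\<in>I. real_of_rat (\<phi> (r i)) * real_of_int (fst (M i)))"
    by (rule *)
  have "real_of_int (snd m $ j) = (\<Sum>i\<in>I. r i * real_of_int (snd (M i) $ j))" for j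
    using arg_cong [OF arg_cong [OF assms, of snd], of "\<lambda>v. v $ j"]
    by (simp add: snd_sum real_hat_eq real_vec_def)
  then have s: "real_of_int (snd m $ j) = (\<Sum>i\<in>I. real_of_rat (\<phi> (r i)) * real_of_int (snd (M i) $ j))" for j
    by (rule *)
  have "real_hat m = (\<Sum>i\<in>I. real_of_rat (\<phi> (r i)) *\<^sub>R real_hat (M i))"
    by (simp add: prod_eq_iff vec_eq_iff fst_sum snd_sum real_hat_eq real_vec_def f s)
  then show ?thesis by (rule exI [of _ "\<lambda>i. \<phi> (r i)"])
qed

lemma common_denominator:
  assumes "finite F" shows "\<exists>N::int. 0 < N \<and> (\<forall>x\<in>F. of_int N * (x::rat) \<in> \<int>)"
  using assms
proof (induction F)
  case (insert x F)
  then obtain N where N: "0 < N" "\<forall>x\<in>F. of_int N * (x::rat) \<in> \<int>" by blast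
  obtain p q where pq: "quotient_of x = (p, q)" by (cases "quotient_of x")
  then have q: "0 < q" "x = of_int p / of_int q"
    using quotient_of_denom_pos quotient_of_div by blast+
  have "of_int (N * q) * y \<in> \<int>" if "y \<in> F" for y
  proof -
    have "of_int (N * q) * y = of_int q * (of_int N * y)" by simp
    then show ?thesis using N(2) that by (metis Ints_mult Ints_of_int)
  qed
  moreover have "of_int (N * q) * x = of_int (N * p)" using q by simp
  then have "of_int (N * q) * x \<in> \<int>" by (metis Ints_of_int)
  ultimately show ?case using N q by (intro exI [of _ "N * q"]) auto
qed (auto intro: exI [of _ 1])

text \<open>It suffices to clear the denominators on the standard basis of the lattice.\<close>

lemma additive_denominator:
  fixes g :: "int \<times> (int ^ 'n) \<Rightarrow> rat"
  assumes add: "\<And>x y. g (x + y) = g x + g y"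
  shows "\<exists>N::int. 0 < N \<and> (\<forall>x. of_int N * g x \<in> \<int>)"
proof -
  have 0: "g 0 = 0" using add [of 0 0] by simp
  have minus: "g (- x) = - g x" for x using add [of "- x" x] 0 by (simp add: eq_neg_iff_add_eq_0)
  have sum: "g (\<Sum>i\<in>I. x i) = (\<Sum>i\<in>I. g (x i))" for I :: "'n set" and x
    by (induction I rule: infinite_finite_induct) (auto simp: 0 add)
  let ?F = "insert (g (1, 0)) (range (\<lambda>i. g (0, axis i 1)))"
  obtain N :: int where N: "0 < N" "\<forall>x\<in>?F. of_int N * x \<in> \<int>"
    using common_denominator [of ?F] by auto
  define G where "G = {x. of_int N * g x \<in> \<int>}"
  have G_add: "x + y \<in> G" if "x \<in> G" "y \<in> G" for x y
    using that by (simp add: G_def add distrib_left)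
  have G_minus: "- x \<in> G" if "x \<in> G" for x using that by (simp add: G_def minus)
  have G_0: "0 \<in> G" by (simp add: G_def 0)
  have G_sum: "(\<Sum>i\<in>I. x i) \<in> G" if "\<And>i. x i \<in> G" for I :: "'n set" and x
    using that by (induction I rule: infinite_finite_induct) (auto simp: G_0 G_add)
  have G_nat: "(int n * fst x, int n *s snd x) \<in> G" if "x \<in> G" for n x
  proof (induction n)
    case 0
    then show ?case using G_0 by (simp add: zero_prod_def)
  next
    case (Suc n)
    have "(int (Suc n) * fst x, int (Suc n) *s snd x) = (int n * fst x, int n *s snd x) + x"
      by (simp add: prod_eq_iff vec_eq_iff algebra_simps)
    then show ?case using G_add [OF Suc that] by simp
  qed
  have G_int: "(k * fst x, k *s snd x) \<in> G" if "x \<in> G" for k x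
  proof (cases "0 \<le> k")
    case True
    then show ?thesis using G_nat [OF that, of "nat k"] by simp
  next
    case False
    then have "(k * fst x, k *s snd x) = - (int (nat (- k)) * fst x, int (nat (- k)) *s snd x)"
      by (simp add: prod_eq_iff vec_eq_iff)
    then show ?thesis using G_minus [OF G_nat [OF that, of "nat (- k)"]] by simp
  qed
  have "x \<in> G" for x
  proof -
    have "(1, 0) \<in> G" "(0, axis i 1) \<in> G" for i using N by (auto simp: G_def)
    then have "(fst x, 0) \<in> G" "(0, snd x $ i *s axis i 1) \<in> G" for i
      using G_int [of "(1, 0)" "fst x"] G_int [of "(0, axis i 1)" "snd x $ i"] by auto
    then have "(fst x, 0) + (\<Sum>i\<in>UNIV. (0, snd x $ i *s axis i 1)) \<in> G" by (intro G_add G_sum)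
    moreover have "(fst x, 0) + (\<Sum>i\<in>UNIV. (0, snd x $ i *s axis i 1)) = x"
      by (simp add: prod_eq_iff fst_sum snd_sum basis_expansion)
    ultimately show ?thesis by simp
  qed
  then show ?thesis using N(1) by (auto simp: G_def)
qed

text \<open>A nonzero rational-valued additive function on a lattice has a discrete group of values, so it
  becomes surjective onto the integers after scaling.\<close>

lemma additive_normalization:
  fixes g :: "int \<times> (int ^ 'n) \<Rightarrow> rat"
  assumes add: "\<And>x y. g (x + y) = g x + g y"
    and L: "\<And>x y. x \<in> L \<Longrightarrow> y \<in> L \<Longrightarrow> x - y \<in> L" and M: "M \<in> L" "g M = 1"
  obtains b :: int and x where "0 < b" "x \<in> L" "of_int b * g x = 1" "\<And>y. y \<in> L \<Longrightarrow> of_int b * g y \<in> \<int>"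
proof -
  obtain N :: int where N: "0 < N" "\<And>x. of_int N * g x \<in> \<int>" using additive_denominator [OF add] by blast
  have L0: "0 \<in> L" using L [OF M(1) M(1)] by simp
  have Ladd: "x + y \<in> L" if "x \<in> L" "y \<in> L" for x y
    using L [OF that(1) L [OF L0 that(2)]] by simp
  have minus: "g (x - y) = g x - g y" for x y using add [of "x - y" y] by simp
  define D where "D n \<longleftrightarrow> 0 < n \<and> (\<exists>x\<in>L. of_nat n = of_int N * g x)" for n :: nat
  have "D (nat N)" using N M by (auto simp: D_def intro!: bexI [of _ M])
  then have D: "D (Least D)" by (rule LeastI)
  define d where "d = Least D"
  obtain x where x: "x \<in> L" "of_nat d = of_int N * g x" and d: "0 < d" using D by (auto simp: D_def d_def)
  have int: "of_int N * g y / of_nat d \<in> \<int>" if y: "y \<in> L" for y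
  proof -
    obtain k where k: "of_int N * g y = of_int k" using N(2) [of y] by (auto elim: Ints_cases)
    have mult: "\<exists>z\<in>L. of_int N * g z = of_int l * of_nat d" for l
    proof -
      have nat: "\<exists>z\<in>L. of_int N * g z = of_nat n * of_nat d" for n
      proof (induction n)
        case 0
        show ?case using L0 add [of 0 0] by (intro bexI [of _ 0]) auto
      next
        case (Suc n)
        then obtain z where "z \<in> L" "of_int N * g z = of_nat n * of_nat d" by blast
        then show ?case using x Ladd by (intro bexI [of _ "z + x"]) (auto simp: add algebra_simps)
      qed
      show ?thesis
      proof (cases "0 \<le> l")
        case True
        then show ?thesis using nat [of "nat l"] by simp
      next
        case False
        obtain z where "z \<in> L" "of_int N * g z = of_nat (nat (- l)) * of_nat d" using nat by blast
        then show ?thesis using False L [OF L0] minus [of 0 z] add [of 0 0]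
          by (intro bexI [of _ "0 - z"]) auto
      qed
    qed
    obtain z where z: "z \<in> L" "of_int N * g z = of_int (k div int d) * of_nat d" using mult by blast
    have "of_int N * g (y - z) = of_int (k - (k div int d) * int d)"
      by (simp add: minus right_diff_distrib k z)
    then have r: "of_int N * g (y - z) = of_int (k mod int d)" by (simp add: minus_div_mult_eq_mod)
    have "k mod int d = 0"
    proof (rule ccontr)
      assume "k mod int d \<noteq> 0"
      then have pos: "0 < k mod int d" using pos_mod_sign [of "int d" k] d by linarith
      then have "of_nat (nat (k mod int d)) = of_int N * g (y - z)" using r by simp
      then have "D (nat (k mod int d))"
        unfolding D_def using pos L [OF y z(1)] by auto
      then have "d \<le> nat (k mod int d)" unfolding d_def by (rule Least_le)
      moreover have "k mod int d < int d" using d by simp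
      ultimately show False using pos by linarith
    qed
    then obtain l where "k = int d * l" by auto
    then have "of_int N * g y / of_nat d = of_int l" using k d by simp
    then show ?thesis by simp
  qed
  define b where "b = \<lfloor>of_int N / of_nat d :: rat\<rfloor>"
  have b: "of_int b = (of_int N / of_nat d :: rat)"
    using int [OF M(1)] M(2) by (simp add: b_def)
  show thesis
  proof
    have "(0::rat) < of_int b" unfolding b using N d by simp
    then show "0 < b" by simp
    show "x \<in> L" by (rule x(1))
    have "of_int b * g x = of_int N * g x / of_nat d" by (simp add: b)
    then show "of_int b * g x = 1" using d by (simp flip: x(2))
    show "of_int b * g y \<in> \<int>" if "y \<in> L" for y unfolding b using int [OF that] by simp
  qed
qed


section \<open>The lexicographic order\<close>

locale lex_order =
  fixes A :: "'a set" and t :: "'a rel"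
  assumes finite_A: "finite A" and linear: "linear_order_on A t"
begin

lemma t_antisym: "(\<sigma>, \<tau>) \<in> t \<Longrightarrow> (\<tau>, \<sigma>) \<in> t \<Longrightarrow> \<sigma> = \<tau>"
  using linear by (auto simp: linear_order_on_def partial_order_on_def antisym_def)

lemma t_trans: "(\<sigma>, \<tau>) \<in> t \<Longrightarrow> (\<tau>, \<rho>) \<in> t \<Longrightarrow> (\<sigma>, \<rho>) \<in> t"
  using linear unfolding linear_order_on_def partial_order_on_def preorder_on_def trans_def by blast

lemma t_total: "\<sigma> \<in> A \<Longrightarrow> \<tau> \<in> A \<Longrightarrow> \<sigma> \<noteq> \<tau> \<Longrightarrow> (\<sigma>, \<tau>) \<in> t \<or> (\<tau>, \<sigma>) \<in> t"
  using linear by (auto simp: linear_order_on_def total_on_def)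

lemma finite_has_greatest:
  "finite D \<Longrightarrow> D \<noteq> {} \<Longrightarrow> D \<subseteq> A \<Longrightarrow> \<exists>\<sigma>\<in>D. \<forall>\<tau>\<in>D. \<tau> \<noteq> \<sigma> \<longrightarrow> (\<tau>, \<sigma>) \<in> t"
proof (induction D rule: finite_ne_induct)
  case (insert x D)
  then obtain \<sigma> where \<sigma>: "\<sigma> \<in> D" "\<forall>\<tau>\<in>D. \<tau> \<noteq> \<sigma> \<longrightarrow> (\<tau>, \<sigma>) \<in> t" by blast
  have "x \<noteq> \<sigma>" using insert \<sigma> by blast
  then consider "(\<sigma>, x) \<in> t" | "(x, \<sigma>) \<in> t" using t_total [of x \<sigma>] insert \<sigma> by blast
  then show ?case
  proof cases
    case 1
    have "(\<tau>, x) \<in> t" if "\<tau> \<in> D" for \<tau>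
      using that 1 \<sigma> t_trans [OF _ 1, of \<tau>] by (cases "\<tau> = \<sigma>") auto
    then show ?thesis by blast
  next
    case 2
    then show ?thesis using \<sigma> by blast
  qed
qed auto

lemma lex_less_irrefl: "\<not> lex_less A t u u"
  by (simp add: lex_less_def)

lemma lex_less_trans:
  assumes "lex_less A t u v" "lex_less A t v w" shows "lex_less A t u w"
proof -
  obtain \<sigma> where \<sigma>: "\<sigma> \<in> A" "u \<sigma> < v \<sigma>" "\<And>\<tau>. \<tau> \<in> A \<Longrightarrow> (\<sigma>, \<tau>) \<in> t \<Longrightarrow> \<tau> \<noteq> \<sigma> \<Longrightarrow> u \<tau> = v \<tau>"
    using assms(1) unfolding lex_less_def by blast
  obtain \<rho> where \<rho>: "\<rho> \<in> A" "v \<rho> < w \<rho>" "\<And>\<tau>. \<tau> \<in> A \<Longrightarrow> (\<rho>, \<tau>) \<in> t \<Longrightarrow> \<tau> \<noteq> \<rho> \<Longrightarrow> v \<tau> = w \<tau>"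
    using assms(2) unfolding lex_less_def by blast
  consider "\<sigma> = \<rho>" | "\<sigma> \<noteq> \<rho>" "(\<sigma>, \<rho>) \<in> t" | "\<sigma> \<noteq> \<rho>" "(\<rho>, \<sigma>) \<in> t"
    using t_total \<sigma>(1) \<rho>(1) by blast
  then show ?thesis
  proof cases
    case 1
    then have "u \<sigma> < w \<sigma>" using \<sigma>(2) \<rho>(2) by simp
    then show ?thesis unfolding lex_less_def using \<sigma> \<rho> 1 by (intro bexI [of _ \<sigma>]) auto
  next
    case 2
    have "u \<rho> < w \<rho>" using \<sigma>(3) [of \<rho>] \<rho> 2 by simp
    moreover have "u \<tau> = w \<tau>" if "\<tau> \<in> A" "(\<rho>, \<tau>) \<in> t" "\<tau> \<noteq> \<rho>" for \<tau>
    proof -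
      have "(\<sigma>, \<tau>) \<in> t" "\<tau> \<noteq> \<sigma>" using t_trans [OF 2(2)] t_antisym [OF 2(2)] that by auto
      then show ?thesis using \<sigma>(3) \<rho>(3) that by simp
    qed
    ultimately show ?thesis unfolding lex_less_def using \<rho>(1) by blast
  next
    case 3
    have "u \<sigma> < w \<sigma>" using \<rho>(3) [of \<sigma>] \<sigma> 3 by simp
    moreover have "u \<tau> = w \<tau>" if "\<tau> \<in> A" "(\<sigma>, \<tau>) \<in> t" "\<tau> \<noteq> \<sigma>" for \<tau>
    proof -
      have "(\<rho>, \<tau>) \<in> t" "\<tau> \<noteq> \<rho>" using t_trans [OF 3(2)] t_antisym [OF 3(2)] that by auto
      then show ?thesis using \<sigma>(3) \<rho>(3) that by simp
    qed
    ultimately show ?thesis unfolding lex_less_def using \<sigma>(1) by blast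
  qed
qed

lemma lex_less_total:
  assumes "\<sigma> \<in> A" "u \<sigma> \<noteq> v \<sigma>" shows "lex_less A t u v \<or> lex_less A t v u"
proof -
  let ?D = "{\<sigma> \<in> A. u \<sigma> \<noteq> v \<sigma>}"
  have "finite ?D" "?D \<noteq> {}" "?D \<subseteq> A" using finite_A assms by auto
  then obtain \<rho> where "\<rho> \<in> ?D" "\<forall>\<tau>\<in>?D. \<tau> \<noteq> \<rho> \<longrightarrow> (\<tau>, \<rho>) \<in> t" using finite_has_greatest by blast
  then have \<rho>: "\<rho> \<in> A" "u \<rho> \<noteq> v \<rho>" "\<forall>\<tau>\<in>A. (\<rho>, \<tau>) \<in> t \<and> \<tau> \<noteq> \<rho> \<longrightarrow> u \<tau> = v \<tau>"
    using t_antisym by blast+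
  then have "u \<rho> < v \<rho> \<or> v \<rho> < u \<rho>" by auto
  then show ?thesis
  proof
    assume "u \<rho> < v \<rho>"
    then have "lex_less A t u v" unfolding lex_less_def using \<rho> by (intro bexI [of _ \<rho>]) auto
    then show ?thesis ..
  next
    assume "v \<rho> < u \<rho>"
    then have "lex_less A t v u" unfolding lex_less_def using \<rho> by (intro bexI [of _ \<rho>]) auto
    then show ?thesis ..
  qed
qed

lemma lex_min_eqI:
  assumes "u \<in> S" "\<And>v. v \<in> S \<Longrightarrow> v = u \<or> lex_less A t u v"
  shows "lex_min A t S = u"
  unfolding lex_min_def
proof (rule the_equality)
  show "u \<in> S \<and> (\<forall>v\<in>S. v = u \<or> lex_less A t u v)" using assms by blast
  fix w assume w: "w \<in> S \<and> (\<forall>v\<in>S. v = w \<or> lex_less A t w v)"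
  show "w = u"
  proof (rule ccontr)
    assume "w \<noteq> u"
    then have "lex_less A t u w" "lex_less A t w u" using w assms by auto
    then show False using lex_less_trans lex_less_irrefl by blast
  qed
qed

end


section \<open>Maximal chains of faces are flags\<close>

lemma sorted_wrt_supset_unique:
  "sorted_wrt (\<supset>) xs \<Longrightarrow> sorted_wrt (\<supset>) ys \<Longrightarrow> set xs = set ys \<Longrightarrow> xs = ys"
proof (induction xs arbitrary: ys)
  case (Cons x xs)
  then obtain y ys' where ys: "ys = y # ys'" by (cases ys) auto
  have "x = y"
  proof (rule ccontr)
    assume "x \<noteq> y"
    then have "x \<in> set ys'" "y \<in> set xs" using Cons.prems ys by auto
    then have "y \<supset> x" "x \<supset> y" using Cons.prems ys by auto
    then show False by blast
  qed
  moreover have "x \<notin> set xs" "y \<notin> set ys'" using Cons.prems ys by auto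
  then have "set xs = set ys'" using Cons.prems ys \<open>x = y\<close> by auto
  ultimately show ?case using Cons ys by auto
qed simp

lemma finite_chain_sorted:
  assumes "finite C" "\<And>X Y. X \<in> C \<Longrightarrow> Y \<in> C \<Longrightarrow> X \<subseteq> Y \<or> Y \<subseteq> X"
  shows "\<exists>xs. set xs = C \<and> sorted_wrt (\<supset>) xs"
  using assms
proof (induction "card C" arbitrary: C)
  case 0
  then show ?case by (intro exI [of _ "[]"]) auto
next
  case (Suc n)
  then have "C \<noteq> {}" by auto
  then obtain X where X: "X \<in> C" "\<And>Y. Y \<in> C \<Longrightarrow> X \<subseteq> Y \<Longrightarrow> X = Y"
    using finite_has_maximal [OF Suc.prems(1)] by blast
  have "card (C - {X}) = n" using Suc X by simp
  then obtain xs where xs: "set xs = C - {X}" "sorted_wrt (\<supset>) xs"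
    using Suc.hyps(1) [of "C - {X}"] Suc.prems by auto
  have "Y \<subset> X" if "Y \<in> C - {X}" for Y using that X Suc.prems(2) [of X Y] by auto
  then show ?case using xs X by (intro exI [of _ "X # xs"]) auto
qed

lemma desc_list:
  assumes "finite C" "\<And>X Y. X \<in> C \<Longrightarrow> Y \<in> C \<Longrightarrow> X \<subseteq> Y \<or> Y \<subseteq> X"
  shows "set (desc_list C) = C \<and> sorted_wrt (\<supset>) (desc_list C)"
proof -
  have "\<exists>!\<tau>s. set \<tau>s = C \<and> sorted_wrt (\<supset>) \<tau>s"
    using finite_chain_sorted [OF assms] sorted_wrt_supset_unique by blast
  then show ?thesis unfolding desc_list_def by (rule theI')
qed

lemma max_chain_member:
  assumes C: "subset.maxchain A C" and G: "G \<in> A" "\<And>X. X \<in> C \<Longrightarrow> X \<subseteq> G \<or> G \<subseteq> X"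
  shows "G \<in> C"
proof (rule ccontr)
  assume "G \<notin> C"
  have "subset.chain A C" using C by (simp add: subset.maxchain_def)
  then have "subset.chain A (insert G C)"
    using G by (auto simp: subset_chain_def)
  then show False using C \<open>G \<notin> C\<close> unfolding subset.maxchain_def by blast
qed

text \<open>A proper nonempty face of a polytope lies in a facet, and a polytope has a vertex.  By maximality
  these facets and vertices are members of the chain already.\<close>

lemma max_chain_flag:
  fixes P :: "(real ^ 'n) set"
  assumes P: "polytope P" "P \<noteq> {}" and C: "C \<in> max_chains P"
  shows "flag (desc_list C)" "set (desc_list C) = C" "C \<subseteq> faces P" "next_face (desc_list C) = P"
proof -
  have max: "subset.maxchain (faces P) C" using C by (simp add: max_chains_def)
  then have chain: "subset.chain (faces P) C" by (simp add: subset.maxchain_def)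
  show sub: "C \<subseteq> faces P" using chain by (simp add: subset_chain_def)
  have "finite (faces P)"
    using finite_subset [OF _ finite_polytope_faces [OF P(1)]] by (auto simp: faces_def)
  then have fin: "finite C" using sub finite_subset by blast
  have cmp: "X \<subseteq> Y \<or> Y \<subseteq> X" if "X \<in> C" "Y \<in> C" for X Y
    using chain that by (auto simp: subset_chain_def)
  let ?ts = "desc_list C"
  have ts: "set ?ts = C" "sorted_wrt (\<supset>) ?ts" using desc_list [OF fin cmp] by auto
  then show "set ?ts = C" by simp
  have member: "G \<in> C" if "G face_of P" "G \<noteq> {}" "\<And>X. X \<in> C \<Longrightarrow> X \<subseteq> G \<or> G \<subseteq> X" for G
    using max_chain_member [OF max, of G] that by (auto simp: faces_def)
  have "P face_of P" using P polytope_imp_convex face_of_refl by blast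
  then have PC: "P \<in> C" using member [of P] P sub face_of_imp_subset by (auto simp: faces_def)
  show "next_face ?ts = P"
  proof (cases ?ts)
    case (Cons \<tau> \<tau>s)
    then have "\<tau> = P \<or> P \<subset> \<tau>" using ts PC by auto
    moreover have "\<tau> \<subseteq> P" using sub ts Cons face_of_imp_subset by (auto simp: faces_def)
    ultimately show ?thesis using Cons by auto
  qed (use ts PC in auto)
  have "flag \<tau>s" if "?ts = pre @ \<tau>s" for pre \<tau>s
    using that
  proof (induction \<tau>s arbitrary: pre)
    case (Cons \<tau> \<tau>s)
    have IH: "flag \<tau>s" using Cons.IH [of "pre @ [\<tau>]"] Cons.prems by simp
    have C_eq: "C = set pre \<union> {\<tau>} \<union> set \<tau>s" using ts(1) Cons.prems by auto
    have above: "\<tau> \<subset> X" if "X \<in> set pre" for X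
      using ts(2) that unfolding Cons.prems by (auto simp: sorted_wrt_append)
    have below: "X \<subset> \<tau>" if "X \<in> set \<tau>s" for X
      using ts(2) that unfolding Cons.prems by (auto simp: sorted_wrt_append)
    have next_max: "X \<subseteq> next_face \<tau>s" if "X \<in> set \<tau>s" for X
      using ts(2) that unfolding Cons.prems by (cases \<tau>s) (auto simp: sorted_wrt_append)
    have \<tau>: "\<tau> face_of P" "\<tau> \<noteq> {}" using sub C_eq by (auto simp: faces_def)
    have poly: "polytope \<tau>" using face_of_polytope_polytope P(1) \<tau>(1) by blast
    have convex: "convex \<tau>" using poly by (rule polytope_imp_convex)
    \<comment> \<open>By maximality of the chain, no face lies strictly between.\<close>
    have between: "G = next_face \<tau>s"
      if G: "G face_of \<tau>" "G \<noteq> {}" "G \<noteq> \<tau>" "next_face \<tau>s \<subseteq> G" for G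
    proof -
      have "G \<subset> \<tau>" using G face_of_imp_subset by blast
      have "G face_of P" using face_of_trans [OF G(1) \<tau>(1)] .
      then have "G \<in> C"
      proof (rule member [OF _ G(2)])
        fix X assume "X \<in> C"
        then consider "X \<in> set pre" | "X = \<tau>" | "X \<in> set \<tau>s" using C_eq by blast
        then show "X \<subseteq> G \<or> G \<subseteq> X"
          using above next_max G(4) \<open>G \<subset> \<tau>\<close> by cases blast+
      qed
      then have "G \<in> set \<tau>s" using C_eq above \<open>G \<subset> \<tau>\<close> by blast
      then show ?thesis using next_max G(4) by blast
    qed
    have "next_face \<tau>s face_of \<tau> \<and> aff_dim (next_face \<tau>s) = aff_dim \<tau> - 1"
    proof (cases "\<tau>s = []")
      case True
      obtain v where "v extreme_point_of \<tau>"
        using extreme_point_exists_convex [of \<tau>] poly convex \<tau>(2) polytope_imp_compact by blast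
      then have "{v} face_of \<tau>" by (simp add: face_of_singleton)
      then have "\<tau> = {v}" using between [of "{v}"] True by auto
      then show ?thesis using True by simp
    next
      case False
      then have mem: "next_face \<tau>s \<in> set \<tau>s" by (cases \<tau>s) auto
      then have \<rho>: "next_face \<tau>s \<subset> \<tau>" "next_face \<tau>s face_of P" "next_face \<tau>s \<noteq> {}"
        using below sub C_eq by (auto simp: faces_def)
      then have face: "next_face \<tau>s face_of \<tau>"
        using face_of_subset face_of_imp_subset [OF \<tau>(1)] by blast
      obtain G where G: "G facet_of \<tau>" "next_face \<tau>s \<subseteq> G"
        using face_of_polyhedron_subset_facet [OF polytope_imp_polyhedron [OF poly] face] \<rho> by blast
      have "G \<noteq> \<tau>" using G(1) by (auto simp: facet_of_def)
      then have "G = next_face \<tau>s"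
        using between [of G] G by (auto simp: facet_of_def)
      then show ?thesis using G by (auto simp: facet_of_def)
    qed
    then show ?case using \<tau> convex IH below by simp
  qed simp
  from this [of "[]"] show "flag ?ts" by simp
qed


section \<open>Coordinates with respect to the weights of a flag\<close>

text \<open>The vectors \<open>M \<sigma>\<close> are the exponents of the functions \<open>f_\<sigma>\<close>, that is, the negatives of their
  weights; \<open>ts\<close> is a maximal chain of faces in decreasing order.\<close>

locale weighted_flag = normal_lattice_polytope P + lex_order "faces P" t
  for P :: "(real ^ 'n) set" and t :: "(real ^ 'n) set rel" +
  fixes M :: "(real ^ 'n) set \<Rightarrow> int \<times> (int ^ 'n)" and ts :: "(real ^ 'n) set list"
  assumes dim: "aff_dim P = int CARD('n)"
    and refines: "\<And>\<sigma> \<tau>. \<sigma> \<in> faces P \<Longrightarrow> \<tau> \<in> faces P \<Longrightarrow> \<sigma> \<subseteq> \<tau> \<Longrightarrow> (\<sigma>, \<tau>) \<in> t"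
    and M: "\<And>\<sigma>. \<sigma> \<in> faces P \<Longrightarrow> interior_vec \<sigma> (real_hat (M \<sigma>))"
    and ts: "flag ts" "set ts \<subseteq> faces P" "next_face ts = P"
begin

definition coord :: "int \<times> (int ^ 'n) \<Rightarrow> (real ^ 'n) set \<Rightarrow> rat" where
  "coord m = (THE a. (\<forall>\<sigma>. \<sigma> \<notin> set ts \<longrightarrow> a \<sigma> = 0) \<and>
     real_hat m = (\<Sum>\<tau>\<in>set ts. real_of_rat (a \<tau>) *\<^sub>R real_hat (M \<tau>)))"

text \<open>This covers the final segments of \<open>ts\<close>, over which the recursion runs.\<close>

definition subflag :: "(real ^ 'n) set list \<Rightarrow> bool" where
  "subflag \<tau>s \<longleftrightarrow> flag \<tau>s \<and> set \<tau>s \<subseteq> set ts"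

lemma subflag_Cons:
  assumes "subflag (\<tau> # \<tau>s)"
  shows "subflag \<tau>s" "\<tau> \<in> faces P" "\<tau> \<notin> set \<tau>s" "\<tau> \<in> set ts" "next_face \<tau>s face_of \<tau>"
    "\<And>\<sigma>. \<sigma> \<in> set \<tau>s \<Longrightarrow> \<sigma> \<subset> \<tau>" "convex \<tau>"
  using assms ts(2) by (auto simp: subflag_def)

lemma basis_independent:
  "subflag \<tau>s \<Longrightarrow> (\<Sum>\<sigma>\<in>set \<tau>s. a \<sigma> *\<^sub>R real_hat (M \<sigma>)) = 0 \<Longrightarrow> \<sigma> \<in> set \<tau>s \<Longrightarrow> a \<sigma> = 0"
  using flag_basis [of \<tau>s "\<lambda>\<sigma>. real_hat (M \<sigma>)"] M ts(2) unfolding subflag_def by blast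

lemma basis_span:
  "subflag \<tau>s \<Longrightarrow> x \<in> span (real_cone (next_face \<tau>s)) \<longleftrightarrow> (\<exists>a. x = (\<Sum>\<sigma>\<in>set \<tau>s. a \<sigma> *\<^sub>R real_hat (M \<sigma>)))"
  using flag_basis [of \<tau>s "\<lambda>\<sigma>. real_hat (M \<sigma>)"] M ts(2) unfolding subflag_def by blast

lemma subflag_ts: "subflag ts"
  using ts by (simp add: subflag_def)

lemma real_coefficients_unique:
  assumes "(\<Sum>\<sigma>\<in>set ts. a \<sigma> *\<^sub>R real_hat (M \<sigma>)) = (\<Sum>\<sigma>\<in>set ts. b \<sigma> *\<^sub>R real_hat (M \<sigma>))" "\<sigma> \<in> set ts"
  shows "a \<sigma> = b \<sigma>"
proof -
  have "(\<Sum>\<sigma>\<in>set ts. (a \<sigma> - b \<sigma>) *\<^sub>R real_hat (M \<sigma>)) = 0"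
    using assms(1) by (simp add: scaleR_left_diff_distrib sum_subtractf)
  from basis_independent [OF subflag_ts this assms(2)] show ?thesis by simp
qed

lemma coord_ex1:
  "\<exists>!a. (\<forall>\<sigma>. \<sigma> \<notin> set ts \<longrightarrow> a \<sigma> = 0) \<and>
     real_hat m = (\<Sum>\<tau>\<in>set ts. real_of_rat (a \<tau>) *\<^sub>R real_hat (M \<tau>))"
proof -
  have "real_hat m \<in> span (real_cone (next_face ts))"
    using span_real_cone_full [of P] dim ts(3) by simp
  then obtain r where "real_hat m = (\<Sum>\<tau>\<in>set ts. r \<tau> *\<^sub>R real_hat (M \<tau>))"
    using basis_span [OF subflag_ts] by blast
  then obtain a where a: "real_hat m = (\<Sum>\<tau>\<in>set ts. real_of_rat (a \<tau>) *\<^sub>R real_hat (M \<tau>))"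
    using rational_coefficients by blast
  show ?thesis
  proof (rule ex1I)
    let ?a = "\<lambda>\<sigma>. if \<sigma> \<in> set ts then a \<sigma> else 0"
    have "(\<Sum>\<tau>\<in>set ts. real_of_rat (?a \<tau>) *\<^sub>R real_hat (M \<tau>)) = real_hat m"
      unfolding a by (intro sum.cong) auto
    then show "(\<forall>\<sigma>. \<sigma> \<notin> set ts \<longrightarrow> ?a \<sigma> = 0) \<and>
        real_hat m = (\<Sum>\<tau>\<in>set ts. real_of_rat (?a \<tau>) *\<^sub>R real_hat (M \<tau>))" by simp
    fix b assume b: "(\<forall>\<sigma>. \<sigma> \<notin> set ts \<longrightarrow> b \<sigma> = 0) \<and>
        real_hat m = (\<Sum>\<tau>\<in>set ts. real_of_rat (b \<tau>) *\<^sub>R real_hat (M \<tau>))"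
    have "real_of_rat (b \<sigma>) = real_of_rat (a \<sigma>)" if "\<sigma> \<in> set ts" for \<sigma>
      using b a that by (intro real_coefficients_unique) auto
    then show "b = ?a" using b by auto
  qed
qed

lemma coord_outside: "\<sigma> \<notin> set ts \<Longrightarrow> coord m \<sigma> = 0"
  and coord_sum: "real_hat m = (\<Sum>\<tau>\<in>set ts. real_of_rat (coord m \<tau>) *\<^sub>R real_hat (M \<tau>))"
  using theI' [OF coord_ex1 [of m]] unfolding coord_def by blast+

lemma coord_eqI:
  assumes "\<And>\<sigma>. \<sigma> \<notin> set ts \<Longrightarrow> a \<sigma> = 0" "real_hat m = (\<Sum>\<tau>\<in>set ts. real_of_rat (a \<tau>) *\<^sub>R real_hat (M \<tau>))"
  shows "coord m = a"
  unfolding coord_def using coord_ex1 [of m] assms by (intro the1_equality) auto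

lemma coord_add: "coord (m + m') \<sigma> = coord m \<sigma> + coord m' \<sigma>"
proof -
  have "coord (m + m') = (\<lambda>\<sigma>. coord m \<sigma> + coord m' \<sigma>)"
  proof (rule coord_eqI)
    show "real_hat (m + m') = (\<Sum>\<tau>\<in>set ts. real_of_rat (coord m \<tau> + coord m' \<tau>) *\<^sub>R real_hat (M \<tau>))"
      using coord_sum [of m] coord_sum [of m']
      by (simp add: real_hat_add of_rat_add scaleR_left_distrib sum.distrib)
  qed (simp add: coord_outside)
  then show ?thesis by simp
qed

lemma coord_0: "coord 0 \<sigma> = 0"
  using coord_add [of 0 0 \<sigma>] by simp

lemma coord_diff: "coord (m - m') \<sigma> = coord m \<sigma> - coord m' \<sigma>"
  using coord_add [of "m - m'" m' \<sigma>] by simp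

lemma coord_multiple: "coord (multiple k m) \<sigma> = of_nat k * coord m \<sigma>"
  by (induction k) (auto simp: coord_0 coord_add algebra_simps)

lemma coord_M:
  assumes "\<tau> \<in> set ts" shows "coord (M \<tau>) = (\<lambda>\<sigma>. if \<sigma> = \<tau> then 1 else 0)"
proof (rule coord_eqI)
  have "(\<Sum>\<sigma>\<in>set ts. real_of_rat (if \<sigma> = \<tau> then 1 else 0) *\<^sub>R real_hat (M \<sigma>))
      = (\<Sum>\<sigma>\<in>set ts. if \<sigma> = \<tau> then real_hat (M \<tau>) else 0)"
    by (intro sum.cong) auto
  then show "real_hat (M \<tau>) = (\<Sum>\<sigma>\<in>set ts. real_of_rat (if \<sigma> = \<tau> then 1 else 0) *\<^sub>R real_hat (M \<sigma>))"
    using assms by simp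
qed (use assms in auto)

lemma coord_inject: "coord m = coord m' \<Longrightarrow> m = m'"
  using coord_sum [of m] coord_sum [of m'] real_hat_eq_iff [of m m'] by simp

text \<open>The coordinates in the part of the basis that belongs to the smaller flag are also coordinates in
  the whole basis.\<close>

lemma coord_support:
  assumes \<tau>s: "subflag \<tau>s" and m: "real_hat m \<in> span (real_cone (next_face \<tau>s))" and \<sigma>: "\<sigma> \<notin> set \<tau>s"
  shows "coord m \<sigma> = 0"
proof (cases "\<sigma> \<in> set ts")
  case True
  obtain a where a: "real_hat m = (\<Sum>\<tau>\<in>set \<tau>s. a \<tau> *\<^sub>R real_hat (M \<tau>))"
    using basis_span [OF \<tau>s] m by blast
  let ?a = "\<lambda>\<tau>. if \<tau> \<in> set \<tau>s then a \<tau> else 0"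
  have "real_hat m = (\<Sum>\<tau>\<in>set ts. ?a \<tau> *\<^sub>R real_hat (M \<tau>))"
    unfolding a using \<tau>s by (intro sum.mono_neutral_cong_left) (auto simp: subflag_def)
  then have "real_of_rat (coord m \<sigma>) = ?a \<sigma>"
    using coord_sum [of m] True by (intro real_coefficients_unique) auto
  then show ?thesis using \<sigma> by simp
qed (rule coord_outside)

lemma lattice_cone_span: "m \<in> lattice_cone \<sigma> \<Longrightarrow> real_hat m \<in> span (real_cone \<sigma>)"
  by (simp add: lattice_cone_def span_base)

lemma span_minus_head:
  assumes \<tau>: "subflag (\<tau> # \<tau>s)" and m: "real_hat m \<in> span (real_cone \<tau>)"
  shows "real_hat m - real_of_rat (coord m \<tau>) *\<^sub>R real_hat (M \<tau>) \<in> span (real_cone (next_face \<tau>s))"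
proof -
  have "real_hat m = (\<Sum>\<sigma>\<in>set (\<tau> # \<tau>s). real_of_rat (coord m \<sigma>) *\<^sub>R real_hat (M \<sigma>))"
    unfolding coord_sum [of m] using \<tau> coord_support [OF \<tau>] m
    by (intro sum.mono_neutral_right) (auto simp: subflag_def coord_sum [of m, symmetric])
  also have "\<dots> = real_of_rat (coord m \<tau>) *\<^sub>R real_hat (M \<tau>) +
      (\<Sum>\<sigma>\<in>set \<tau>s. real_of_rat (coord m \<sigma>) *\<^sub>R real_hat (M \<sigma>))"
    using subflag_Cons(3) [OF \<tau>] by simp
  finally have "real_hat m - real_of_rat (coord m \<tau>) *\<^sub>R real_hat (M \<tau>)
      = (\<Sum>\<sigma>\<in>set \<tau>s. real_of_rat (coord m \<sigma>) *\<^sub>R real_hat (M \<sigma>))" by simp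
  then show ?thesis unfolding basis_span [OF subflag_Cons(1) [OF \<tau>]]
    by (rule exI [of _ "\<lambda>\<sigma>. real_of_rat (coord m \<sigma>)"])
qed

lemma M_in_cone: "\<sigma> \<in> faces P \<Longrightarrow> M \<sigma> \<in> lattice_cone \<sigma>"
  using interior_vec_in_real_cone [OF M] by (simp add: lattice_cone_def)

lemma interior_next:
  assumes "subflag \<tau>s" shows "interior_vec (next_face \<tau>s) (real_hat (next_vec M \<tau>s))"
proof (cases \<tau>s)
  case Nil
  then show ?thesis by (simp add: next_vec_def interior_vec_def)
next
  case (Cons \<rho> \<rho>s)
  then have "\<rho> \<in> faces P" using assms ts(2) by (auto simp: subflag_def)
  then show ?thesis using M Cons by (simp add: next_vec_def)
qed

text \<open>A vector with a negative leading coordinate plus a multiple of the interior vector of the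
  face would lie in the cone over the facet, and then so would the interior vector.\<close>

lemma coord_head_nonneg:
  assumes \<tau>: "subflag (\<tau> # \<tau>s)" and m: "m \<in> lattice_cone \<tau>"
  shows "0 \<le> coord m \<tau>" and "coord m \<tau> = 0 \<longleftrightarrow> m \<in> lattice_cone (next_face \<tau>s)"
proof -
  note \<tau>s = subflag_Cons [OF \<tau>]
  let ?\<rho> = "next_face \<tau>s"
  let ?A = "real_of_rat (coord m \<tau>)" and ?x = "real_hat m" and ?z = "real_hat (M \<tau>)" and ?w = "real_hat (next_vec M \<tau>s)"
  note w = interior_next [OF \<tau>s(1)]
  have x: "?x \<in> real_cone \<tau>" using m by (simp add: lattice_cone_def)
  have z: "?z \<in> real_cone \<tau>" using M_in_cone [OF \<tau>s(2)] by (simp add: lattice_cone_def)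
  have convex: "convex \<tau>" "convex ?\<rho>" using \<tau>s(5,7) face_of_imp_convex by auto
  have zn: "?z \<notin> real_cone ?\<rho>"
  proof -
    have "flag (\<tau> # \<tau>s)" using \<tau> by (simp add: subflag_def)
    then have "?z \<notin> span (real_cone ?\<rho>)"
      using facet_span(1) [of \<tau> ?\<rho> ?w ?z] w M [OF \<tau>s(2)] by simp
    then show ?thesis using span_base by blast
  qed
  obtain N :: nat where N: "(?x - ?A *\<^sub>R ?z) + real N *\<^sub>R ?w \<in> real_cone ?\<rho>"
    using span_shift_into_cone [OF convex(2) w span_minus_head [OF \<tau> lattice_cone_span [OF m]]] by blast
  have wt: "real N *\<^sub>R ?w \<in> real_cone \<tau>"
    using interior_vec_in_real_cone [OF w] real_cone_mono [OF face_of_imp_subset [OF \<tau>s(5)]]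
    by (intro real_cone_scale) auto
  show nonneg: "0 \<le> coord m \<tau>"
  proof (rule ccontr)
    assume "\<not> 0 \<le> coord m \<tau>"
    then have A: "?A < 0" by simp
    have Az: "(- ?A) *\<^sub>R ?z \<in> real_cone \<tau>" using z A by (intro real_cone_scale) auto
    have "((- ?A) *\<^sub>R ?z + real N *\<^sub>R ?w) + ?x \<in> real_cone ?\<rho>" using N by (simp add: algebra_simps)
    then have "(- ?A) *\<^sub>R ?z + real N *\<^sub>R ?w \<in> real_cone ?\<rho>"
      using real_cone_face [OF \<tau>s(5) real_cone_add [OF convex(1) Az wt] x] by blast
    then have "(- ?A) *\<^sub>R ?z \<in> real_cone ?\<rho>" using real_cone_face [OF \<tau>s(5) Az wt] by blast
    moreover have "0 \<le> 1 / - ?A" using A by simp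
    ultimately have "(1 / - ?A) *\<^sub>R ((- ?A) *\<^sub>R ?z) \<in> real_cone ?\<rho>" by (rule real_cone_scale)
    moreover have "(1 / - ?A) *\<^sub>R ((- ?A) *\<^sub>R ?z) = ?z" using A by simp
    ultimately show False using zn by (simp only:)
  qed
  show "coord m \<tau> = 0 \<longleftrightarrow> m \<in> lattice_cone ?\<rho>"
  proof
    assume "coord m \<tau> = 0"
    then have "?x + real N *\<^sub>R ?w \<in> real_cone ?\<rho>" using N by simp
    then have "?x \<in> real_cone ?\<rho>" using real_cone_face [OF \<tau>s(5) x wt] by blast
    then show "m \<in> lattice_cone ?\<rho>" by (simp add: lattice_cone_def)
  next
    assume "m \<in> lattice_cone ?\<rho>"
    then show "coord m \<tau> = 0"
      using coord_support [OF \<tau>s(1) lattice_cone_span \<tau>s(3)] by blast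
  qed
qed

text \<open>The component along \<open>M \<tau>\<close> is in the cone, and the rest is in the span of the facet cone, where the
  interior vector of the facet shifts it into that cone.\<close>

lemma shift_into_lattice_cone:
  assumes \<tau>: "subflag (\<tau> # \<tau>s)" and m: "real_hat m \<in> span (real_cone \<tau>)" "0 \<le> coord m \<tau>"
  shows "\<exists>N. m + multiple N (next_vec M \<tau>s) \<in> lattice_cone \<tau>"
proof -
  note \<tau>s = subflag_Cons [OF \<tau>]
  let ?A = "real_of_rat (coord m \<tau>)" and ?z = "real_hat (M \<tau>)" and ?w = "real_hat (next_vec M \<tau>s)"
  have "convex (next_face \<tau>s)" using \<tau>s(5) by (rule face_of_imp_convex)
  then obtain N :: nat where N: "(real_hat m - ?A *\<^sub>R ?z) + real N *\<^sub>R ?w \<in> real_cone (next_face \<tau>s)"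
    using span_shift_into_cone [OF _ interior_next [OF \<tau>s(1)] span_minus_head [OF \<tau> m(1)]] by blast
  then have "(real_hat m - ?A *\<^sub>R ?z) + real N *\<^sub>R ?w \<in> real_cone \<tau>"
    using real_cone_mono [OF face_of_imp_subset [OF \<tau>s(5)]] by blast
  moreover have "?A *\<^sub>R ?z \<in> real_cone \<tau>"
    using M_in_cone [OF \<tau>s(2)] m(2) by (intro real_cone_scale) (auto simp: lattice_cone_def)
  ultimately have "((real_hat m - ?A *\<^sub>R ?z) + real N *\<^sub>R ?w) + ?A *\<^sub>R ?z \<in> real_cone \<tau>"
    using real_cone_add [OF \<tau>s(7)] by blast
  then have "real_hat (m + multiple N (next_vec M \<tau>s)) \<in> real_cone \<tau>"
    by (simp add: real_hat_add real_hat_multiple algebra_simps)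
  then show ?thesis by (auto simp: lattice_cone_def)
qed

definition prec :: "int \<times> (int ^ 'n) \<Rightarrow> int \<times> (int ^ 'n) \<Rightarrow> bool" where
  "prec m m' \<longleftrightarrow> lex_less (faces P) t (coord m) (coord m')"

sublocale translation_order prec
proof
  show "\<not> prec a a" for a by (simp add: prec_def lex_less_irrefl)
  show "prec a b \<Longrightarrow> prec b c \<Longrightarrow> prec a c" for a b c
    unfolding prec_def by (rule lex_less_trans)
  show "prec a b \<or> prec b a" if "a \<noteq> b" for a b
  proof -
    have "coord a \<noteq> coord b" using coord_inject \<open>a \<noteq> b\<close> by blast
    then obtain \<sigma> where \<sigma>: "coord a \<sigma> \<noteq> coord b \<sigma>" by (auto simp: fun_eq_iff)
    have "\<sigma> \<in> set ts"
    proof (rule ccontr)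
      assume "\<sigma> \<notin> set ts"
      then have "coord a \<sigma> = 0" "coord b \<sigma> = 0" by (simp_all add: coord_outside)
      then show False using \<sigma> by simp
    qed
    then have "\<sigma> \<in> faces P" using ts(2) by blast
    then show ?thesis unfolding prec_def using \<sigma> by (rule lex_less_total)
  qed
  show "prec (a + c) (b + c)" if "prec a b" for a b c
    using that by (simp add: prec_def lex_less_def coord_add)
qed

text \<open>On the cone over \<open>\<tau>\<close> only the coordinates at members of the flag can differ, and the linearization
  compares the one at \<open>\<tau>\<close> first.\<close>

lemma prec_coord_head:
  assumes \<tau>: "subflag (\<tau> # \<tau>s)" and m: "m \<in> lattice_cone \<tau>" "m' \<in> lattice_cone \<tau>" and "prec m m'"
  shows "coord m \<tau> \<le> coord m' \<tau>"
proof -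
  obtain \<sigma> where \<sigma>: "\<sigma> \<in> faces P" "coord m \<sigma> < coord m' \<sigma>"
    "\<And>\<rho>. \<rho> \<in> faces P \<Longrightarrow> (\<sigma>, \<rho>) \<in> t \<Longrightarrow> \<rho> \<noteq> \<sigma> \<Longrightarrow> coord m \<rho> = coord m' \<rho>"
    using assms(4) unfolding prec_def lex_less_def by blast
  have "\<sigma> \<in> set (\<tau> # \<tau>s)"
  proof (rule ccontr)
    assume "\<sigma> \<notin> set (\<tau> # \<tau>s)"
    then have "coord m \<sigma> = 0" "coord m' \<sigma> = 0"
      using coord_support [OF \<tau>] m[THEN lattice_cone_span] by auto
    then show False using \<sigma>(2) by simp
  qed
  then have "\<sigma> = \<tau> \<or> \<sigma> \<subset> \<tau>" using subflag_Cons(6) [OF \<tau>] by auto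
  then show ?thesis
  proof
    assume "\<sigma> \<subset> \<tau>"
    then show ?thesis using \<sigma>(3) [of \<tau>] refines \<sigma>(1) subflag_Cons(2) [OF \<tau>] by auto
  qed (use \<sigma>(2) in simp)
qed

end


section \<open>Vanishing multiplicities along a flag\<close>

context weighted_flag
begin

lemma toric_ring_flag:
  assumes "\<tau> \<in> faces P"
  shows "semigroup_ring prec (toric_ring P \<tau>) (lattice_cone \<tau>)
    (laurent_fun P (toric_cone P \<tau>) :: (_ \<Rightarrow>\<^sub>0 'k::field_char_0) \<Rightarrow> _) coord"
  by (rule toric_semigroup_ring [OF assms translation_order_axioms coord_add])

text \<open>The coordinate at \<open>\<tau>\<close>, scaled by \<open>b\<close> so that it becomes surjective from the lattice points of
  the span of the cone to the integers, is the degree \<open>h\<close>.  The unit is the monomial of the interior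
  vector of the facet; the uniformizer is a lattice vector of degree 1, shifted into the cone.\<close>

lemma divisor_of_subflag:
  fixes \<tau>s :: "(real ^ 'n) set list"
  assumes \<tau>: "subflag (\<tau> # \<tau>s)"
  obtains b h m0 m1 where "0 < b" "h (M \<tau>) = b"
    "\<And>m. m \<in> lattice_cone \<tau> \<Longrightarrow> rat_of_int (h m) = of_int b * coord m \<tau>"
    "monomial_divisor prec (toric_ring P \<tau>) (lattice_cone \<tau>)
       (laurent_fun P (toric_cone P \<tau>) :: (_ \<Rightarrow>\<^sub>0 'k::field_char_0) \<Rightarrow> _) coord h
       (vanishing_ideal (lattice_points P) (toric_cone P \<tau>) (next_cone P \<tau>s)) m0 m1"
proof -
  note \<tau>s = subflag_Cons [OF \<tau>]
  \<comment> \<open>On \<open>L\<close> and not only on the cone, since a vector of degree 1 need not lie in the cone at first.\<close>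
  define L where "L = {m. real_hat m \<in> span (real_cone \<tau>)}"
  have L_diff: "x - y \<in> L" if "x \<in> L" "y \<in> L" for x y
    using that span_diff [of "real_hat x" "real_cone \<tau>" "real_hat y"] real_hat_add [of x "- y"]
    by (simp add: L_def real_hat_minus)
  have cone_L: "m \<in> L" if "m \<in> lattice_cone \<tau>" for m using lattice_cone_span [OF that] by (simp add: L_def)
  have M_L: "M \<tau> \<in> L" by (rule cone_L [OF M_in_cone [OF \<tau>s(2)]])
  have M1: "coord (M \<tau>) \<tau> = 1" by (simp add: coord_M [OF \<tau>s(4)])
  obtain b x where b: "0 < b" and x: "x \<in> L" "of_int b * coord x \<tau> = 1"
    and int: "\<And>y. y \<in> L \<Longrightarrow> of_int b * coord y \<tau> \<in> \<int>"
    using additive_normalization [of "\<lambda>m. coord m \<tau>" L "M \<tau>", OF coord_add L_diff M_L M1] by blast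
  define h where "h m = \<lfloor>of_int b * coord m \<tau>\<rfloor>" for m
  have h: "rat_of_int (h m) = of_int b * coord m \<tau>" if "m \<in> L" for m
    using int [OF that] by (simp add: h_def)
  define m0 where "m0 = next_vec M \<tau>s"
  have m0': "m0 \<in> lattice_cone (next_face \<tau>s)"
    using interior_vec_in_real_cone [OF interior_next [OF \<tau>s(1)]] by (simp add: m0_def lattice_cone_def)
  then have m0: "m0 \<in> lattice_cone \<tau>"
    using lattice_cone_mono [OF face_of_imp_subset [OF \<tau>s(5)]] by blast
  have c0: "coord m0 \<tau> = 0" using coord_head_nonneg(2) [OF \<tau> m0] m0' by simp
  have shift: "\<exists>N. y + multiple N m0 \<in> lattice_cone \<tau>" if "y \<in> L" "0 \<le> of_int b * coord y \<tau>" for y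
    unfolding m0_def
  proof (rule shift_into_lattice_cone [OF \<tau>])
    show "real_hat y \<in> span (real_cone \<tau>)" using that(1) by (simp add: L_def)
    show "0 \<le> coord y \<tau>" using that(2) b by (simp add: zero_le_mult_iff)
  qed
  obtain N1 where N1: "x + multiple N1 m0 \<in> lattice_cone \<tau>" using shift [of x] x by auto
  define m1 where "m1 = x + multiple N1 m0"
  have m1: "m1 \<in> lattice_cone \<tau>" "of_int b * coord m1 \<tau> = 1"
    using N1 x(2) by (simp_all add: m1_def coord_add coord_multiple c0)
  have pos: "0 < h m \<longleftrightarrow> m \<notin> lattice_cone (next_face \<tau>s)" if m: "m \<in> lattice_cone \<tau>" for m
  proof -
    have "0 < h m \<longleftrightarrow> 0 < rat_of_int (h m)" by simp
    also have "\<dots> \<longleftrightarrow> 0 < coord m \<tau>" unfolding h [OF cone_L [OF m]] using b by (simp add: zero_less_mult_iff)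
    also have "\<dots> \<longleftrightarrow> m \<notin> lattice_cone (next_face \<tau>s)" using coord_head_nonneg [OF \<tau> m] by auto
    finally show ?thesis .
  qed
  show thesis
  proof (rule that)
    show "0 < b" by (rule b)
    show "h (M \<tau>) = b" using h [OF M_L] M1 by simp
    show "rat_of_int (h m) = of_int b * coord m \<tau>" if "m \<in> lattice_cone \<tau>" for m
      by (rule h [OF cone_L [OF that]])
    show "monomial_divisor prec (toric_ring P \<tau>) (lattice_cone \<tau>)
       (laurent_fun P (toric_cone P \<tau>) :: (_ \<Rightarrow>\<^sub>0 'k) \<Rightarrow> _) coord h
       (vanishing_ideal (lattice_points P) (toric_cone P \<tau>) (next_cone P \<tau>s)) m0 m1"
    proof (intro monomial_divisor.intro monomial_divisor_axioms.intro toric_ring_flag [OF \<tau>s(2)])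
      fix m m' assume m: "m \<in> lattice_cone \<tau>" "m' \<in> lattice_cone \<tau>"
      have "rat_of_int (h (m + m')) = rat_of_int (h m + h m')"
        using lattice_cone_add [OF \<tau>s(7) m] m by (simp add: h cone_L coord_add algebra_simps)
      then show "h (m + m') = h m + h m'" by (simp only: of_int_eq_iff)
      assume "prec m m'"
      then have "coord m \<tau> \<le> coord m' \<tau>" by (rule prec_coord_head [OF \<tau> m])
      then show "h m \<le> h m'" unfolding h_def using b by (intro floor_mono mult_left_mono) auto
    next
      fix m assume "m \<in> lattice_cone \<tau>"
      then show "0 \<le> h m" unfolding h_def using coord_head_nonneg(1) [OF \<tau>] b by simp
    next
      have "\<tau>s \<noteq> [] \<Longrightarrow> next_face \<tau>s \<in> faces P \<and> next_face \<tau>s \<subseteq> \<tau>"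
        using \<tau>s(1,6) ts(2) by (cases \<tau>s) (auto simp: subflag_def)
      then have "vanishing_ideal (lattice_points P) (toric_cone P \<tau>) (next_cone P \<tau>s)
        = laurent_fun P (toric_cone P \<tau> :: (int ^ 'n \<Rightarrow> 'k) set) `
          {q \<in> laurents (lattice_cone \<tau>). keys q \<inter> lattice_cone (next_face \<tau>s) = {}}"
        by (rule vanishing_ideal_next_cone [OF \<tau>s(2)])
      moreover have "{q \<in> laurents (lattice_cone \<tau>). keys q \<inter> lattice_cone (next_face \<tau>s) = {}}
        = {q \<in> laurents (lattice_cone \<tau>). \<forall>m\<in>keys (q :: _ \<Rightarrow>\<^sub>0 'k). 0 < h m}"
        using pos by (auto simp: laurents_def)
      ultimately show "vanishing_ideal (lattice_points P) (toric_cone P \<tau>) (next_cone P \<tau>s)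
        = laurent_fun P (toric_cone P \<tau> :: (int ^ 'n \<Rightarrow> 'k) set) `
          {q \<in> laurents (lattice_cone \<tau>). \<forall>m\<in>keys q. 0 < h m}" by simp
    next
      show "m0 \<in> lattice_cone \<tau>" "h m0 = 0" "m1 \<in> lattice_cone \<tau>" "h m1 = 1"
        using m0 m1 c0 by (auto simp: h_def)
    next
      fix m and n :: nat assume m: "m \<in> lattice_cone \<tau>" "int n \<le> h m"
      have "m - multiple n m1 \<in> L"
        using cone_L lattice_cone_multiple m1(1) m(1) L_diff by blast
      moreover have "of_int b * coord (m - multiple n m1) \<tau> = rat_of_int (h m) - of_nat n * (of_int b * coord m1 \<tau>)"
        unfolding h [OF cone_L [OF m(1)]] by (simp add: coord_diff coord_multiple algebra_simps)
      then have "of_int b * coord (m - multiple n m1) \<tau> = rat_of_int (h m - int n)" by (simp add: m1(2))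
      then have "0 \<le> of_int b * coord (m - multiple n m1) \<tau>" using m(2) by simp
      ultimately obtain N where "m - multiple n m1 + multiple N m0 \<in> lattice_cone \<tau>" using shift by blast
      then show "\<exists>N. m + multiple N m0 - multiple n m1 \<in> lattice_cone \<tau>"
        by (intro exI [of _ N]) (simp add: algebra_simps)
    qed
  qed
qed

definition fun_val ::
    "(real ^ 'n) set \<Rightarrow> (int ^ 'n, 'k::field_char_0) ratfun \<Rightarrow> ((real ^ 'n) set \<Rightarrow> rat) \<Rightarrow> bool" where
  "fun_val \<tau> = semigroup_ring.has_val prec (toric_ring P \<tau>) (lattice_cone \<tau>)
     (laurent_fun P (toric_cone P \<tau>)) coord"

lemma fun_val_iff:
  assumes "\<tau> \<in> faces P"
  shows "fun_val \<tau> (\<phi> :: (int ^ 'n, 'k::field_char_0) ratfun) u \<longleftrightarrow>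
    (\<exists>a\<in>laurents (lattice_cone \<tau>) - {0}. \<exists>s\<in>laurents (lattice_cone \<tau>) - {0}.
       \<phi> = fraction (toric_ring P \<tau>) (laurent_fun P (toric_cone P \<tau>) a) (laurent_fun P (toric_cone P \<tau>) s) \<and>
       u = (\<lambda>i. coord (lead a) i - coord (lead s) i))"
  unfolding fun_val_def semigroup_ring.has_val_def [OF toric_ring_flag [OF assms]] ..

lemma lead_in_cone: "a \<in> laurents (lattice_cone \<tau>) - {0} \<Longrightarrow> lead a \<in> lattice_cone \<tau>"
  using lead_in_keys [of a] by (auto simp: laurents_def)

lemma fun_val_support:
  assumes \<tau>: "subflag (\<tau> # \<tau>s)" and "fun_val \<tau> (\<phi> :: (int ^ 'n, 'k::field_char_0) ratfun) u" "\<sigma> \<notin> set (\<tau> # \<tau>s)"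
  shows "u \<sigma> = 0"
proof -
  obtain a s where a: "a \<in> laurents (lattice_cone \<tau>) - {0 :: _ \<Rightarrow>\<^sub>0 'k}" and s: "s \<in> laurents (lattice_cone \<tau>) - {0 :: _ \<Rightarrow>\<^sub>0 'k}"
    and u: "u = (\<lambda>i. coord (lead a) i - coord (lead s) i)"
    using assms(2) unfolding fun_val_iff [OF subflag_Cons(2) [OF \<tau>]] by blast
  have "coord (lead a) \<sigma> = 0" "coord (lead s) \<sigma> = 0"
    using coord_support [OF \<tau> _ assms(3)] lattice_cone_span [OF lead_in_cone [OF a]]
      lattice_cone_span [OF lead_in_cone [OF s]] by simp_all
  then show ?thesis by (simp add: u)
qed

text \<open>Keeping the terms over a face is multiplicative, since it is the restriction of functions to the
  cone of that face.\<close>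

lemma restrict_keys_mult:
  fixes p q :: "int \<times> (int ^ 'n) \<Rightarrow>\<^sub>0 'k::field_char_0"
  assumes \<rho>: "\<rho> \<in> faces P" and p: "p \<in> laurents (lattice_cone P)" and q: "q \<in> laurents (lattice_cone P)"
  shows "restrict_keys (lattice_cone \<rho>) (p * q) = restrict_keys (lattice_cone \<rho>) p * restrict_keys (lattice_cone \<rho>) q"
proof -
  let ?Z = "toric_cone P \<rho> :: (int ^ 'n \<Rightarrow> 'k) set"
  note PP = P_face [OF \<rho>]
  interpret R: semigroup_ring prec "toric_ring P \<rho>" "lattice_cone \<rho>" "laurent_fun P ?Z" coord
    by (rule toric_ring_flag [OF \<rho>])
  interpret RP: semigroup_ring prec "toric_ring P P" "lattice_cone P"
    "laurent_fun P (toric_cone P P) :: (_ \<Rightarrow>\<^sub>0 'k) \<Rightarrow> _" coord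
    by (rule toric_ring_flag [OF PP])
  have sub: "\<rho> \<subseteq> P" using \<rho> face_of_imp_subset by (auto simp: faces_def)
  note res = restrict_laurent_fun [OF \<rho> PP sub]
  have mem: "restrict_keys (lattice_cone \<rho>) r \<in> laurents (lattice_cone \<rho>)" for r :: "int \<times> (int ^ 'n) \<Rightarrow>\<^sub>0 'k"
    by (simp add: laurents_def keys_restrict_keys)
  have "laurent_fun P ?Z (restrict_keys (lattice_cone \<rho>) (p * q))
      = restrict (laurent_fun P (toric_cone P P) p \<otimes>\<^bsub>toric_ring P P\<^esub> laurent_fun P (toric_cone P P) q) ?Z"
    using res [OF RP.mult_in_laurents [OF p q]] RP.\<Psi>_mult [OF p q] by simp
  also have "\<dots> = restrict (laurent_fun P (toric_cone P P) p) ?Z \<otimes>\<^bsub>toric_ring P \<rho>\<^esub> restrict (laurent_fun P (toric_cone P P) q) ?Z"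
    unfolding toric_ring_simps using toric_cone_mono [OF \<rho> PP sub] by (auto simp: restrict_def fun_eq_iff)
  also have "\<dots> = laurent_fun P ?Z (restrict_keys (lattice_cone \<rho>) p * restrict_keys (lattice_cone \<rho>) q)"
    unfolding res [OF p] res [OF q] by (rule R.\<Psi>_mult [OF mem mem, symmetric])
  finally show ?thesis using R.\<Psi>_eq_iff mem R.mult_in_laurents by blast
qed

end

context weighted_flag
begin

text \<open>After normalization the leading exponents of numerator and denominator have coordinate zero at
  \<open>\<tau>\<close>, so they lie over the facet \<open>\<rho>\<close>.  They survive the restriction and stay leading.\<close>

lemma fun_val_restrict:
  fixes \<phi> :: "(int ^ 'n, 'k::field_char_0) ratfun"
  assumes \<tau>: "subflag (\<tau> # \<rho> # \<tau>s)" and \<phi>: "fun_val \<tau> \<phi> u" and u: "u \<tau> = 0"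
  shows "fun_val \<rho> (rat_restrict (lattice_points P) (toric_cone P \<tau>) (toric_cone P \<rho>) \<phi>) u"
proof -
  let ?L = "lattice_points P" and ?Z = "toric_cone P \<tau> :: (int ^ 'n \<Rightarrow> 'k) set" and ?D = "toric_cone P \<rho> :: (int ^ 'n \<Rightarrow> 'k) set"
  let ?R = "toric_ring P \<tau> :: (int ^ 'n, 'k) regfun ring" and ?Q = "vanishing_ideal ?L ?Z ?D"
  let ?res = "restrict_keys (lattice_cone \<rho>) :: (_ \<Rightarrow>\<^sub>0 'k) \<Rightarrow> _"
  note \<tau>f = subflag_Cons [OF \<tau>]
  have \<rho>: "\<rho> \<in> faces P" "\<rho> \<subseteq> \<tau>" using subflag_Cons(2) [OF \<tau>f(1)] \<tau>f(6) by auto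
  have face: "\<tau> face_of P" using \<tau>f(2) by (simp add: faces_def)
  obtain b h m0 m1 where b: "0 < b"
    and h: "\<And>m. m \<in> lattice_cone \<tau> \<Longrightarrow> rat_of_int (h m) = of_int b * coord m \<tau>"
    and div: "monomial_divisor prec ?R (lattice_cone \<tau>) (laurent_fun P ?Z) coord h
       (vanishing_ideal ?L ?Z (next_cone P (\<rho> # \<tau>s))) m0 m1"
    using divisor_of_subflag [OF \<tau>, where 'k = 'k] by metis
  interpret D: monomial_divisor prec ?R "lattice_cone \<tau>" "laurent_fun P ?Z" coord h ?Q m0 m1
    using div by (simp add: next_cone_def)
  interpret S: semigroup_ring prec "toric_ring P \<rho>" "lattice_cone \<rho>" "laurent_fun P ?D" coord
    by (rule toric_ring_flag [OF \<rho>(1)])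
  obtain a\<^sub>0 s\<^sub>0 where as0: "a\<^sub>0 \<in> laurents (lattice_cone \<tau>) - {0}" "s\<^sub>0 \<in> laurents (lattice_cone \<tau>) - {0}"
    "\<phi> = fraction ?R (laurent_fun P ?Z a\<^sub>0) (laurent_fun P ?Z s\<^sub>0)"
    "u = (\<lambda>i. coord (lead a\<^sub>0) i - coord (lead s\<^sub>0) i)"
    using \<phi> unfolding fun_val_iff [OF \<tau>f(2)] by blast
  have "rat_of_int (h (lead a\<^sub>0)) = rat_of_int (h (lead s\<^sub>0))"
    using u as0(4) by (simp add: h [OF lead_in_cone [OF as0(1)]] h [OF lead_in_cone [OF as0(2)]])
  then have "h (lead a\<^sub>0) = h (lead s\<^sub>0)" by simp
  from D.normalize_fraction [OF as0(1,2) this]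
  obtain a s where a: "a \<in> laurents (lattice_cone \<tau>) - {0}" "h (lead a) = 0"
    and s: "s \<in> laurents (lattice_cone \<tau>) - {0}" "h (lead s) = 0"
    and \<phi>_eq: "\<phi> = fraction ?R (laurent_fun P ?Z a) (laurent_fun P ?Z s)"
    and u_eq: "\<And>i. u i = coord (lead a) i - coord (lead s) i"
    unfolding as0(3,4) by metis
  have res: "restrict (laurent_fun P ?Z q) ?D = laurent_fun P ?D (?res q)" if "q \<in> laurents (lattice_cone \<tau>)" for q
    using restrict_laurent_fun [OF \<rho>(1) \<tau>f(2) \<rho>(2)] that face_lattice_cone [OF face] by (auto simp: laurents_def)
  have res_mem: "?res q \<in> laurents (lattice_cone \<rho>)" for q
    by (simp add: laurents_def keys_restrict_keys)
  have res_mult: "?res (p * q) = ?res p * ?res q" if "p \<in> laurents (lattice_cone \<tau>)" "q \<in> laurents (lattice_cone \<tau>)" for p q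
    using restrict_keys_mult [OF \<rho>(1), of p q] that face_lattice_cone [OF face] by (auto simp: laurents_def)
  have lead_res: "?res q \<noteq> 0 \<and> lead (?res q) = lead q"
    if q: "q \<in> laurents (lattice_cone \<tau>) - {0}" "h (lead q) = 0" for q
  proof -
    have "coord (lead q) \<tau> = 0" using h [OF lead_in_cone [OF q(1)]] q(2) b by simp
    then have "lead q \<in> lattice_cone \<rho>"
      using coord_head_nonneg(2) [OF \<tau> lead_in_cone [OF q(1)]] by simp
    moreover have "is_lead q (lead q)" using q(1) by (intro is_lead_lead) simp
    ultimately have lead: "is_lead (?res q) (lead q)"
      by (simp add: is_lead_def keys_restrict_keys)
    then have "lead q \<in> keys (?res q)" by (simp add: is_lead_def)
    then have "?res q \<noteq> 0" by (metis keys_zero empty_iff)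
    then show ?thesis using lead_eqI [OF lead] by simp
  qed
  have "rat_restrict ?L ?Z ?D \<phi> = fraction (toric_ring P \<rho>) (laurent_fun P ?D (?res a)) (laurent_fun P ?D (?res s))"
    unfolding rat_restrict_def toric_ring_def [symmetric]
  proof (rule the_equality)
    have "laurent_fun P ?Z s \<notin> ?Q" using D.Q_iff [OF s(1)] s(2) by simp
    then show "\<exists>x\<in>carrier ?R. \<exists>y\<in>carrier ?R - ?Q. \<phi> = fraction ?R x y \<and>
        fraction (toric_ring P \<rho>) (laurent_fun P ?D (?res a)) (laurent_fun P ?D (?res s))
          = fraction (toric_ring P \<rho>) (restrict x ?D) (restrict y ?D)"
      using a(1) s(1) D.\<Psi>_carrier \<phi>_eq res
      by (intro bexI [of _ "laurent_fun P ?Z a"] bexI [of _ "laurent_fun P ?Z s"]) auto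
  next
    fix \<psi> assume "\<exists>x\<in>carrier ?R. \<exists>y\<in>carrier ?R - ?Q. \<phi> = fraction ?R x y \<and>
        \<psi> = fraction (toric_ring P \<rho>) (restrict x ?D) (restrict y ?D)"
    then obtain x y where xy: "x \<in> laurents (lattice_cone \<tau>)" "y \<in> laurents (lattice_cone \<tau>)"
      "laurent_fun P ?Z y \<notin> ?Q" "\<phi> = fraction ?R (laurent_fun P ?Z x) (laurent_fun P ?Z y)"
      "\<psi> = fraction (toric_ring P \<rho>) (restrict (laurent_fun P ?Z x) ?D) (restrict (laurent_fun P ?Z y) ?D)"
      unfolding D.carrier_eq by blast
    have "laurent_fun P ?Z 0 \<in> ?Q" unfolding D.Q_eq by (rule imageI) simp
    then have y: "y \<in> laurents (lattice_cone \<tau>) - {0}" using xy by blast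
    have "\<not> 0 < h (lead y)" using D.Q_iff [OF y] xy(3) by simp
    then have "h (lead y) = 0" using D.h_nonneg [OF lead_in_cone [OF y]] by simp
    then have ry: "?res y \<in> laurents (lattice_cone \<rho>) - {0}" using lead_res [OF y] res_mem by simp
    have rs: "?res s \<in> laurents (lattice_cone \<rho>) - {0}" using lead_res [OF s] res_mem by simp
    have "x * s = a * y"
      using xy(4) unfolding \<phi>_eq using D.fraction_\<Psi>_eq_iff [of a s x y] a(1) s(1) xy(1) y by simp
    then have "?res x * ?res s = ?res a * ?res y"
      using res_mult [of x s] res_mult [of a y] xy(1) y a(1) s(1) by simp
    then show "\<psi> = fraction (toric_ring P \<rho>) (laurent_fun P ?D (?res a)) (laurent_fun P ?D (?res s))"
      unfolding xy(5) res [OF xy(1)] res [OF xy(2)]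
      using S.fraction_\<Psi>_eq_iff [OF res_mem ry res_mem rs, of x a] by simp
  qed
  then show ?thesis
    unfolding fun_val_iff [OF \<rho>(1)] using lead_res [OF a] lead_res [OF s] res_mem u_eq
    by (intro bexI [of _ "?res a"] bexI [of _ "?res s"]) auto
qed

text \<open>The recursion keeps the coordinates of the current function along the rest of the flag,
  up to the product of the multiplicities by which it has been raised.\<close>

lemma succ_vanishing_eq:
  fixes \<phi> :: "(int ^ 'n, 'k::field_char_0) ratfun"
  assumes f: "\<And>\<sigma>. \<sigma> \<in> faces P \<Longrightarrow> \<exists>\<kappa>. \<kappa> \<noteq> 0 \<and> f \<sigma> = laurent_fun P (toric_cone P P) (single (M \<sigma>) \<kappa>)"
    and "subflag \<tau>s" "\<tau>s \<noteq> []" "fun_val (next_face \<tau>s) \<phi> u" "B \<noteq> 0"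
  shows "succ_vanishing P f \<tau>s \<phi> B = (\<lambda>\<sigma>. u \<sigma> / of_int B)"
  using assms(2-)
proof (induction \<tau>s arbitrary: \<phi> u B)
  case (Cons \<tau> \<tau>s)
  let ?L = "lattice_points P" and ?Z = "toric_cone P \<tau> :: (int ^ 'n \<Rightarrow> 'k) set" and ?D = "next_cone P \<tau>s :: (int ^ 'n \<Rightarrow> 'k) set"
  let ?R = "toric_ring P \<tau> :: (int ^ 'n, 'k) regfun ring" and ?K = "toric_field P \<tau> :: (int ^ 'n, 'k) ratfun ring"
  note \<tau> = Cons.prems(1) and \<tau>f = subflag_Cons [OF Cons.prems(1)]
  note PP = P_face [OF \<tau>f(2)]
  have K: "?K = frac_field ?R" by (simp add: toric_field_def function_field_def toric_ring_def)
  obtain b h m0 m1 where b: "0 < b" "h (M \<tau>) = b"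
    and h: "\<And>m. m \<in> lattice_cone \<tau> \<Longrightarrow> rat_of_int (h m) = of_int b * coord m \<tau>"
    and div: "monomial_divisor prec ?R (lattice_cone \<tau>) (laurent_fun P ?Z) coord h (vanishing_ideal ?L ?Z ?D) m0 m1"
    using divisor_of_subflag [OF \<tau>, where 'k = 'k] by metis
  interpret D: monomial_divisor prec ?R "lattice_cone \<tau>" "laurent_fun P ?Z" coord h "vanishing_ideal ?L ?Z ?D" m0 m1
    by (rule div)
  have val: "rat_of_int (vanishing_mult ?L ?Z ?D \<phi>) = of_int b * u \<tau>" if \<phi>: "fun_val \<tau> \<phi> u" for \<phi> u
  proof -
    obtain a s where a: "a \<in> laurents (lattice_cone \<tau>) - {0}" and s: "s \<in> laurents (lattice_cone \<tau>) - {0}"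
      and \<phi>: "\<phi> = fraction ?R (laurent_fun P ?Z a) (laurent_fun P ?Z s)"
        "u = (\<lambda>i. coord (lead a) i - coord (lead s) i)"
      using \<phi> unfolding fun_val_iff [OF \<tau>f(2)] by blast
    have "vanishing_mult ?L ?Z ?D \<phi> = h (lead a) - h (lead s)"
      unfolding vanishing_mult_def toric_ring_def [symmetric] \<phi>(1) by (rule D.val_at_eq [OF a s])
    then have "rat_of_int (vanishing_mult ?L ?Z ?D \<phi>) = rat_of_int (h (lead a)) - rat_of_int (h (lead s))"
      by (simp only: of_int_diff)
    then show ?thesis
      unfolding h [OF lead_in_cone [OF a]] h [OF lead_in_cone [OF s]] \<phi>(2) by (simp add: right_diff_distrib)
  qed
  define F where "F = fraction ?R (restrict (f \<tau>) ?Z) \<one>\<^bsub>?R\<^esub>"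
  have F: "fun_val \<tau> F (coord (M \<tau>))"
  proof -
    obtain \<kappa> where \<kappa>: "\<kappa> \<noteq> 0" "f \<tau> = laurent_fun P (toric_cone P P) (single (M \<tau>) \<kappa>)"
      using f \<tau>f(2) by blast
    note M\<tau> = M_in_cone [OF \<tau>f(2)]
    have "\<tau> face_of P" using \<tau>f(2) by (simp add: faces_def)
    then have "single (M \<tau>) \<kappa> \<in> laurents (lattice_cone P)" "\<tau> \<subseteq> P"
      using M\<tau> face_lattice_cone face_of_imp_subset by (blast intro: single_in_laurents)+
    then have "restrict (f \<tau>) ?Z = laurent_fun P ?Z (single (M \<tau>) \<kappa>)"
      unfolding \<kappa>(2) using restrict_laurent_fun [OF \<tau>f(2) PP, of "single (M \<tau>) \<kappa>"] M\<tau>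
      by (simp add: restrict_keys_id)
    then have F_eq: "F = fraction ?R (laurent_fun P ?Z (single (M \<tau>) \<kappa>)) (laurent_fun P ?Z 1)"
      by (simp add: F_def D.\<Psi>_1)
    have "single (M \<tau>) \<kappa> \<noteq> 0" using \<kappa>(1) by (metis lookup_single_eq lookup_zero)
    moreover have "coord (M \<tau>) = (\<lambda>i. coord (lead (single (M \<tau>) \<kappa>)) i - coord (lead (1 :: _ \<Rightarrow>\<^sub>0 'k)) i)"
      using \<kappa>(1) lead_single [of "1::'k" 0] by (simp add: lead_single coord_0)
    ultimately show ?thesis
      unfolding fun_val_iff [OF \<tau>f(2)] using F_eq M\<tau> D.one_in_laurents
      by (intro bexI [of _ "single (M \<tau>) \<kappa>"] bexI [of _ 1]) (auto intro: single_in_laurents)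
  qed
  have cM: "coord (M \<tau>) \<sigma> = (if \<sigma> = \<tau> then 1 else 0)" for \<sigma> by (simp add: coord_M [OF \<tau>f(4)])
  have bF: "vanishing_mult ?L ?Z ?D F = b" using val [OF F] cM by simp
  have \<phi>: "fun_val \<tau> \<phi> u" using Cons.prems(3) by simp
  define k where "k = vanishing_mult ?L ?Z ?D \<phi>"
  have k: "rat_of_int k = of_int b * u \<tau>" unfolding k_def by (rule val [OF \<phi>])
  define \<psi> where "\<psi> = (\<phi> [^]\<^bsub>?K\<^esub> b) \<otimes>\<^bsub>?K\<^esub> inv\<^bsub>?K\<^esub> (F [^]\<^bsub>?K\<^esub> k)"
  define v where "v = (\<lambda>\<sigma>. of_int b * u \<sigma> + - (of_int k * coord (M \<tau>) \<sigma>))"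
  have \<psi>: "fun_val \<tau> \<psi> v"
    unfolding \<psi>_def v_def K fun_val_def
    using \<phi> F unfolding fun_val_def by (intro D.has_val_mult D.has_val_inv D.has_val_int_pow)
  have v: "v \<tau> = 0" "\<And>\<sigma>. \<sigma> \<noteq> \<tau> \<Longrightarrow> v \<sigma> = of_int b * u \<sigma>" by (auto simp: v_def cM k)
  have rec: "succ_vanishing P f (\<tau> # \<tau>s) \<phi> B =
      (succ_vanishing P f \<tau>s (rat_restrict ?L ?Z ?D \<psi>) (B * b)) (\<tau> := of_int k / of_int (B * b))"
    by (simp add: Let_def bF [unfolded F_def] k_def \<psi>_def F_def)
  have head: "of_int k / of_int (B * b) = u \<tau> / of_int B" using b(1) by (simp add: k)
  have tail: "succ_vanishing P f \<tau>s (rat_restrict ?L ?Z ?D \<psi>) (B * b) \<sigma> = u \<sigma> / of_int B"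
    if \<sigma>: "\<sigma> \<noteq> \<tau>" for \<sigma>
  proof (cases \<tau>s)
    case Nil
    then show ?thesis using fun_val_support [OF \<tau> \<phi>, of \<sigma>] \<sigma> by simp
  next
    case (Cons \<rho> \<rho>s)
    have "fun_val (next_face \<tau>s) (rat_restrict ?L ?Z ?D \<psi>) v"
      using fun_val_restrict [OF _ \<psi> v(1)] \<tau> unfolding Cons by (simp add: next_cone_def)
    then have "succ_vanishing P f \<tau>s (rat_restrict ?L ?Z ?D \<psi>) (B * b) = (\<lambda>\<sigma>. v \<sigma> / of_int (B * b))"
      using Cons b(1) Cons.prems(4) by (intro Cons.IH \<tau>f(1)) auto
    then show ?thesis using v(2) [OF \<sigma>] b(1) by simp
  qed
  show ?case unfolding rec using head tail by (auto simp: fun_eq_iff)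
qed simp

end


section \<open>The two quasi-valuations agree on every maximal chain\<close>

text \<open>Both sides are the coordinates of the leading exponent of \<open>g\<close>: the left one by the recursion, the
  right one because the weight components of \<open>g\<close> are its monomials.\<close>

lemma chain_values_agree:
  fixes P :: "(real ^ 'n) set"
    and f :: "(real ^ 'n) set \<Rightarrow> (int ^ 'n, 'k :: field_char_0) regfun"
    and g :: "(int ^ 'n, 'k) regfun"
  assumes P: "lattice_polytope P" "aff_dim P = int CARD('n)" "normal_polytope P"
    and f: "comb_seshadri_strat P f" and t: "linearization P t"
    and g: "g \<in> carrier (toric_ring P P) - {\<zero>\<^bsub>toric_ring P P\<^esub>}"
    and C: "C \<in> max_chains P"
  shows "V_chain P f C (fraction (toric_ring P P) g \<one>\<^bsub>toric_ring P P\<^esub>) = nu_chain P f t C g"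
proof -
  interpret normal_lattice_polytope P by unfold_locales (fact P)+
  have poly: "polytope P" using P(1) unfolding lattice_polytope_def polytope_def by blast
  have nonempty: "P \<noteq> {}" using P(2) by auto
  have face: "P face_of P" using convex_P by (rule face_of_refl)
  have PP: "P \<in> faces P" using face nonempty by (simp add: faces_def)
  define M where "M \<sigma> = - weight P (f \<sigma>)" for \<sigma>
  have strat: "interior_vec \<sigma> (real_hat (M \<sigma>)) \<and>
      (\<exists>\<kappa>. \<kappa> \<noteq> 0 \<and> f \<sigma> = laurent_fun P (toric_cone P P) (single (M \<sigma>) \<kappa>))"
    if \<sigma>: "\<sigma> \<in> faces P" for \<sigma>
  proof
    let ?d = "real (deg P (f \<sigma>))"
    have f\<sigma>: "eigenfunction P (f \<sigma>)" "1 \<le> deg P (f \<sigma>)"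
      "(- 1 / ?d) *\<^sub>R real_hat (weight P (f \<sigma>)) \<in> {1} \<times> rel_interior \<sigma>"
      using f \<sigma> unfolding comb_seshadri_strat_def by auto
    have d: "0 < ?d" using f\<sigma>(2) by simp
    have "(1 / ?d) *\<^sub>R real_hat (M \<sigma>) \<in> {1} \<times> rel_interior \<sigma>"
      using f\<sigma>(3) by (simp add: M_def real_hat_minus)
    then have "fst (real_hat (M \<sigma>)) = ?d" "(1 / ?d) *\<^sub>R snd (real_hat (M \<sigma>)) \<in> rel_interior \<sigma>"
      using d by (auto simp: mem_Times_iff field_simps)
    moreover have "\<sigma> \<noteq> {}" using \<sigma> by (simp add: faces_def)
    ultimately show "interior_vec \<sigma> (real_hat (M \<sigma>))" using d by (simp add: interior_vec_def)
    obtain m \<kappa> where "m \<in> lattice_cone P" "\<kappa> \<noteq> 0" "f \<sigma> = laurent_fun P (toric_cone P P) (single m \<kappa>)"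
      using f\<sigma>(1) unfolding eigenfunction_iff [OF PP] by blast
    moreover from this have "M \<sigma> = m" using weight_monomial [OF PP, of \<kappa> m] by (simp add: M_def)
    ultimately show "\<exists>\<kappa>. \<kappa> \<noteq> 0 \<and> f \<sigma> = laurent_fun P (toric_cone P P) (single (M \<sigma>) \<kappa>)"
      by blast
  qed
  note chain = max_chain_flag [OF poly nonempty C]
  have fin: "finite (faces P)"
    using finite_subset [OF _ finite_polytope_faces [OF poly]] by (auto simp: faces_def)
  interpret weighted_flag P t M "desc_list C"
    using t fin P(2) strat chain by unfold_locales (auto simp: linearization_def)
  interpret R: semigroup_ring prec "toric_ring P P" "lattice_cone P"
    "laurent_fun P (toric_cone P P) :: (_ \<Rightarrow>\<^sub>0 'k) \<Rightarrow> _" coord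
    by (rule toric_ring_flag [OF PP])
  obtain q where q: "q \<in> laurents (lattice_cone P) - {0}" "g = laurent_fun P (toric_cone P P) q"
    using g unfolding R.carrier_nonzero by blast
  have "fun_val P (fraction (toric_ring P P) g \<one>\<^bsub>toric_ring P P\<^esub>) (coord (lead q))"
    unfolding fun_val_iff [OF PP] using q R.one_in_laurents R.\<Psi>_1 lead_single [of "1::'k" 0]
    by (intro bexI [of _ q] bexI [of _ 1]) (auto simp: coord_0)
  then have val: "fun_val (next_face (desc_list C)) (fraction (toric_ring P P) g \<one>\<^bsub>toric_ring P P\<^esub>) (coord (lead q))"
    by (simp add: chain(4))
  have nonnil: "desc_list C \<noteq> []" using chain(4) nonempty by (auto simp: next_face_def)
  have f_mono: "\<exists>\<kappa>. \<kappa> \<noteq> 0 \<and> f \<sigma> = laurent_fun P (toric_cone P P) (single (M \<sigma>) \<kappa>)"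
    if "\<sigma> \<in> faces P" for \<sigma>
    using strat [OF that] by (rule conjunct2)
  have V: "V_chain P f C (fraction (toric_ring P P) g \<one>\<^bsub>toric_ring P P\<^esub>) = coord (lead q)"
    unfolding V_chain_def using succ_vanishing_eq [OF f_mono subflag_ts nonnil val, of 1] by simp
  have coords: "weight_coords P f C (laurent_fun P (toric_cone P P) (single m \<kappa>)) = coord m"
    if "\<kappa> \<noteq> 0" "m \<in> lattice_cone P" for m and \<kappa> :: 'k
  proof -
    have "real_hat (weight P (f \<tau>)) = - real_hat (M \<tau>)" for \<tau> by (simp add: M_def real_hat_minus)
    then show ?thesis
      unfolding weight_coords_def coord_def chain(2) weight_monomial [OF PP that]
      by (simp add: real_hat_minus sum_negf)
  qed
  have "weight_coords P f C ` weight_components P g = coord ` keys q"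
  proof -
    have mem: "m \<in> lattice_cone P" "lookup q m \<noteq> 0" if "m \<in> keys q" for m
      using q(1) that by (auto simp: laurents_def in_keys_iff)
    have "weight_components P g = (\<lambda>m. laurent_fun P (toric_cone P P) (single m (lookup q m))) ` keys q"
      unfolding q(2) using q(1) by (intro weight_components_laurent_fun [OF PP]) simp
    then show ?thesis by (simp only: image_image) (intro image_cong refl coords mem)
  qed
  then have "nu_chain P f t C g = lex_min (faces P) t (coord ` keys q)"
    by (simp add: nu_chain_def)
  also have "\<dots> = coord (lead q)"
  proof (rule lex_min_eqI)
    have lead: "is_lead q (lead q)" using q(1) by (intro is_lead_lead) simp
    then show "coord (lead q) \<in> coord ` keys q" by (auto simp: is_lead_def)
    fix v assume "v \<in> coord ` keys q"
    then obtain m where "m \<in> keys q" "v = coord m" by blast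
    then show "v = coord (lead q) \<or> lex_less (faces P) t (coord (lead q)) v"
      using lead by (auto simp: is_lead_def prec_def)
  qed
  finally show ?thesis using V by simp
qed

theorem corollary7p16:
  fixes P :: "(real ^ 'n) set"
    and f :: "(real ^ 'n) set \<Rightarrow> (int ^ 'n, 'k :: {alg_closed_field, field_char_0}) regfun"
    and t :: "(real ^ 'n) set rel"
    and g :: "(int ^ 'n, 'k) regfun"
  assumes "lattice_polytope P" and "aff_dim P = int CARD('n)" and "normal_polytope P"
    and "comb_seshadri_strat P f"
    and "linearization P t"
    and "g \<in> carrier (toric_ring P P) - {\<zero>\<^bsub>toric_ring P P\<^esub>}"
  shows "quasi_V P f t g = quasi_nu P f t g"
proof -
  have "{V_chain P f C (fraction (toric_ring P P) g \<one>\<^bsub>toric_ring P P\<^esub>) | C. C \<in> max_chains P}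
      = {nu_chain P f t C g | C. C \<in> max_chains P}"
    unfolding Setcompr_eq_image by (intro image_cong refl chain_values_agree [OF assms])
  then show ?thesis unfolding quasi_V_def quasi_nu_def by simp
qed

end
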